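(* For every nilpotent Lie algebra $\mathfrak{g}$ of dimension $\le 9$ over a field of characteristic $0$, the reduced Koszul map $\bar\eta:H_3(\mathfrak{g})\to\mathrm{Kill}(\mathfrak{g})$ vanishes.
   Context: Tensor, exterior and symmetric powers are over the ground field. $H_*(\mathfrak{g})$ is the homology of the Chevalley–Eilenberg complex $\Lambda^*\mathfrak{g}$ with $\partial_n(x_1\wedge\dots\wedge x_n)=\sum_{i<j}(-1)^{i+j}[x_i,x_j]\wedge x_1\wedge\dots\wedge\hat{x_i}\wedge\dots\wedge\hat{x_j}\wedge\dots\wedge x_n$, and $Z_3(\mathfrak{g})=\ker\partial_3$. Writing $x\odot y$ for the product in the symmetric square $S^2\mathfrak{g}$, the Killing module $\mathrm{Kill}(\mathfrak{g})$ is the cokernel of $\mathfrak{g}^{\otimes 3}\to S^2\mathfrak{g}$, $x\otimes y\otimes z\mapsto [x,y]\odot z-x\odot[y,z]$. The Koszul map $\eta:\Lambda^3\mathfrak{g}\to\mathrm{Kill}(\mathfrak{g})$ sends $x\wedge y\wedge z$ to the class of $x\odot[y,z]$; it vanishes on 3-boundaries, and the reduced Koszul map $\bar\eta$ is induced by restricting $\eta$ to $Z_3(\mathfrak{g})$. *)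

theory Defs
  imports Complex_Main "HOL-Library.Poly_Mapping" "HOL-Library.Set_Algebras" "HOL-Library.Multiset"
begin

section \<open>Free vector spaces and quotients\<close>

text \<open>
  The finitely supported functions \<open>'x \<Rightarrow>\<^sub>0 'k\<close> form the vector space with basis
  \<open>'x\<close>, the basis vector of \<open>x\<close> being \<open>Poly_Mapping.single x 1\<close>.
\<close>

definition fscale :: "'k::field \<Rightarrow> ('x \<Rightarrow>\<^sub>0 'k) \<Rightarrow> ('x \<Rightarrow>\<^sub>0 'k)" where
  "fscale c p = Poly_Mapping.map ((*) c) p"

lemma lookup_fscale [simp]:
  "Poly_Mapping.lookup (fscale c p) x = c * Poly_Mapping.lookup p x"
  unfolding fscale_def by transfer (simp add: when_def)

lemma vector_space_fscale: "vector_space (fscale :: 'k::field \<Rightarrow> ('x \<Rightarrow>\<^sub>0 'k) \<Rightarrow> _)"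
  by unfold_locales
    (auto intro!: poly_mapping_eqI simp: lookup_add algebra_simps)

abbreviation fspan :: "('x \<Rightarrow>\<^sub>0 'k::field) set \<Rightarrow> ('x \<Rightarrow>\<^sub>0 'k) set" where
  "fspan \<equiv> module.span fscale"

abbreviation basis_vec :: "'x \<Rightarrow> ('x \<Rightarrow>\<^sub>0 'k::field)" where
  "basis_vec x \<equiv> Poly_Mapping.single x 1"

definition lin_ext :: "('x \<Rightarrow> ('y \<Rightarrow>\<^sub>0 'k::field)) \<Rightarrow> ('x \<Rightarrow>\<^sub>0 'k) \<Rightarrow> ('y \<Rightarrow>\<^sub>0 'k)" where
  "lin_ext f p = (\<Sum>x\<in>Poly_Mapping.keys p. fscale (Poly_Mapping.lookup p x) (f x))"

text \<open>
  The quotient \<open>V / U\<close> is the set of cosets \<open>v +o U\<close>.  As sets are added elementwise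
  (\<open>HOL-Library.Set_Algebras\<close>), this also makes sense when the elements of \<open>V\<close> are themselves
  cosets, so that quotients of quotients can be formed.
\<close>

definition quotient_space :: "'v::plus set \<Rightarrow> 'v set \<Rightarrow> 'v set set" where
  "quotient_space V U = (\<lambda>v. v +o U) ` V"

text \<open>
  The map induced on a quotient by a map \<open>f\<close> that is constant on cosets: it sends a coset to the
  common value of \<open>f\<close> on its elements.
\<close>

definition induced :: "('v \<Rightarrow> 'w) \<Rightarrow> 'v set \<Rightarrow> 'w" where
  "induced f A = the_elem (f ` A)"


section \<open>Tensor, exterior and symmetric powers\<close>

text \<open>
  All three are quotients of the vector space with basis the \<open>n\<close>-tuples of vectors, represented
  as lists of length \<open>n\<close>.
\<close>

definition tuple_space :: "nat \<Rightarrow> ('g list \<Rightarrow>\<^sub>0 'k::field) set" where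
  "tuple_space n = {p. \<forall>xs\<in>Poly_Mapping.keys p. length xs = n}"

definition multilinear_rels ::
  "('k::field \<Rightarrow> 'g::ab_group_add \<Rightarrow> 'g) \<Rightarrow> nat \<Rightarrow> ('g list \<Rightarrow>\<^sub>0 'k) set" where
  "multilinear_rels scale n =
     {basis_vec (xs @ (x + y) # ys) - basis_vec (xs @ x # ys) - basis_vec (xs @ y # ys)
        | xs x y ys. length xs + 1 + length ys = n} \<union>
     {basis_vec (xs @ scale c x # ys) - fscale c (basis_vec (xs @ x # ys))
        | xs c x ys. length xs + 1 + length ys = n}"

definition tensor_null ::
  "('k::field \<Rightarrow> 'g::ab_group_add \<Rightarrow> 'g) \<Rightarrow> nat \<Rightarrow> ('g list \<Rightarrow>\<^sub>0 'k) set" where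
  "tensor_null scale n = fspan (multilinear_rels scale n)"

definition ext_null ::
  "('k::field \<Rightarrow> 'g::ab_group_add \<Rightarrow> 'g) \<Rightarrow> nat \<Rightarrow> ('g list \<Rightarrow>\<^sub>0 'k) set" where
  "ext_null scale n = fspan (multilinear_rels scale n \<union>
     {basis_vec xs | xs. length xs = n \<and> \<not> distinct xs})"

definition sym_null ::
  "('k::field \<Rightarrow> 'g::ab_group_add \<Rightarrow> 'g) \<Rightarrow> nat \<Rightarrow> ('g list \<Rightarrow>\<^sub>0 'k) set" where
  "sym_null scale n = fspan (multilinear_rels scale n \<union>
     {basis_vec xs - basis_vec ys | xs ys. length xs = n \<and> mset xs = mset ys})"

definition tensor_power ::
  "('k::field \<Rightarrow> 'g::ab_group_add \<Rightarrow> 'g) \<Rightarrow> nat \<Rightarrow> ('g list \<Rightarrow>\<^sub>0 'k) set set" where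
  "tensor_power scale n = quotient_space (tuple_space n) (tensor_null scale n)"

definition ext_power ::
  "('k::field \<Rightarrow> 'g::ab_group_add \<Rightarrow> 'g) \<Rightarrow> nat \<Rightarrow> ('g list \<Rightarrow>\<^sub>0 'k) set set" where
  "ext_power scale n = quotient_space (tuple_space n) (ext_null scale n)"

definition sym_power ::
  "('k::field \<Rightarrow> 'g::ab_group_add \<Rightarrow> 'g) \<Rightarrow> nat \<Rightarrow> ('g list \<Rightarrow>\<^sub>0 'k) set set" where
  "sym_power scale n = quotient_space (tuple_space n) (sym_null scale n)"


section \<open>Lie algebras, homology and the Koszul map\<close>

locale lie_algebra = vector_space scale
  for scale :: "'k::field \<Rightarrow> 'g::ab_group_add \<Rightarrow> 'g" +
  fixes bracket :: "'g \<Rightarrow> 'g \<Rightarrow> 'g"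
  assumes bracket_linear_right: "Vector_Spaces.linear scale scale (\<lambda>y. bracket x y)"
    and bracket_linear_left: "Vector_Spaces.linear scale scale (\<lambda>x. bracket x y)"
    and bracket_self: "bracket x x = 0"
    and jacobi: "bracket x (bracket y z) + bracket y (bracket z x) + bracket z (bracket x y) = 0"
begin

primrec lower_central :: "nat \<Rightarrow> 'g set" where
  "lower_central 0 = UNIV"
| "lower_central (Suc n) = span {bracket x y | x y. y \<in> lower_central n}"

definition nilpotent :: bool where
  "nilpotent \<longleftrightarrow> (\<exists>n. lower_central n = {0})"

text \<open>
  The Chevalley--Eilenberg differential on a tuple.  Positions are counted from 0, which does not
  change the parity of \<open>i + j\<close>; \<open>nths xs (- {i, j})\<close> omits the entries at \<open>i\<close> and \<open>j\<close>.
\<close>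

definition boundary_tuple :: "'g list \<Rightarrow> ('g list \<Rightarrow>\<^sub>0 'k)" where
  "boundary_tuple xs =
     (\<Sum>(i, j)\<in>{(i, j). i < j \<and> j < length xs}.
        fscale ((-1) ^ (i + j)) (basis_vec (bracket (xs ! i) (xs ! j) # nths xs (- {i, j}))))"

definition boundary :: "nat \<Rightarrow> ('g list \<Rightarrow>\<^sub>0 'k) set \<Rightarrow> ('g list \<Rightarrow>\<^sub>0 'k) set" where
  "boundary n = induced (\<lambda>p. lin_ext boundary_tuple p +o ext_null scale (n - 1))"

definition cycles :: "nat \<Rightarrow> ('g list \<Rightarrow>\<^sub>0 'k) set set" where
  "cycles n = {z \<in> ext_power scale n. boundary n z = 0 +o ext_null scale (n - 1)}"

definition boundaries :: "nat \<Rightarrow> ('g list \<Rightarrow>\<^sub>0 'k) set set" where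
  "boundaries n = boundary (n + 1) ` ext_power scale (n + 1)"

definition homology :: "nat \<Rightarrow> ('g list \<Rightarrow>\<^sub>0 'k) set set set" where
  "homology n = quotient_space (cycles n) (boundaries n)"

definition killing_map :: "('g list \<Rightarrow>\<^sub>0 'k) set \<Rightarrow> ('g list \<Rightarrow>\<^sub>0 'k) set" where
  "killing_map =
     induced (\<lambda>p. lin_ext (\<lambda>xs. basis_vec [bracket (xs ! 0) (xs ! 1), xs ! 2]
                             - basis_vec [xs ! 0, bracket (xs ! 1) (xs ! 2)]) p +o sym_null scale 2)"

definition killing_null :: "('g list \<Rightarrow>\<^sub>0 'k) set set" where
  "killing_null = killing_map ` tensor_power scale 3"

definition killing_module :: "('g list \<Rightarrow>\<^sub>0 'k) set set set" where
  "killing_module = quotient_space (sym_power scale 2) killing_null"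

text \<open>
  The class in \<open>Kill(g) = S\<^sup>2 g / killing_null\<close> of the element of \<open>S\<^sup>2 g\<close> represented by \<open>p\<close>;
  \<open>killing_class 0\<close> is the zero of \<open>Kill(g)\<close>.
\<close>

definition killing_class :: "('g list \<Rightarrow>\<^sub>0 'k) \<Rightarrow> ('g list \<Rightarrow>\<^sub>0 'k) set set" where
  "killing_class p = (p +o sym_null scale 2) +o killing_null"

definition koszul_map :: "('g list \<Rightarrow>\<^sub>0 'k) set \<Rightarrow> ('g list \<Rightarrow>\<^sub>0 'k) set set" where
  "koszul_map =
     induced (\<lambda>p. killing_class
       (lin_ext (\<lambda>xs. basis_vec [xs ! 0, bracket (xs ! 1) (xs ! 2)]) p))"

definition reduced_koszul_map :: "('g list \<Rightarrow>\<^sub>0 'k) set set \<Rightarrow> ('g list \<Rightarrow>\<^sub>0 'k) set set" where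
  "reduced_koszul_map = induced koszul_map"

end

end

theory Submission
  imports Defs
begin

text \<open>
  A linear functional on \<open>Kill(g)\<close> is an invariant symmetric bilinear form \<open>B\<close>, and its composition with the Koszul
  map is the 3-cocycle \<open>om x y z = B [x, y] z\<close>. So it suffices to show that \<open>om\<close> is a coboundary for every \<open>B\<close>.

  Let \<open>Z\<close> be the orthogonal of \<open>[g, g]\<close>. Then \<open>om\<close> only depends on \<open>V \<oplus> W\<close>, where \<open>V\<close> is a complement of
  \<open>[g, g] + Z\<close>, of dimension \<open>R\<close>, and \<open>W = [g, g] / ([g, g] \<inter> Z)\<close>, on which \<open>B\<close> is nondegenerate. As \<open>V\<close> is dual to
  a subspace of \<open>[g, g] \<inter> Z\<close>, the bound on the dimension gives \<open>2 R + dim W \<le> 9\<close>, so \<open>R \<le> 4\<close>. Nilpotency makes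
  \<open>W\<close> abelian, and \<open>V\<close> acts on it by commuting nilpotent skew operators. For \<open>R = 2\<close> the module \<open>W\<close> is cyclic over
  \<open>K[X, Y]\<close>, of dimension at most 5; for \<open>R = 3\<close> it has dimension at most 3 and only one direction of \<open>V\<close> acts;
  for \<open>R = 4\<close> it has dimension at most 1; and for \<open>R \<le> 1\<close> it is zero. In each case a primitive of \<open>om\<close> is a combination of wedge
  products of the 1-forms dual to \<open>V\<close>, which are closed, and the 1-forms \<open>B a\<close>.
\<close>

section \<open>Invariant forms and exact 3-forms\<close>

text \<open>\<open>W\<close> is never formed: \<open>Z\<close> is an ideal, \<open>om\<close>
  vanishes once an argument lies in \<open>Z\<close>, and statements about \<open>W\<close> become
  memberships modulo \<open>Z\<close>. The main obstacle appears for R = 2. With u = [e1, e2] and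
  dual forms f1, f2, the exact forms f_i \<and> om e_i add up to om plus a surplus f1 \<and> f2
  \<and> b u, where b a denotes B a made to vanish on e1 and e2. As f1 \<and> f2 \<and> b a is exact
  for all a in e1 W + e2 W and u generates W, only this surplus is left. Differentials of products b
  a \<and> b c of two non-closed forms dispose of it: modulo exact forms they yield its multiple by
  -3 or by 6 B(e1^4 u, u), and characteristic 0 permits the division. Over an arbitrary field no
  normal form of the pair e1, e2 is used. The split is by the quartic v -> B(v^2 u, v^2 u): if it
  has a nonzero value, W is a single Jordan block of size 5 for some v; if it vanishes, words of
  length 3 kill u modulo Z.\<close>

context lie_algebra
begin

lemma br_add_right: "bracket x (y + z) = bracket x y + bracket x z"
  and br_scale_right: "bracket x (scale c y) = scale c (bracket x y)"
  and br_add_left: "bracket (x + y) z = bracket x z + bracket y z"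
  and br_scale_left: "bracket (scale c x) y = scale c (bracket x y)"
  using bracket_linear_right[of x] bracket_linear_left[of z] bracket_linear_left[of y]
  by (simp_all add: Vector_Spaces.linear_iff)

lemma br_skew: "bracket x y = - bracket y x"
proof -
  have "0 = bracket (x + y) (x + y)" by (simp only: bracket_self)
  also have "\<dots> = bracket x y + bracket y x" by (simp only: br_add_left br_add_right) (simp add: bracket_self)
  finally show ?thesis by (metis add_eq_0_iff2)
qed

end

locale quadratic_lie =
  lie_algebra scale bracket + finite_dimensional_vector_space scale Basis
  for scale :: "'k::field_char_0 \<Rightarrow> 'g::ab_group_add \<Rightarrow> 'g" (infixr "*s" 75)
    and bracket :: "'g \<Rightarrow> 'g \<Rightarrow> 'g" (infixl "\<star>" 70)
    and Basis :: "'g set" +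
  fixes B :: "'g \<Rightarrow> 'g \<Rightarrow> 'k"
  assumes B_add: "B (x + y) z = B x z + B y z"
    and B_scale: "B (c *s x) y = c * B x y"
    and B_sym: "B x y = B y x"
    and B_inv: "B (x \<star> y) z = B x (y \<star> z)"
begin

lemma br_zero [simp]: "0 \<star> x = 0" "x \<star> 0 = 0"
  using br_scale_left[of 0 x x] br_scale_right[of x 0 x] by simp_all

lemma br_minus_left: "(- x) \<star> y = - (x \<star> y)" and br_minus_right: "x \<star> (- y) = - (x \<star> y)"
  using br_scale_left[of "-1" x y] br_scale_right[of x "-1" y] by simp_all

lemma br_diff_left: "(x - y) \<star> z = x \<star> z - y \<star> z"
  and br_diff_right: "x \<star> (y - z) = x \<star> y - x \<star> z"
  using br_add_left[of x "- y" z] br_add_right[of x y "- z"]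
  by (simp_all add: br_minus_left br_minus_right)

lemmas br_lin = br_add_left br_add_right br_diff_left br_diff_right br_minus_left br_minus_right
  br_scale_left br_scale_right

lemma jacobi_left: "x \<star> (y \<star> z) = (x \<star> y) \<star> z + y \<star> (x \<star> z)"
  using jacobi[of x y z] br_skew[of "x \<star> y" z] br_skew[of z x]
  by (simp add: br_minus_right algebra_simps)

lemma B_add_right: "B x (y + z) = B x y + B x z"
  by (metis B_add B_sym)

lemma B_scale_right: "B x (c *s y) = c * B x y"
  by (metis B_scale B_sym)

lemma B_zero [simp]: "B 0 x = 0" "B x 0 = 0"
  using B_scale[of 0 x x] B_scale_right[of x 0 x] by simp_all

lemma B_minus: "B (- x) y = - B x y" and B_minus_right: "B x (- y) = - B x y"
  using B_scale[of "-1" x y] B_scale_right[of x "-1" y] by simp_all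

lemma B_diff: "B (x - y) z = B x z - B y z" and B_diff_right: "B x (y - z) = B x y - B x z"
  using B_add[of x "- y" z] B_add_right[of x y "- z"] by (simp_all add: B_minus B_minus_right)

lemmas B_lin = B_add B_add_right B_diff B_diff_right B_minus B_minus_right B_scale B_scale_right

text \<open>Invariance makes every operator \<open>x \<star> _\<close> skew for \<open>B\<close>.
  Iterated, this gives the signs behind all the vanishing arguments below.\<close>

lemma B_ad: "B (x \<star> y) z = - B y (x \<star> z)"
  by (metis B_inv B_minus br_skew)

definition om :: "'g \<Rightarrow> 'g \<Rightarrow> 'g \<Rightarrow> 'k" where
  "om x y z = B (x \<star> y) z"

lemma om_rot: "om x y z = om y z x"
  unfolding om_def by (metis B_inv B_sym)

lemma om_swap: "om y x z = - om x y z" "om x z y = - om x y z" "om z y x = - om x y z"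
proof -
  show 1: "om y x z = - om x y z" for x y z
    unfolding om_def using br_skew[of x y] B_minus by simp
  show "om x z y = - om x y z" "om z y x = - om x y z"
    using 1 om_rot by metis+
qed

lemma om_self [simp]: "om x x y = 0" "om x y x = 0" "om y x x = 0"
  using om_rot[of x x y] om_rot[of y x x] by (simp_all add: om_def bracket_self)

lemma om_lin:
  "om (x + x') y z = om x y z + om x' y z" "om x (y + y') z = om x y z + om x y' z"
  "om x y (z + z') = om x y z + om x y z'"
  "om (x - x') y z = om x y z - om x' y z" "om x (y - y') z = om x y z - om x y' z"
  "om x y (z - z') = om x y z - om x y z'"
  "om (- x) y z = - om x y z" "om x (- y) z = - om x y z" "om x y (- z) = - om x y z"
  "om (c *s x) y z = c * om x y z" "om x (c *s y) z = c * om x y z" "om x y (c *s z) = c * om x y z"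
  by (simp_all add: om_def br_lin B_lin)

lemma om_zero [simp]: "om 0 y z = 0" "om x 0 z = 0" "om x y 0 = 0"
  by (simp_all add: om_def)

lemma B_br: "B a (x \<star> y) = om a x y"
  by (simp add: om_def B_inv)

definition linform :: "('g \<Rightarrow> 'k) \<Rightarrow> bool" where
  "linform f \<longleftrightarrow> (\<forall>x y. f (x + y) = f x + f y) \<and> (\<forall>c x. f (c *s x) = c * f x)"

lemma linform_add: "linform f \<Longrightarrow> f (x + y) = f x + f y"
  and linform_scale: "linform f \<Longrightarrow> f (c *s x) = c * f x"
  by (simp_all add: linform_def)

lemma linform_diff: "linform f \<Longrightarrow> f (x - y) = f x - f y"
  using linform_add[of f "x - y" y] by simp

lemma linform_B: "linform (B a)"
  by (simp add: linform_def B_lin)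

definition alt_form :: "('g \<Rightarrow> 'g \<Rightarrow> 'k) \<Rightarrow> bool" where
  "alt_form \<alpha> \<longleftrightarrow> (\<forall>y. linform (\<lambda>x. \<alpha> x y)) \<and> (\<forall>x. linform (\<alpha> x)) \<and> (\<forall>x. \<alpha> x x = 0)"

text \<open>
  A 1-form \<open>\<xi>\<close> has differential \<open>\<xi> (x \<star> y)\<close>; \<open>exact \<Phi>\<close> says that \<open>\<Phi>\<close> is, up to sign, the
  Chevalley--Eilenberg differential of an alternating 2-form.
\<close>

definition exact :: "('g \<Rightarrow> 'g \<Rightarrow> 'g \<Rightarrow> 'k) \<Rightarrow> bool" where
  "exact \<Phi> \<longleftrightarrow> (\<exists>\<alpha>. alt_form \<alpha> \<and>
     (\<forall>x y z. \<Phi> x y z = \<alpha> (x \<star> y) z + \<alpha> (y \<star> z) x + \<alpha> (z \<star> x) y))"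

lemma exact_cong: "exact \<Phi> \<Longrightarrow> (\<And>x y z. \<Psi> x y z = \<Phi> x y z) \<Longrightarrow> exact \<Psi>"
  unfolding exact_def by simp

lemma exact_add: 
  assumes "exact \<Phi>" "exact \<Psi>"
  shows "exact (\<lambda>x y z. \<Phi> x y z + \<Psi> x y z)"
proof -
  obtain \<alpha> \<beta> where a: "alt_form \<alpha>" "\<And>x y z. \<Phi> x y z = \<alpha> (x \<star> y) z + \<alpha> (y \<star> z) x + \<alpha> (z \<star> x) y"
    and b: "alt_form \<beta>" "\<And>x y z. \<Psi> x y z = \<beta> (x \<star> y) z + \<beta> (y \<star> z) x + \<beta> (z \<star> x) y"
    using assms unfolding exact_def by metis
  have "alt_form (\<lambda>x y. \<alpha> x y + \<beta> x y)"
    using a(1) b(1) unfolding alt_form_def linform_def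
    by (auto simp: algebra_simps)
  then show ?thesis unfolding exact_def
    by (rule_tac exI[of _ "\<lambda>x y. \<alpha> x y + \<beta> x y"]) (simp add: a(2) b(2))
qed

lemma exact_scale: 
  assumes "exact \<Phi>"
  shows "exact (\<lambda>x y z. c * \<Phi> x y z)"
proof -
  obtain \<alpha> where a: "alt_form \<alpha>" "\<And>x y z. \<Phi> x y z = \<alpha> (x \<star> y) z + \<alpha> (y \<star> z) x + \<alpha> (z \<star> x) y"
    using assms unfolding exact_def by metis
  have "alt_form (\<lambda>x y. c * \<alpha> x y)"
    using a(1) unfolding alt_form_def linform_def
    by (auto simp: algebra_simps)
  then show ?thesis unfolding exact_def
    by (rule_tac exI[of _ "\<lambda>x y. c * \<alpha> x y"]) (simp add: a(2) algebra_simps)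
qed

lemma exact_zero: "exact (\<lambda>x y z. 0)"
  unfolding exact_def alt_form_def linform_def by (rule exI[of _ "\<lambda>x y. 0"]) simp

text \<open>Leibniz rule for the primitive \<open>f \<and> g\<close>, spelled out as a cyclic
  sum.\<close>

lemma exact_wedge:
  assumes "linform f" "linform g"
  shows "exact (\<lambda>x y z. f (x \<star> y) * g z - g (x \<star> y) * f z + (f (y \<star> z) * g x - g (y \<star> z) * f x)
     + (f (z \<star> x) * g y - g (z \<star> x) * f y))"
proof -
  have "alt_form (\<lambda>x y. f x * g y - g x * f y)"
    using assms unfolding alt_form_def linform_def by (auto simp: algebra_simps)
  then show ?thesis unfolding exact_def by blast
qed

text \<open>For closed \<open>f\<close> the Leibniz rule leaves only \<open>f \<and> dg\<close>, up
  to sign. With \<open>g = B a\<close> the differential \<open>dg\<close> is \<open>om a\<close> by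
  \<open>B_br\<close>, which makes this the main source of exact forms.\<close>

lemma exact_closed:
  assumes "linform f" "linform g" "\<And>x y. f (x \<star> y) = 0"
  shows "exact (\<lambda>x y z. f x * g (y \<star> z) + f y * g (z \<star> x) + f z * g (x \<star> y))"
  by (rule exact_cong[OF exact_scale[OF exact_wedge[OF assms(1,2)], of "-1"]])
    (simp add: assms(3) algebra_simps)

definition wedge :: "('g \<Rightarrow> 'k) \<Rightarrow> ('g \<Rightarrow> 'k) \<Rightarrow> 'g \<Rightarrow> 'g \<Rightarrow> 'k" where
  "wedge f g x y = f x * g y - g x * f y"

definition wedge21 :: "('g \<Rightarrow> 'k) \<Rightarrow> ('g \<Rightarrow> 'g \<Rightarrow> 'k) \<Rightarrow> 'g \<Rightarrow> 'g \<Rightarrow> 'g \<Rightarrow> 'k" where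
  "wedge21 f Q x y z = f x * Q y z + f y * Q z x + f z * Q x y"

lemma exact_cancel: "exact (\<lambda>x y z. c * \<Phi> x y z) \<Longrightarrow> c \<noteq> 0 \<Longrightarrow> exact \<Phi>"
  by (rule exact_cong[OF exact_scale[where c = "inverse c"]]) (auto simp: field_simps)

section \<open>The derived algebra and its orthogonal\<close>

declare lower_central.simps(2) [simp del] One_nat_def [simp del]

text \<open>Indices start at 0, so \<open>L 1\<close> is \<open>[g, g]\<close> and
  \<open>L n\<close> is spanned by brackets of \<open>n + 1\<close> elements; hence the
  \<open>Suc (i + j)\<close> in \<open>br_L_L\<close>.\<close>

abbreviation "L \<equiv> lower_central"

text \<open>The kernel of \<open>om\<close>; \<open>Z_iff\<close> identifies it with the orthogonal
  of \<open>[g, g]\<close> under \<open>B\<close>.\<close>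

definition Z :: "'g set" where "Z = {x. \<forall>y z. om x y z = 0}"

abbreviation "G \<equiv> span (L 1 \<union> Z)"

lemma subspace_L: "subspace (L n)"
  by (cases n) (auto simp: lower_central.simps(2))

lemma subspace_Z: "subspace Z"
  unfolding subspace_def Z_def by (auto simp: om_lin)

lemma span_L [simp]: "span (L n) = L n" and span_Z [simp]: "span Z = Z"
  using subspace_L subspace_Z by simp_all

lemma br_L_Suc: "y \<in> L n \<Longrightarrow> x \<star> y \<in> L (Suc n)"
  by (auto intro!: span_base simp: lower_central.simps(2))

lemma br_in_L1 [simp]: "x \<star> y \<in> L 1" "x \<star> y \<in> L (Suc 0)"
  using br_L_Suc[of y 0 x] by (simp_all add: One_nat_def)

lemma br_L_Suc': "y \<in> L n \<Longrightarrow> y \<star> x \<in> L (Suc n)"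
  using br_L_Suc[of y n x] br_skew[of y x] subspace_neg[OF subspace_L] by metis

lemma L_induct [consumes 1, case_names bracket zero add scale]:
  assumes "a \<in> L (Suc n)" "\<And>x y. y \<in> L n \<Longrightarrow> P (x \<star> y)" "P 0"
    "\<And>a b. P a \<Longrightarrow> P b \<Longrightarrow> P (a + b)" "\<And>c a. P a \<Longrightarrow> P (c *s a)"
  shows "P a"
proof -
  have "a \<in> span {x \<star> y | x y. y \<in> L n}" using assms(1) by (simp add: lower_central.simps(2))
  then show ?thesis
    by (induction rule: span_induct_alt) (use assms(2-) in auto)
qed

lemma L_decseq: "L (Suc n) \<subseteq> L n"
proof (induction n)
  case 0 then show ?case by simp
next
  case (Suc n)
  have "{x \<star> y | x y. y \<in> L (Suc n)} \<subseteq> {x \<star> y | x y. y \<in> L n}" using Suc by blast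
  then show ?case by (simp add: span_mono lower_central.simps(2))
qed

lemma L_antimono: "m \<le> n \<Longrightarrow> L n \<subseteq> L m"
  by (induction n rule: dec_induct) (use L_decseq in blast)+

lemma br_L_L: "x \<in> L i \<Longrightarrow> y \<in> L j \<Longrightarrow> x \<star> y \<in> L (Suc (i + j))"
proof (induction i arbitrary: x y j)
  case 0 then show ?case by (simp add: br_L_Suc)
next
  case (Suc i)
  from Suc.prems(1) show ?case
  proof (induction rule: L_induct)
    case (bracket a b)
    have "(a \<star> b) \<star> y = a \<star> (b \<star> y) - b \<star> (a \<star> y)"
      using jacobi_left[of a b y] by simp
    moreover have "a \<star> (b \<star> y) \<in> L (Suc (Suc i + j))"
      using br_L_Suc[OF Suc.IH[OF bracket Suc.prems(2)], of a] by simp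
    moreover have "b \<star> (a \<star> y) \<in> L (Suc (Suc i + j))"
      using Suc.IH[OF bracket br_L_Suc[OF Suc.prems(2)], of a] by (simp only: add_Suc add_Suc_right)
    ultimately show ?case by (simp only: subspace_diff[OF subspace_L])
  qed (simp_all only: br_lin br_zero subspace_0[OF subspace_L] subspace_add[OF subspace_L] subspace_scale[OF subspace_L])
qed

lemma om_Z: "z \<in> Z \<Longrightarrow> om z x y = 0" "z \<in> Z \<Longrightarrow> om x z y = 0" "z \<in> Z \<Longrightarrow> om x y z = 0"
proof -
  assume z: "z \<in> Z"
  then show "om z x y = 0" "om x z y = 0" "om x y z = 0"
    unfolding Z_def om_rot[of x z y] om_rot[of x y z] om_rot[of y z x] by blast+
qed

lemma B_Z_L1: 
  assumes z: "z \<in> Z" and "a \<in> L 1"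
  shows "B z a = 0"
proof -
  from assms(2) have "a \<in> L (Suc 0)" by (simp add: One_nat_def)
  then show "B z a = 0"
  proof (induction rule: L_induct)
    case (bracket x y)
    show ?case using om_Z(1)[OF z, of x y] by (simp only: B_br)
  qed (simp_all add: B_lin)
qed

lemma Z_iff: "x \<in> Z \<longleftrightarrow> (\<forall>a\<in>L 1. B x a = 0)"
proof
  assume "\<forall>a\<in>L 1. B x a = 0"
  then have "om x y z = 0" for y z
    unfolding B_br[symmetric] using br_in_L1(1) by blast
  then show "x \<in> Z" unfolding Z_def by blast
qed (use B_Z_L1 in blast)

text \<open>By skewness the orthogonal of the ideal \<open>L 1\<close> is again an ideal, so
  computing modulo \<open>Z\<close> is compatible with brackets.\<close>

lemma br_Z:
  assumes "z \<in> Z"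
  shows "x \<star> z \<in> Z" "z \<star> x \<in> Z"
proof -
  show 1: "x \<star> z \<in> Z"
    unfolding Z_iff[of "x \<star> z"] B_ad[of x z] using B_Z_L1[OF assms br_in_L1(1)] by simp
  show "z \<star> x \<in> Z"
    unfolding br_skew[of z x] using subspace_neg[OF subspace_Z 1] .
qed

lemma G_E:
  assumes "x \<in> G" obtains a z where "a \<in> L 1" "z \<in> Z" "x = a + z"
  using assms unfolding span_Un span_L span_Z by blast

text \<open>Membership in \<open>Z\<close> gives orthogonality to \<open>L 1\<close>, and membership
  in \<open>L 1\<close> gives orthogonality to \<open>Z\<close>. Thus a congruence modulo
  \<open>Z\<close> between elements of \<open>L 1\<close> becomes an equality when paired with
  \<open>G\<close>.\<close>

lemma B_G:
  assumes "a \<in> L 1" "a \<in> Z" "x \<in> G"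
  shows "B a x = 0"
proof -
  obtain b z where "b \<in> L 1" "z \<in> Z" "x = b + z" using assms(3) by (rule G_E)
  then show ?thesis
    using B_Z_L1[OF assms(2), of b] B_Z_L1[OF _ assms(1), of z] B_sym[of a z] by (simp only: B_add_right add_0)
qed

section \<open>Dimension counts and frames\<close>

text \<open>\<open>chain S vs\<close> says that \<open>vs\<close> is linearly independent modulo the span of \<open>S\<close>.\<close>

primrec chain :: "'g set \<Rightarrow> 'g list \<Rightarrow> bool" where
  "chain S [] \<longleftrightarrow> True"
| "chain S (v # vs) \<longleftrightarrow> v \<notin> span S \<and> chain (insert v S) vs"

lemma chain_dim: "chain S vs \<Longrightarrow> dim S + length vs \<le> dim (S \<union> set vs)"
proof (induction vs arbitrary: S)
  case (Cons v vs)
  then show ?case using Cons.IH[of "insert v S"] by (simp add: dim_insert)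
qed simp

lemma chain_append: "chain S (vs @ [x]) \<longleftrightarrow> chain S vs \<and> x \<notin> span (S \<union> set vs)"
  by (induction vs arbitrary: S) auto

lemma dim_ker:
  assumes "subspace S" "linform f"
  shows "dim S \<le> Suc (dim {x \<in> S. f x = 0})"
proof (cases "\<exists>s\<in>S. f s \<noteq> 0")
  case True
  then obtain s where s: "s \<in> S" "f s \<noteq> 0" by blast
  have "S \<subseteq> span (insert s {x \<in> S. f x = 0})"
  proof
    fix x assume x: "x \<in> S"
    have "x - (f x / f s) *s s \<in> {x \<in> S. f x = 0}"
      using x s assms by (auto simp: linform_diff linform_scale intro!: subspace_diff subspace_scale)
    then show "x \<in> span (insert s {x \<in> S. f x = 0})"
      unfolding span_breakdown_eq by (meson span_base)
  qed
  then have "dim S \<le> dim (insert s {x \<in> S. f x = 0})"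
    by (metis dim_mono)
  also have "\<dots> \<le> Suc (dim {x \<in> S. f x = 0})" by (simp add: dim_insert)
  finally show ?thesis .
next
  case False
  then have "{x \<in> S. f x = 0} = S" by blast
  then show ?thesis by simp
qed

lemma dim_perp_finite:
  assumes "finite A"
  shows "dim (UNIV :: 'g set) \<le> card A + dim {x. \<forall>a\<in>A. B a x = 0}"
  using assms
proof (induction A rule: finite_induct)
  case (insert a A)
  have "subspace {x. \<forall>a\<in>A. B a x = 0}"
    unfolding subspace_def by (auto simp: B_lin)
  then have "dim {x. \<forall>a\<in>A. B a x = 0} \<le> Suc (dim {x \<in> {x. \<forall>a\<in>A. B a x = 0}. B a x = 0})"
    by (rule dim_ker) (rule linform_B)
  moreover have "{x \<in> {x. \<forall>a\<in>A. B a x = 0}. B a x = 0} = {x. \<forall>b\<in>insert a A. B b x = 0}" by auto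
  ultimately show ?case using insert by simp
qed simp

text \<open>\<open>Z\<close> is cut out by one linear condition for each vector in a basis of
  \<open>L 1\<close>.\<close>

lemma dim_perp: "dim (UNIV :: 'g set) \<le> dim (L 1) + dim Z"
proof -
  obtain A where A: "A \<subseteq> L 1" "independent A" "L 1 \<subseteq> span A" "card A = dim (L 1)"
    using basis_exists by blast
  have fin: "finite A" using A(2) by (rule finiteI_independent)
  have "x \<in> Z" if x: "\<forall>a\<in>A. B a x = 0" for x
    unfolding Z_iff
  proof
    fix a assume "a \<in> L 1"
    then have "a \<in> span A" using A(3) by blast
    then have "B a x = 0"
      by (induction rule: span_induct_alt) (use x in \<open>auto simp: B_lin\<close>)
    then show "B x a = 0" by (simp add: B_sym)
  qed
  then have "dim {x. \<forall>a\<in>A. B a x = 0} \<le> dim Z" by (intro dim_subset) blast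
  then show ?thesis using dim_perp_finite[OF fin] A(4) by linarith
qed

text \<open>
  \<open>R\<close> is the codimension of \<open>G = [g, g] + Z\<close>. As \<open>G\<close> is the orthogonal of \<open>[g, g] \<inter> Z\<close>, the space
  \<open>Z\<close> has dimension at least \<open>R\<close>, which is where the factor 2 in \<open>chain_bound\<close> comes from.
\<close>

definition R :: nat where "R = dim (UNIV :: 'g set) - dim G"

lemma R_plus: "R + dim G = dim (UNIV :: 'g set)"
  unfolding R_def using dim_subset[of G UNIV] by simp

lemma chain_bound:
  assumes "chain Z vs" "set vs \<subseteq> L 1"
  shows "2 * R + length vs \<le> dim (UNIV :: 'g set)"
proof -
  have "{x + y |x y. x \<in> L 1 \<and> y \<in> Z} = G" by (simp only: span_Un span_L span_Z)
  then have 1: "dim G + dim (L 1 \<inter> Z) = dim (L 1) + dim Z"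
    using dim_sums_Int[OF subspace_L subspace_Z, of 1] by (simp only: dim_span)
  have 2: "dim (L 1 \<inter> Z) \<le> dim Z" by (intro dim_subset) blast
  have "dim (Z \<union> set vs) \<le> dim (L 1 \<union> Z)" by (intro dim_subset) (use assms(2) in blast)
  then have "dim Z + length vs \<le> dim G" using chain_dim[OF assms(1)] by simp
  \<comment> \<open>\<open>dim_perp\<close> and fact 1 give
    \<open>R \<le> dim (L 1 \<inter> Z)\<close>, which is at most \<open>dim Z\<close>; so
    \<open>2 * R + length vs\<close> is at most \<open>R + dim Z + length vs\<close>, hence at most
    \<open>R + dim G\<close>.\<close>
  then show ?thesis using 1 2 R_plus dim_perp by linarith
qed

lemma chain_G:
  assumes "chain G vs"
  shows "length vs \<le> R"
  using chain_dim[OF assms] dim_subset[of "G \<union> set vs" UNIV] R_plus by simp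

text \<open>Coordinates along a complement of \<open>G\<close>. As they vanish on \<open>G\<close>,
  which contains all brackets, they are closed 1-forms.\<close>

lemma frame_exists:
  "\<exists>E f. finite E \<and> card E = R \<and> (\<forall>e. linform (f e)) \<and> (\<forall>e. \<forall>x\<in>G. f e x = 0)
    \<and> (\<forall>x. x - (\<Sum>e\<in>E. f e x *s e) \<in> G)"
proof -
  obtain A where A: "A \<subseteq> G" "independent A" "G \<subseteq> span A" "card A = dim G"
    by (rule basis_exists[of G])
  obtain A' where A': "A \<subseteq> A'" "independent A'" "UNIV \<subseteq> span A'"
    by (rule maximal_independent_subset_extend[OF subset_UNIV A(2)])
  have fin: "finite A'" using A'(2) by (rule finiteI_independent)
  have sp: "span A' = UNIV" using A'(3) by (rule top.extremum_uniqueI)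
  have "card A' = dim (UNIV :: 'g set)" using dim_unique[OF subset_UNIV A'(3,2) refl] by simp
  then have card: "card (A' - A) = R"
    using card_Diff_subset[OF finite_subset[OF A'(1) fin] A'(1)] A(4) unfolding R_def by simp
  define f where "f e x = (if e \<in> A then 0 else representation A' x e)" for e x
  have lin: "linform (f e)" for e
    unfolding linform_def f_def using representation_add[OF A'(2)] representation_scale[OF A'(2)] sp by auto
  have GA: "G = span A" using A(1,3) span_minimal[OF A(1) subspace_span] by (intro subset_antisym)
  have zero: "f e x = 0" if "x \<in> G" for e x
  proof -
    have "representation A' x = representation A x"
      using that unfolding GA by (intro representation_extend[OF A'(2) _ A'(1)])
    then show ?thesis unfolding f_def using representation_ne_zero[of A x e] by auto
  qed
  have "x - (\<Sum>e\<in>A' - A. f e x *s e) \<in> G" for x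
  proof -
    have "x = (\<Sum>b\<in>A'. representation A' x b *s b)"
      using sum_representation_eq[OF A'(2) _ fin order_refl, of x] sp by simp
    also have "\<dots> = (\<Sum>b\<in>A' - A. representation A' x b *s b) + (\<Sum>b\<in>A. representation A' x b *s b)"
      using sum.subset_diff[OF A'(1) fin] .
    also have "(\<Sum>b\<in>A' - A. representation A' x b *s b) = (\<Sum>e\<in>A' - A. f e x *s e)"
      by (rule sum.cong) (auto simp: f_def)
    finally have "x - (\<Sum>e\<in>A' - A. f e x *s e) = (\<Sum>b\<in>A. representation A' x b *s b)"
      by (metis add_diff_cancel_left')
    also have "\<dots> \<in> G" using A(1) by (intro span_sum span_scale) (rule subsetD)
    finally show ?thesis .
  qed
  then show ?thesis by (intro exI[of _ "A' - A"] exI[of _ f] conjI allI ballI finite_Diff fin card lin zero)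
qed

lemma br_M:
  assumes "y \<in> span (L j \<union> Z)"
  shows "x \<star> y \<in> span (L (Suc j) \<union> Z)" "y \<star> x \<in> span (L (Suc j) \<union> Z)"
proof -
  obtain a z where y: "a \<in> L j" "z \<in> Z" "y = a + z"
    using assms unfolding span_Un span_L span_Z by blast
  show 1: "x \<star> y \<in> span (L (Suc j) \<union> Z)"
    unfolding y(3) br_add_right using br_L_Suc[OF y(1)] br_Z[OF y(2)] 
    by (intro span_add) (auto intro: span_base)
  show "y \<star> x \<in> span (L (Suc j) \<union> Z)"
    unfolding br_skew[of y x] using 1 by (rule span_neg)
qed

text \<open>If the lower central series stalls once modulo \<open>Z\<close>, bracketing the
  inclusion shows that it stalls at every later step.\<close>

lemma L_stab:
  assumes "L i \<subseteq> span (L (Suc i) \<union> Z)"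
  shows "L i \<subseteq> span (L (i + k) \<union> Z)"
proof -
  have step: "L (i + k) \<subseteq> span (L (Suc (i + k)) \<union> Z)" for k
  proof (induction k)
    case (Suc k)
    show ?case
    proof
      fix a assume "a \<in> L (i + Suc k)"
      then have "a \<in> L (Suc (i + k))" by simp
      then show "a \<in> span (L (Suc (i + Suc k)) \<union> Z)"
        by (induction rule: L_induct)
          (use Suc br_M in \<open>auto intro: span_add span_scale span_zero\<close>)
    qed
  qed (use assms in simp)
  show ?thesis
  proof (induction k)
    case (Suc k)
    have "span (L (i + k) \<union> Z) \<subseteq> span (L (i + Suc k) \<union> Z)"
      using step[of k] by (intro span_minimal) (auto intro: span_base)
    then show ?case using Suc by blast
  qed (auto intro: span_base)
qed

end

locale small_quadratic_lie = quadratic_lie +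
  assumes nil: "nilpotent" and dim9: "dim (UNIV :: 'b set) \<le> 9"
begin

text \<open>A series that stalls modulo \<open>Z\<close> stays inside \<open>L (i + N) + Z\<close>,
  and nilpotency makes this \<open>Z\<close> for large \<open>N\<close>.\<close>

lemma L_strict:
  assumes "\<not> L i \<subseteq> Z"
  obtains a where "a \<in> L i" "a \<notin> span (L (Suc i) \<union> Z)"
proof -
  have "\<not> L i \<subseteq> span (L (Suc i) \<union> Z)"
  proof
    assume *: "L i \<subseteq> span (L (Suc i) \<union> Z)"
    obtain N where "L N = {0}" using nil unfolding nilpotent_def by blast
    then have "L (i + N) \<subseteq> {0}" using L_antimono[of N "i + N"] by simp
    then have "L (i + N) \<union> Z \<subseteq> Z" using subspace_0[OF subspace_Z] by blast
    then have "span (L (i + N) \<union> Z) \<subseteq> Z" by (metis span_Z span_mono)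
    then show False using L_stab[OF *, of N] assms by blast
  qed
  then show ?thesis using that by blast
qed

text \<open>One vector is taken from each layer. The deepest comes first, so that each new vector is
  compared only with vectors of the next layer.\<close>

lemma L_chain:
  assumes "\<not> L k \<subseteq> Z"
  shows "\<exists>a. (\<forall>i\<le>k. a i \<in> L i) \<and> (\<forall>i\<le>k. a i \<notin> span (L (Suc i) \<union> Z))
    \<and> (\<forall>i\<le>Suc k. chain Z (map a (rev [i..<Suc k])))"
proof -
  have "\<forall>i. \<exists>a. i \<le> k \<longrightarrow> a \<in> L i \<and> a \<notin> span (L (Suc i) \<union> Z)"
    using L_strict L_antimono assms by (metis order_trans)
  then obtain a where a: "\<And>i. i \<le> k \<Longrightarrow> a i \<in> L i" "\<And>i. i \<le> k \<Longrightarrow> a i \<notin> span (L (Suc i) \<union> Z)"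
    by metis
  have "chain Z (map a (rev [i..<Suc k]))" if "i \<le> Suc k" for i
    using that
  proof (induction rule: inc_induct)
    case (step i)
    have "set (map a (rev [Suc i..<Suc k])) \<subseteq> L (Suc i)"
      using a(1) L_antimono[of "Suc i"] by fastforce
    then have "span (Z \<union> set (map a (rev [Suc i..<Suc k]))) \<subseteq> span (L (Suc i) \<union> Z)"
      by (intro span_mono) blast
    then have "chain Z (map a (rev [Suc i..<Suc k]) @ [a i])"
      unfolding chain_append using step a(2)[of i] by auto
    moreover have "map a (rev [Suc i..<Suc k]) @ [a i] = map a (rev [i..<Suc k])"
      using step by (subst (2) upt_conv_Cons) auto
    ultimately show ?case by simp
  qed simp
  with a show ?thesis by (intro exI[of _ a] conjI allI impI)
qed

text \<open>Otherwise the layers 1 to \<open>k\<close> would supply \<open>k\<close> vectors of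
  \<open>[g, g]\<close> independent modulo \<open>Z\<close>, against
  \<open>chain_bound\<close>.\<close>

lemma L_small:
  assumes "9 < 2 * R + k" "1 \<le> k"
  shows "L k \<subseteq> Z"
proof (rule ccontr)
  assume "\<not> L k \<subseteq> Z"
  from L_chain[OF this] obtain a where a: "\<forall>i\<le>k. a i \<in> L i" "\<forall>i\<le>Suc k. chain Z (map a (rev [i..<Suc k]))"
    by (elim exE conjE)
  have "set (map a (rev [1..<Suc k])) \<subseteq> L 1" using a(1) L_antimono[of 1] by fastforce
  then show False using chain_bound[OF a(2)[rule_format, OF le_SucI[OF assms(2)]]] assms dim9 by simp
qed

text \<open>When the dimension bound is attained, one more independent vector would violate
  it.\<close>

lemma chain_maximal:
  assumes "chain Z vs" "set vs \<subseteq> L 1" "9 \<le> 2 * R + length vs" "x \<in> L 1"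
  shows "x \<in> span (Z \<union> set vs)"
proof (rule ccontr)
  assume "x \<notin> span (Z \<union> set vs)"
  then have "chain Z (vs @ [x])" using assms(1) unfolding chain_append by blast
  from chain_bound[OF this] show False using assms(2-4) dim9 by simp
qed

lemma R_le: "R \<le> 4"
  using chain_bound[of "[]"] dim9 by simp

end

section \<open>Exactness by contraction with a projection along \<open>G\<close>\<close>

context quadratic_lie
begin

lemma om_norm: "om b a c = - om a b c" "om a c b = - om a b c" "om c b a = - om a b c"
  "om b c a = om a b c" "om c a b = om a b c"
  using om_swap[of a b c] om_rot[of a b c] om_rot[of c a b] by (simp_all del: om_rot)

lemma om_G:
  assumes "x \<in> G" "\<And>a. a \<in> L 1 \<Longrightarrow> om a y z = 0"
  shows "om x y z = 0"
proof -
  obtain a c where "a \<in> L 1" "c \<in> Z" "x = a + c" using assms(1) by (rule G_E)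
  then show ?thesis using assms(2)[of a] om_Z(1)[of c y z] by (simp only: om_lin add_0)
qed

lemma om_G2:
  assumes "x \<in> G" "y \<in> G" "\<And>a b. a \<in> L 1 \<Longrightarrow> b \<in> L 1 \<Longrightarrow> om a b z = 0"
  shows "om x y z = 0"
proof (rule om_G[OF assms(1)])
  fix a assume a: "a \<in> L 1"
  have "om y a z = 0"
    by (rule om_G[OF assms(2)]) (use assms(3)[OF _ a] in simp)
  then show "om a y z = 0" using om_swap(1)[of y a z] by simp
qed

lemma om_G3:
  assumes "x \<in> G" "y \<in> G" "z \<in> G" "\<And>a b c. a \<in> L 1 \<Longrightarrow> b \<in> L 1 \<Longrightarrow> c \<in> L 1 \<Longrightarrow> om a b c = 0"
  shows "om x y z = 0"
proof (rule om_G2[OF assms(1,2)])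
  fix a b assume ab: "a \<in> L 1" "b \<in> L 1"
  have "om z a b = 0"
    by (rule om_G[OF assms(3)]) (use assms(4)[OF _ ab] in simp)
  then show "om a b z = 0" using om_rot[of z a b] by simp
qed

definition proj :: "('g \<Rightarrow> 'g) \<Rightarrow> bool" where
  "proj P \<longleftrightarrow> (\<forall>x y. P (x + y) = P x + P y) \<and> (\<forall>c x. P (c *s x) = c *s P x) \<and> (\<forall>x\<in>G. P x = 0) \<and> (\<forall>x. x - P x \<in> G)"

lemma br_G [simp]: "x \<star> y \<in> G"
  using br_in_L1(1)[of x y] span_base by blast

text \<open>Inserting \<open>P\<close> into one slot of \<open>om\<close> and summing over the slots
  gives the differential of the alternating form \<open>B x (P y) - B (P x) y\<close>, because
  \<open>P\<close> kills brackets.\<close>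

lemma om_P_exact:
  assumes "\<And>x y. P (x + y) = P x + P y" "\<And>c x. P (c *s x) = c *s P x" "\<And>x y. P (x \<star> y) = 0"
  shows "exact (\<lambda>x y z. om x y (P z) + om y z (P x) + om z x (P y))"
proof -
  define \<alpha> where "\<alpha> x y = B x (P y) - B (P x) y" for x y
  have "alt_form \<alpha>"
    unfolding alt_form_def linform_def \<alpha>_def
    by (simp add: assms B_lin B_sym[of "P _"] algebra_simps)
  moreover have "om x y (P z) + om y z (P x) + om z x (P y) = \<alpha> (x \<star> y) z + \<alpha> (y \<star> z) x + \<alpha> (z \<star> x) y" for x y z
    by (simp add: \<alpha>_def assms om_def)
  ultimately show ?thesis unfolding exact_def by blast
qed

lemma om_P_exact':
  assumes "proj P"
  shows "exact (\<lambda>x y z. om x y (P z) + om y z (P x) + om z x (P y))"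
  by (rule om_P_exact) (use assms in \<open>simp_all add: proj_def\<close>)

lemma om_expand:
  "om (p + p') (q + q') (r + r') = om p q r + om p q r' + om p q' r + om p q' r' + om p' q r + om p' q r' + om p' q' r + om p' q' r'"
  by (simp add: om_lin)

text \<open>The hypothesis says that \<open>W\<close> is acted on trivially: after splitting
  \<open>x = P x + D x\<close>, every term with two factors \<open>D\<close> disappears.\<close>

lemma exact_of_abelian:
  assumes P: "proj P" and "\<And>a b x. a \<in> L 1 \<Longrightarrow> b \<in> L 1 \<Longrightarrow> om a b x = 0"
    and ex: "exact (\<lambda>x y z. om (P x) (P y) (P z))"
  shows "exact om"
proof -
  define D where "D x = x - P x" for x
  have DG: "D x \<in> G" for x using P unfolding proj_def D_def by blast
  have z: "om (D x) (D y) w = 0" "om (D x) w (D y) = 0" "om w (D x) (D y) = 0" for x y w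
  proof -
    show 1: "om (D x) (D y) w = 0" by (rule om_G2[OF DG DG assms(2)])
    show "om (D x) w (D y) = 0" "om w (D x) (D y) = 0"
      unfolding om_norm(2)[where a = "D x" and b = "D y" and c = w] om_norm(5)[where a = "D x" and b = "D y" and c = w] 1 by simp_all
  qed
  have D: "x = P x + D x" for x unfolding D_def by simp
  \<comment> \<open>The contraction with \<open>P\<close> counts a term with exactly two factors
    \<open>P\<close> twice and the term with three of them three times. Half of it therefore exceeds
    \<open>om\<close> by half of the latter.\<close>
  have "om x y z = 1/2 * (om x y (P z) + om y z (P x) + om z x (P y)) + (- 1/2) * om (P x) (P y) (P z)" for x y z
  proof -
    have 1: "om x y z = om (P x) (P y) (P z) + om (P x) (P y) (D z) + om (P x) (D y) (P z) + om (D x) (P y) (P z)"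
      using om_expand[of "P x" "D x" "P y" "D y" "P z" "D z"] z unfolding D[symmetric] by simp
    have 2: "om x y (P z) = om (P x) (P y) (P z) + om (D x) (P y) (P z) + om (P x) (D y) (P z)" for x y z
      using om_expand[of "P x" "D x" "P y" "D y" "P z" 0] z unfolding D[symmetric] by simp
    show ?thesis 
      using 1 2[of x y z] 2[of y z x] 2[of z x y] om_rot[of "P x" "P y" "P z"] om_rot[of "P y" "P z" "P x"]
        om_rot[of "D x" "P y" "P z"] om_rot[of "D y" "P z" "P x"] om_rot[of "D z" "P x" "P y"]
        om_rot[of "P x" "P y" "D z"] om_rot[of "P y" "P z" "D x"] om_rot[of "P z" "P x" "D y"]
      by algebra
  qed
  then show ?thesis
    by (rule exact_cong[OF exact_add[OF exact_scale[OF om_P_exact'[OF P]] exact_scale[OF ex]]])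
qed

text \<open>Here \<open>om\<close> depends only on the arguments modulo \<open>G\<close>, so the
  contraction with \<open>P\<close> is \<open>3 om\<close>.\<close>

lemma exact_of_L1_Z:
  assumes P: "proj P" and "L 1 \<subseteq> Z"
  shows "exact om"
proof -
  have z: "om x y w = 0" if "x \<in> G" for x y w
    by (rule om_G[OF that]) (rule om_Z(1)[OF subsetD[OF assms(2)]])
  have "om (x - P x) y w = 0" for x y w using P z unfolding proj_def by blast
  then have "om (P x) y w = om x y w" for x y w by (simp add: om_lin)
  then have "om x y (P z) = om x y z" for x y z
    using om_rot[of "P z" x y] om_rot[of z x y] by simp
  then have "om x y z = 1/3 * (om x y (P z) + om y z (P x) + om z x (P y))" for x y z
    using om_rot[of x y z, symmetric] om_rot[of z x y] by (simp add: field_simps)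
  then show ?thesis by (rule exact_cong[OF exact_scale[OF om_P_exact'[OF P]]])
qed

definition frame2 :: "'g \<Rightarrow> 'g \<Rightarrow> ('g \<Rightarrow> 'k) \<Rightarrow> ('g \<Rightarrow> 'k) \<Rightarrow> bool" where
  "frame2 e1 e2 f1 f2 \<longleftrightarrow> linform f1 \<and> linform f2 \<and> (\<forall>x\<in>G. f1 x = 0 \<and> f2 x = 0) \<and>
     (\<forall>x. x - f1 x *s e1 - f2 x *s e2 \<in> G)"

definition frame3 :: "'g \<Rightarrow> 'g \<Rightarrow> 'g \<Rightarrow> ('g \<Rightarrow> 'k) \<Rightarrow> ('g \<Rightarrow> 'k) \<Rightarrow> ('g \<Rightarrow> 'k) \<Rightarrow> bool" where
  "frame3 e1 e2 e3 f1 f2 f3 \<longleftrightarrow> linform f1 \<and> linform f2 \<and> linform f3 \<and>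
     (\<forall>x\<in>G. f1 x = 0 \<and> f2 x = 0 \<and> f3 x = 0) \<and>
     (\<forall>x. x - f1 x *s e1 - f2 x *s e2 - f3 x *s e3 \<in> G)"

lemma proj_exists: obtains P where "proj P"
proof -
  from frame_exists obtain E f where E: "finite E" "card E = R" "\<forall>e. linform (f e)"
    "\<forall>e. \<forall>x\<in>G. f e x = 0" "\<forall>x. x - (\<Sum>e\<in>E. f e x *s e) \<in> G" by (elim exE conjE)
  have "proj (\<lambda>x. \<Sum>e\<in>E. f e x *s e)"
    unfolding proj_def using E
    by (simp add: linform_add linform_scale sum.distrib scale_left_distrib scale_sum_right)
  then show ?thesis by (rule that)
qed

lemma frame2_exists:
  assumes "R = 2" obtains e1 e2 f1 f2 where "frame2 e1 e2 f1 f2"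
proof -
  from frame_exists obtain E f where E: "finite E" "card E = R" "\<forall>e. linform (f e)"
    "\<forall>e. \<forall>x\<in>G. f e x = 0" "\<forall>x. x - (\<Sum>e\<in>E. f e x *s e) \<in> G" by (elim exE conjE)
  obtain e1 e2 where e: "E = {e1, e2}" "e1 \<noteq> e2" using E(2) assms card_2_iff[of E] by metis
  have "frame2 e1 e2 (f e1) (f e2)"
    unfolding frame2_def using E(3,4) E(5)[unfolded e(1)] e(2) by (simp add: diff_diff_eq)
  then show ?thesis by (rule that)
qed

lemma frame3_exists:
  assumes "R = 3" obtains e1 e2 e3 f1 f2 f3 where "frame3 e1 e2 e3 f1 f2 f3"
proof -
  from frame_exists obtain E f where E: "finite E" "card E = R" "\<forall>e. linform (f e)"
    "\<forall>e. \<forall>x\<in>G. f e x = 0" "\<forall>x. x - (\<Sum>e\<in>E. f e x *s e) \<in> G" by (elim exE conjE)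
  obtain e1 e2 e3 where e: "E = {e1, e2, e3}" "e1 \<noteq> e2" "e2 \<noteq> e3" "e1 \<noteq> e3"
    using E(2) assms card_3_iff[of E] by metis
  have "frame3 e1 e2 e3 (f e1) (f e2) (f e3)"
    unfolding frame3_def using E(3,4) E(5)[unfolded e(1)] e(2-4) by (simp add: diff_diff_eq add.assoc)
  then show ?thesis by (rule that)
qed

lemma frame1_exists:
  assumes "R \<le> 1" shows "\<exists>e f. linform f \<and> (\<forall>x\<in>G. f x = 0) \<and> (\<forall>x. x - f x *s e \<in> G)"
proof -
  from frame_exists obtain E f where E: "finite E" "card E = R" "\<forall>e. linform (f e)"
    "\<forall>e. \<forall>x\<in>G. f e x = 0" "\<forall>x. x - (\<Sum>e\<in>E. f e x *s e) \<in> G" by (elim exE conjE)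
  show ?thesis
  proof (cases "E = {}")
    case True
    show ?thesis
      by (rule exI[of _ 0], rule exI[of _ "\<lambda>x. 0"]) (use E(5)[unfolded True] in \<open>simp add: linform_def\<close>)
  next
    case False
    then have "card E \<noteq> 0" using E(1) by simp
    then have "card E = 1" using E(2) assms by linarith
    then obtain e where "E = {e}" by (rule card_1_singletonE)
    then show ?thesis by (intro exI[of _ e] exI[of _ "f e"]) (use E(3-5) in simp)
  qed
qed

lemma frame2_proj:
  assumes "frame2 e1 e2 f1 f2" shows "proj (\<lambda>x. f1 x *s e1 + f2 x *s e2)"
  using assms unfolding frame2_def proj_def
  by (simp add: linform_add linform_scale scale_left_distrib scale_right_distrib diff_diff_eq)

lemma frame3_proj:
  assumes "frame3 e1 e2 e3 f1 f2 f3" shows "proj (\<lambda>x. f1 x *s e1 + f2 x *s e2 + f3 x *s e3)"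
  using assms unfolding frame3_def proj_def
  by (simp add: linform_add linform_scale scale_left_distrib scale_right_distrib diff_diff_eq)

lemma L1_subset:
  assumes "subspace S" "\<And>x y. x \<star> y \<in> S"
  shows "L 1 \<subseteq> S"
  unfolding One_nat_def lower_central.simps using assms by (intro span_minimal) auto

text \<open>The remaining part \<open>om (P x) (P y) (P z)\<close> is an alternating 3-form on a
  plane.\<close>

lemma exact_abelian_2:
  assumes fr: "frame2 e1 e2 f1 f2" and "\<And>a b x. a \<in> L 1 \<Longrightarrow> b \<in> L 1 \<Longrightarrow> om a b x = 0"
  shows "exact om"
proof (rule exact_of_abelian[OF frame2_proj[OF fr] assms(2)])
  show "exact (\<lambda>x y z. om (f1 x *s e1 + f2 x *s e2) (f1 y *s e1 + f2 y *s e2) (f1 z *s e1 + f2 z *s e2))"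
    by (rule exact_cong[OF exact_zero]) (simp add: om_lin)
qed

text \<open>The remaining part is a multiple of \<open>F = f1 \<and> f2 \<and> f3\<close>. For
  \<open>a\<close> in \<open>L 1\<close> outside \<open>Z\<close> the 2-form \<open>om a\<close> is
  a nonzero combination of the \<open>f_i \<and> f_j\<close>, so its product with a suitable closed
  \<open>f_i\<close> is a nonzero multiple of \<open>F\<close>, which makes \<open>F\<close>
  exact.\<close>

lemma exact_abelian_3:
  assumes fr: "frame3 e1 e2 e3 f1 f2 f3" and ab: "\<And>a b x. a \<in> L 1 \<Longrightarrow> b \<in> L 1 \<Longrightarrow> om a b x = 0"
  shows "exact om"
proof (cases "L 1 \<subseteq> Z")
  case True
  then show ?thesis using exact_of_L1_Z[OF frame3_proj[OF fr]] by blast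
next
  case False
  then obtain a where a: "a \<in> L 1" "a \<notin> Z" by blast
  note lin = fr[unfolded frame3_def, THEN conjunct1] fr[unfolded frame3_def, THEN conjunct2, THEN conjunct1]
     fr[unfolded frame3_def, THEN conjunct2, THEN conjunct2, THEN conjunct1]
  have fz: "f1 (x \<star> y) = 0" "f2 (x \<star> y) = 0" "f3 (x \<star> y) = 0" for x y
    using fr br_G unfolding frame3_def by blast+
  define D where "D x = x - f1 x *s e1 - f2 x *s e2 - f3 x *s e3" for x
  have DG: "D x \<in> G" for x using fr unfolding frame3_def D_def by blast
  have Dx: "x = f1 x *s e1 + f2 x *s e2 + f3 x *s e3 + D x" for x unfolding D_def by simp
  have z: "om a (D x) y = 0" "om a y (D x) = 0" for x y
  proof -
    have 1: "om (D x) a y = 0" by (rule om_G[OF DG]) (rule ab[OF _ a(1)])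
    show "om a (D x) y = 0" "om a y (D x) = 0"
      unfolding om_norm(1)[where a = "D x" and b = a and c = y] om_norm(4)[where a = "D x" and b = a and c = y] 1 by simp_all
  qed
  define c12 c13 c23 where "c12 = om a e1 e2" "c13 = om a e1 e3" "c23 = om a e2 e3"
  have oma: "om a x y = c12 * (f1 x * f2 y - f2 x * f1 y) + c13 * (f1 x * f3 y - f3 x * f1 y)
      + c23 * (f2 x * f3 y - f3 x * f2 y)" for x y
  proof -
    have "om a x y = om a (f1 x *s e1 + f2 x *s e2 + f3 x *s e3 + D x) (f1 y *s e1 + f2 y *s e2 + f3 y *s e3 + D y)"
      using Dx[of x] Dx[of y] by simp
    also have "\<dots> = c12 * (f1 x * f2 y - f2 x * f1 y) + c13 * (f1 x * f3 y - f3 x * f1 y)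
      + c23 * (f2 x * f3 y - f3 x * f2 y)"
      using z om_norm(2)[where a = a and b = e1 and c = e2] om_norm(2)[where a = a and b = e1 and c = e3]
        om_norm(2)[where a = a and b = e2 and c = e3]
      by (simp add: om_lin c12_c13_c23_def algebra_simps)
    finally show ?thesis .
  qed
  define F where "F x y z = f1 x * (f2 y * f3 z - f3 y * f2 z) + f2 x * (f3 y * f1 z - f1 y * f3 z)
     + f3 x * (f1 y * f2 z - f2 y * f1 z)" for x y z
  have F: "exact F"
  proof -
    have 1: "exact (\<lambda>x y z. c23 * F x y z)"
      by (rule exact_cong[OF exact_closed[OF lin(1) linform_B[of a] fz(1)]])
        (simp add: B_br oma F_def algebra_simps)
    have 2: "exact (\<lambda>x y z. - c13 * F x y z)"
      by (rule exact_cong[OF exact_closed[OF lin(2) linform_B[of a] fz(2)]])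
        (simp add: B_br oma F_def algebra_simps)
    have 3: "exact (\<lambda>x y z. c12 * F x y z)"
      by (rule exact_cong[OF exact_closed[OF lin(3) linform_B[of a] fz(3)]])
        (simp add: B_br oma F_def algebra_simps)
    have "c12 \<noteq> 0 \<or> c13 \<noteq> 0 \<or> c23 \<noteq> 0"
      using a(2) oma unfolding Z_def by auto
    then show ?thesis using exact_cancel[OF 1] exact_cancel[OF 2] exact_cancel[OF 3] by auto
  qed
  show ?thesis
  proof (rule exact_of_abelian[OF frame3_proj[OF fr] ab])
    show "exact (\<lambda>x y z. om (f1 x *s e1 + f2 x *s e2 + f3 x *s e3) (f1 y *s e1 + f2 y *s e2 + f3 y *s e3) (f1 z *s e1 + f2 z *s e2 + f3 z *s e3))"
      by (rule exact_cong[OF exact_scale[OF F, of "om e1 e2 e3"]])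
       (simp add: om_lin om_norm[where a = e1 and b = e2 and c = e3] F_def algebra_simps)
  qed
qed

end

section \<open>Codimension four\<close>

context small_quadratic_lie
begin

text \<open>A single direction \<open>e\<close> outside \<open>G\<close> has
  \<open>e \<star> e = 0\<close>, so every bracket falls into \<open>L 2 + Z\<close>: the series
  stalls at once and \<open>L 1 \<subseteq> Z\<close>.\<close>

lemma exact_R1:
  assumes "R \<le> 1" shows "exact om"
proof -
  from frame1_exists[OF assms] obtain e f where f: "linform f" "\<forall>x\<in>G. f x = 0" "\<forall>x. x - f x *s e \<in> G"
    by (elim exE conjE)
  have eb: "x \<star> e \<in> span (L (Suc 1) \<union> Z)" for x
    using br_M(2)[OF f(3)[rule_format, of x], of e] by (simp add: br_lin bracket_self)
  have "x \<star> y \<in> span (L (Suc 1) \<union> Z)" for x y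
    using span_add[OF br_M(1)[OF f(3)[rule_format, of y], of x] span_scale[OF eb[of x], of "f y"]] by (simp add: br_lin)
  then have "L 1 \<subseteq> span (L (Suc 1) \<union> Z)" by (intro L1_subset subspace_span)
  then have "L 1 \<subseteq> Z" using L_strict[of 1] by blast
  moreover obtain P where "proj P" by (rule proj_exists)
  ultimately show ?thesis using exact_of_L1_Z by blast
qed

text \<open>
  Here \<open>[g, g]\<close> is spanned by one vector \<open>u\<close> modulo \<open>Z\<close>. By the Jacobi identity the 2-form
  \<open>om u\<close> satisfies the Pluecker relation, hence equals \<open>g1 \<and> g2\<close>. Contracting \<open>om\<close> with the projection
  \<open>Q\<close> onto a complement of \<open>G\<close> in the radical of \<open>om u\<close> kills the part of \<open>om\<close> involving \<open>u\<close>.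
\<close>

lemma exact_R4:
  assumes "R = 4" shows "exact om"
proof (cases "L 1 \<subseteq> Z")
  case True
  obtain P where "proj P" by (rule proj_exists)
  then show ?thesis using exact_of_L1_Z True by blast
next
  case False
  then obtain u where u: "u \<in> L 1" "u \<notin> Z" by blast
  \<comment> \<open>One vector attains the bound, since \<open>2 * 4 + 1 = 9\<close>.\<close>
  have "chain Z [u]" using u by simp
  then have "a \<in> span (insert u Z)" if "a \<in> L 1" for a
    using chain_maximal[of "[u]" a] u(1) that assms by simp
  then have L1u: "\<exists>c. a - c *s u \<in> Z" if "a \<in> L 1" for a
    using that unfolding span_breakdown_eq span_Z by blast
  have abelian: "om a b x = 0" if ab: "a \<in> L 1" "b \<in> L 1" for a b x
  proof -
    obtain c d where cd: "a - c *s u \<in> Z" "b - d *s u \<in> Z" using L1u[OF ab(1)] L1u[OF ab(2)] by blast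
    have "om (a - c *s u) b x = 0" "om (c *s u) (b - d *s u) x = 0" using om_Z cd by blast+
    then show ?thesis by (simp add: om_lin)
  qed
  define q where "q = B u u"
  have q: "q \<noteq> 0"
  proof
    assume q0: "q = 0"
    have "B u a = 0" if a: "a \<in> L 1" for a
    proof -
      obtain c where c: "a - c *s u \<in> Z" using L1u[OF a] by blast
      show ?thesis using B_Z_L1[OF c u(1)] q0 B_sym[of u a] by (simp add: q_def B_lin)
    qed
    then show False using u(2) Z_iff by blast
  qed
  have uG: "om u x y = 0" if "x \<in> G" for x y
  proof -
    have "om x u y = 0" using abelian[OF _ u(1)] by (rule om_G[OF that])
    then show ?thesis using om_swap(1)[of u x y] by simp
  qed
  have uG': "om u y x = 0" if "x \<in> G" for x y using om_swap(2)[of u x y] uG[OF that] by simp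
  obtain y1 x2 where y12: "om u y1 x2 \<noteq> 0" using u(2) unfolding Z_def by blast
  define x1 where "x1 = inverse (om u y1 x2) *s y1"
  have k12: "om u x1 x2 = 1" using y12 by (simp add: x1_def om_lin)
  define g1 g2 where "g1 x = om u x x2" and "g2 x = om u x1 x" for x
  have lin: "linform g1" "linform g2" by (simp_all add: g1_def g2_def linform_def om_lin)
  \<comment> \<open>On the line \<open>L 1\<close> modulo \<open>Z\<close> the form \<open>B\<close>
    has rank one, so it is the product of two values of \<open>B u\<close> divided by
    \<open>q\<close>.\<close>
  have Buv: "q * B (x \<star> y) (z \<star> w) = om u x y * om u z w" for x y z w
  proof -
    obtain c d where c: "x \<star> y - c *s u \<in> Z" and d: "z \<star> w - d *s u \<in> Z"
      using L1u[OF br_in_L1(1)[of x y]] L1u[OF br_in_L1(1)[of z w]] by blast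
    have 1: "B (x \<star> y) v = c * B u v" if "v \<in> L 1" for v
      using B_Z_L1[OF c that] by (simp add: B_lin)
    have 2: "B (z \<star> w) v = d * B u v" if "v \<in> L 1" for v
      using B_Z_L1[OF d that] by (simp add: B_lin)
    have "om u x y = c * q" "om u z w = d * q"
      using 1[OF u(1)] 2[OF u(1)] by (simp_all add: B_br[symmetric] q_def B_sym[of u "_ \<star> _"])
    moreover have "B (x \<star> y) (z \<star> w) = c * (d * q)"
      using 1[OF br_in_L1(1), of z w] 2[OF u(1)] by (simp add: q_def B_sym[of u "_ \<star> _"])
    ultimately show ?thesis by simp
  qed
  have jac: "om u x1 x2 * om u x y + om u x2 x * om u x1 y + om u x x1 * om u x2 y = 0" for x y
  proof -
    have "B (x1 \<star> x2) (x \<star> y) + B (x2 \<star> x) (x1 \<star> y) + B (x \<star> x1) (x2 \<star> y)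
        = B (x1 \<star> x2 \<star> x + x2 \<star> x \<star> x1 + x \<star> x1 \<star> x2) y"
      by (simp only: B_inv[symmetric] B_add)
    also have "x1 \<star> x2 \<star> x + x2 \<star> x \<star> x1 + x \<star> x1 \<star> x2 = - (x \<star> (x1 \<star> x2) + x1 \<star> (x2 \<star> x) + x2 \<star> (x \<star> x1))"
      using br_skew[of "x1 \<star> x2" x] br_skew[of "x2 \<star> x" x1] br_skew[of "x \<star> x1" x2] by simp
    also have "\<dots> = 0" using jacobi[of x x1 x2] by simp
    finally have "q * (B (x1 \<star> x2) (x \<star> y) + B (x2 \<star> x) (x1 \<star> y) + B (x \<star> x1) (x2 \<star> y)) = 0" by simp
    then show ?thesis by (simp only: distrib_left Buv)
  qed
  have plucker: "om u x y = g1 x * g2 y - g2 x * g1 y" for x y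
    using jac[of x y] k12 om_swap(2)[of u x x2] om_swap(2)[of u x1 x] om_swap(2)[of u y x2]
    unfolding g1_def g2_def by algebra
  obtain P where P: "proj P" by (rule proj_exists)
  define Q where "Q x = P x - g1 x *s x1 - g2 x *s x2" for x
  have PQ: "P x = g1 x *s x1 + g2 x *s x2 + Q x" for x unfolding Q_def by simp
  have g12: "g1 x1 = 1" "g1 x2 = 0" "g2 x1 = 0" "g2 x2 = 1" using k12 by (simp_all add: g1_def g2_def)
  have gG: "g1 x = 0" "g2 x = 0" if "x \<in> G" for x
    using uG[OF that] uG'[OF that] by (simp_all add: g1_def g2_def)
  have gP: "g1 (P x) = g1 x" "g2 (P x) = g2 x" for x
  proof -
    have "x - P x \<in> G" using P unfolding proj_def by blast
    from gG[OF this] show "g1 (P x) = g1 x" "g2 (P x) = g2 x" by (simp_all add: linform_diff[OF lin(1)] linform_diff[OF lin(2)])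
  qed
  have gQ: "g1 (Q x) = 0" "g2 (Q x) = 0" for x
    by (simp_all add: Q_def linform_diff[OF lin(1)] linform_diff[OF lin(2)] linform_scale[OF lin(1)] linform_scale[OF lin(2)] gP g12)
  have Qadd: "Q (x + y) = Q x + Q y" for x y
    using P by (simp add: Q_def proj_def linform_add[OF lin(1)] linform_add[OF lin(2)] scale_left_distrib algebra_simps)
  have Qscale: "Q (c *s x) = c *s Q x" for c x
    using P by (simp add: Q_def proj_def linform_scale[OF lin(1)] linform_scale[OF lin(2)] scale_right_diff_distrib)
  have Qbr: "Q (x \<star> y) = 0" for x y
    using P br_G[of x y] gG[OF br_G] by (simp add: Q_def proj_def)
  have Gq: "om x y z = 0" if "x \<in> G" "g1 y = 0" "g2 y = 0" for x y z
  proof (rule om_G[OF that(1)])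
    fix a assume "a \<in> L 1"
    from L1u[OF this] obtain c where "a - c *s u \<in> Z" by blast
    from om_Z(1)[OF this, of y z] show "om a y z = 0" using that(2,3) by (simp add: om_lin plucker)
  qed
  \<comment> \<open>The image of \<open>Q\<close> is a plane modulo \<open>G\<close>, on which an
    alternating 3-form vanishes. Otherwise \<open>x1\<close>, \<open>x2\<close> and three values of
    \<open>Q\<close> would be five vectors independent modulo \<open>G\<close>, while
    \<open>R = 4\<close>.\<close>
  have Q3: "om (Q x) (Q y) (Q z) = 0" for x y z
  proof (rule ccontr)
    assume ne: "om (Q x) (Q y) (Q z) \<noteq> 0"
    define p r s where "p = Q x" and "r = Q y" and "s = Q z"
    have prs: "om p r s \<noteq> 0" using ne by (simp add: p_def r_def s_def)
    have g0: "g1 p = 0" "g2 p = 0" "g1 r = 0" "g2 r = 0" "g1 s = 0" "g2 s = 0"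
      by (simp_all add: p_def r_def s_def gQ)
    note lins = linform_diff[OF lin(1)] linform_diff[OF lin(2)] linform_scale[OF lin(1)] linform_scale[OF lin(2)]
    have key: "om v y' z' = 0" if "v - a *s x2 - b *s x1 \<in> G" "g1 v = 0" "g2 v = 0" "g1 y' = 0" "g2 y' = 0" for v y' z' a b
    proof -
      have "a = 0" "b = 0" using gG[OF that(1)] that(2,3) by (simp_all add: lins g12)
      then show ?thesis using Gq[OF _ that(4,5), of v z'] that(1) by simp
    qed
    have "x1 \<notin> G" using gG(1) g12(1) by fastforce
    moreover have "x2 - a *s x1 \<notin> G" for a using gG(2)[of "x2 - a *s x1"] by (auto simp: lins g12)
    moreover have "p - a *s x2 - b *s x1 \<notin> G" for a b
      using key[of p a b r s] prs g0 by auto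
    moreover have "r - c *s p - a *s x2 - b *s x1 \<notin> G" for a b c
      using key[of "r - c *s p" a b p s] prs g0 om_swap(1)[of r p s] by (auto simp: lins om_lin)
    moreover have "s - d *s r - c *s p - a *s x2 - b *s x1 \<notin> G" for a b c d
      using key[of "s - d *s r - c *s p" a b p r] prs g0 om_rot[of s p r] om_self om_swap(3)[of p r s] om_norm(4)[where a=p and b=r and c=s]
       om_norm(5)[where a=p and b=r and c=s] by (auto simp: lins om_lin)
    ultimately have "chain G [x1, x2, p, r, s]"
      by (simp add: span_breakdown_eq span_span del: span_Un)
    from chain_G[OF this] show False using assms by simp
  qed
  define T where "T x y z = om x y (Q z) + om y z (Q x) + om z x (Q y)" for x y z
  have T: "exact T" unfolding T_def using Qadd Qscale Qbr by (rule om_P_exact)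
  define d where "d z = om x1 x2 (Q z)" for z
  define S where "S x y z = d x * B u (y \<star> z) + d y * B u (z \<star> x) + d z * B u (x \<star> y)" for x y z
  have S: "exact S" unfolding S_def
    by (rule exact_closed) (simp_all add: B_lin Qbr d_def linform_def Qadd Qscale om_lin)
  have TQ: "om x y (Q z) = om (P x) (P y) (Q z)" for x y z
  proof -
    have G: "x - P x \<in> G" "y - P y \<in> G" using P unfolding proj_def by blast+
    have "om (x - P x) (Q z) y = 0" using Gq[OF G(1)] gQ by blast
    then have "om (x - P x) y (Q z) = 0" using om_swap(2)[of "x - P x" "Q z" y] by simp
    moreover have "om (y - P y) (Q z) (P x) = 0" using Gq[OF G(2)] gQ by blast
    then have "om (P x) (y - P y) (Q z) = 0" using om_rot[of "P x" "y - P y" "Q z"] by simp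
    ultimately show ?thesis by (simp add: om_lin)
  qed
  \<comment> \<open>Expand by \<open>PQ\<close>. Terms with two factors \<open>Q\<close> occur twice
    in \<open>T\<close>, terms with one factor \<open>Q\<close> once, and
    \<open>S = d \<and> om u\<close> supplies the missing copy of the latter. Terms with none or
    three vanish.\<close>
  have "om (P x) (P y) (P z) = 1/2 * T x y z + 1/2 * S x y z" for x y z
  proof -
    have n1: "om v x1 x2 = om x1 x2 v" "om v x2 x1 = - om x1 x2 v" "om x1 v x2 = - om x1 x2 v" 
       "om x2 v x1 = om x1 x2 v" "om x2 x1 v = - om x1 x2 v" for v
      by (rule om_norm)+
    have n2: "om v w x1 = om x1 v w" "om v x1 w = - om x1 v w" "om v w x2 = om x2 v w" "om v x2 w = - om x2 v w" for v w
      by (rule om_norm)+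
    have n3: "om w y x = - om w x y" for w x y by (rule om_swap(2))
    show ?thesis
      unfolding T_def TQ[of x y z] TQ[of y z x] TQ[of z x y] S_def B_br plucker PQ
      by (simp add: om_lin Q3 n1[of "Q _"] n2[of "Q _" "Q _"] d_def n3[of _ "Q y" "Q x"] n3[of _ "Q z" "Q y"] n3[of _ "Q z" "Q x"] field_simps)
  qed
  then have "exact (\<lambda>x y z. om (P x) (P y) (P z))"
    by (rule exact_cong[OF exact_add[OF exact_scale[OF T] exact_scale[OF S]]])
  then show ?thesis by (intro exact_of_abelian[OF P abelian])
qed

end

section \<open>Codimension two\<close>

context quadratic_lie
begin

text \<open>Skewness moves brackets one at a time from the second argument to the first, until an
  element of \<open>L (i + j)\<close> is paired with \<open>L 1\<close>.\<close>

lemma B_L_L: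
  assumes "L (i + j) \<subseteq> Z" "a \<in> L i" "b \<in> L (Suc j)"
  shows "B a b = 0"
  using assms
proof (induction j arbitrary: i a b)
  case 0
  then show ?case using B_Z_L1[of a b] by (auto simp: One_nat_def)
next
  case (Suc j)
  from Suc.prems(3) show ?case
  proof (induction rule: L_induct)
    case (bracket x y)
    have "B (x \<star> a) y = 0"
      using Suc.IH[of "Suc i" "x \<star> a" y] Suc.prems(1) br_L_Suc[OF Suc.prems(2)] bracket by simp
    then show ?case using B_ad[of x a y] by simp
  qed (simp_all add: B_lin)
qed

end

context small_quadratic_lie
begin

text \<open>Modulo \<open>[g, G]\<close>, which lies in \<open>L 2 + Z\<close>, a bracket sees only
  the components along \<open>e1\<close> and \<open>e2\<close>, and is a multiple of
  \<open>e1 \<star> e2\<close>.\<close>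

lemma u_decomp:
  assumes fr: "frame2 e1 e2 f1 f2" and "a \<in> L 1"
  shows "\<exists>k b. b \<in> L 2 \<and> a - k *s (e1 \<star> e2) - b \<in> Z"
proof -
  define D where "D x = x - f1 x *s e1 - f2 x *s e2" for x
  have DG: "D x \<in> G" for x using fr unfolding frame2_def D_def by blast
  have "x \<star> y \<in> span (insert (e1 \<star> e2) (L 2 \<union> Z))" for x y
  proof -
    have "x \<star> y - (f1 x * f2 y - f2 x * f1 y) *s (e1 \<star> e2)
        = (f1 x *s e1 + f2 x *s e2) \<star> D y + D x \<star> y"
      using br_skew[of e2 e1]
      by (simp add: D_def br_lin bracket_self scale_left_diff_distrib scale_right_diff_distrib scale_right_distrib mult.commute)
    also have "\<dots> \<in> span (L (Suc 1) \<union> Z)"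
      by (intro span_add br_M DG)
    finally show ?thesis unfolding span_breakdown_eq by (auto simp: Suc_1)
  qed
  then have "a \<in> span (insert (e1 \<star> e2) (L 2 \<union> Z))"
    using L1_subset[OF subspace_span, of "insert (e1 \<star> e2) (L 2 \<union> Z)"] assms(2) by blast
  then obtain k where k: "a - k *s (e1 \<star> e2) \<in> span (L 2 \<union> Z)" unfolding span_breakdown_eq by blast
  then obtain b z where "b \<in> L 2" "z \<in> Z" "a - k *s (e1 \<star> e2) = b + z"
    unfolding span_Un span_L span_Z by blast
  then show ?thesis by (intro exI[of _ k] exI[of _ b]) simp
qed

lemma om_L_L:
  assumes "x \<in> L i" "y \<in> L j" "L (Suc (i + j)) \<subseteq> Z" "a \<in> L 1"
  shows "om x y a = 0"
  unfolding om_def using B_Z_L1[OF subsetD[OF assms(3) br_L_L[OF assms(1,2)]] assms(4)] .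

text \<open>
  If \<open>om\<close> did not vanish on \<open>[g, g]\<close>, then \<open>[L 2, L 2] \<subseteq> L 5\<close> would force all five steps of the
  lower central series modulo \<open>Z\<close> to be one-dimensional; but then \<open>[L 2, L 2] = [L 2, L 3] \<subseteq> L 6 \<subseteq> Z\<close>.
\<close>

lemma derived_bracket_R2:
  assumes R: "R = 2" and fr: "frame2 e1 e2 f1 f2"
    and abc: "a \<in> L 1" "b \<in> L 1" "c \<in> L 1"
  shows "om a b c = 0"
proof -
  have L6: "L 6 \<subseteq> Z" using L_small[of 6] R by simp
  have L21: "x \<in> L 1" if "x \<in> L 2" for x by (rule subsetD[OF L_antimono[OF one_le_numeral] that])
  have main: "om a b c = 0" if a: "a \<in> L 1" and b: "b \<in> L 2" and c: "c \<in> L 2" for a b c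
  proof (rule ccontr)
    assume ne: "om a b c \<noteq> 0"
    have "Suc (2 + 2) = (5::nat)" by simp
    then have "b \<star> c \<in> L 5" using br_L_L[OF b c] by (simp only:)
    moreover have "b \<star> c \<notin> Z" using B_Z_L1[OF _ a, of "b \<star> c"] ne unfolding om_rot[of a b c] om_def[of b c a] by blast
    ultimately have "\<not> L 5 \<subseteq> Z" by blast
    from L_chain[OF this] obtain v where v: "\<forall>i\<le>5. v i \<in> L i" "\<forall>i\<le>5. v i \<notin> span (L (Suc i) \<union> Z)"
      "\<forall>i\<le>Suc 5. chain Z (map v (rev [i..<Suc 5]))" by (elim exE conjE)
    have rev5: "rev [1..<Suc 5] = [5,4,3,2,1]" by (simp add: upt_rec)
    \<comment> \<open>Five vectors attain the bound \<open>2 * 2 + 5 = 9\<close>, so they span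
      \<open>L 1\<close> modulo \<open>Z\<close>.\<close>
    have ch: "chain Z [v 5, v 4, v 3, v 2, v 1]" using v(3)[rule_format, of 1] unfolding rev5 by simp
    have vL: "v i \<in> L j" if "j \<le> i" "i \<le> 5" for i j
      by (rule subsetD[OF L_antimono[OF that(1)]]) (use v(1) that in blast)
    have sub: "set [v 5, v 4, v 3, v 2, v 1] \<subseteq> L 1"
      using vL[of 1] by simp
    have dec: "\<exists>k d. d \<in> L 3 \<and> x - k *s v 2 - d \<in> Z" if x: "x \<in> L 2" for x
    proof -
      have "Z \<union> set [v 5, v 4, v 3, v 2, v 1] = insert (v 1) (insert (v 2) (insert (v 3) (insert (v 4) (insert (v 5) Z))))"
        by auto
      then have "x \<in> span (insert (v 1) (insert (v 2) (insert (v 3) (insert (v 4) (insert (v 5) Z)))))"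
        using chain_maximal[OF ch sub _ L21[OF x]] R by simp
      then obtain k l where kl: "x - k *s v 1 - l *s v 2 \<in> span (insert (v 3) (insert (v 4) (insert (v 5) Z)))"
        unfolding span_breakdown_eq[of _ "v 1"] span_breakdown_eq[of _ "v 2"] by blast
      have "insert (v 3) (insert (v 4) (insert (v 5) Z)) \<subseteq> L 3 \<union> Z"
        using vL[of 3] by simp
      from subsetD[OF span_mono[OF this] kl] have y: "x - k *s v 1 - l *s v 2 \<in> span (L 3 \<union> Z)" .
      have "L 3 \<union> Z \<subseteq> L 2 \<union> Z" by (intro Un_mono L_antimono) simp_all
      from subsetD[OF span_mono[OF this] y] have y2: "x - k *s v 1 - l *s v 2 \<in> span (L 2 \<union> Z)" .
      \<comment> \<open>\<open>v 1\<close> was chosen outside \<open>L 2 + Z\<close>, while all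
        other terms lie in it.\<close>
      have "k = 0"
      proof (rule ccontr)
        assume k0: "k \<noteq> 0"
        have "x - l *s v 2 - (x - k *s v 1 - l *s v 2) \<in> span (L 2 \<union> Z)"
          by (intro span_diff[OF span_diff[OF span_base span_scale[OF span_base]] y2]) (use x vL[of 2 2] in simp_all)
        then have "k *s v 1 \<in> span (L 2 \<union> Z)" by simp
        then have "inverse k *s (k *s v 1) \<in> span (L 2 \<union> Z)" by (rule span_scale)
        then show False using v(2)[rule_format, of 1] k0 by (simp add: Suc_1)
      qed
      then obtain d z where "d \<in> L 3" "z \<in> Z" "x - l *s v 2 = d + z"
        using y unfolding span_Un span_L span_Z by auto
      then show ?thesis by (intro exI[of _ l] exI[of _ d]) simp
    qed
    obtain k d where d: "d \<in> L 3" "b - k *s v 2 - d \<in> Z" using dec[OF b] by blast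
    obtain l e where e: "e \<in> L 3" "c - l *s v 2 - e \<in> Z" using dec[OF c] by blast
    have v2: "v 2 \<in> L 2" using v(1)[rule_format, of 2] by simp
    have s: "Suc (2 + 3) = 6" "Suc (3 + 2) = 6" by simp_all
    have L7: "L (Suc (3 + 3)) \<subseteq> Z" by (rule order_trans[OF L_antimono L6]) simp
    have z: "om (v 2) e a = 0" "om d (v 2) a = 0" "om d e a = 0"
      using om_L_L[OF v2 e(1) _ a] om_L_L[OF d(1) v2 _ a] om_L_L[OF d(1) e(1) L7 a] L6 unfolding s by blast+
    have "om b c a = om (k *s v 2 + d) (l *s v 2 + e) a"
      using om_Z(1)[OF d(2), of c a] om_Z(2)[OF e(2), of "k *s v 2 + d" a] unfolding om_lin by algebra
    also have "\<dots> = 0" using z by (simp add: om_lin)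
    finally show False using ne om_rot[of a b c] by simp
  qed
  \<comment> \<open>After decomposing the three arguments along \<open>e1 \<star> e2\<close>,
    alternation leaves terms with at most one factor \<open>e1 \<star> e2\<close>. Their other
    arguments lie in \<open>L 2\<close>, where \<open>main\<close> applies.\<close>
  obtain ka a' where a': "a' \<in> L 2" "a - ka *s (e1 \<star> e2) - a' \<in> Z" using u_decomp[OF fr abc(1)] by blast
  obtain kb b' where b': "b' \<in> L 2" "b - kb *s (e1 \<star> e2) - b' \<in> Z" using u_decomp[OF fr abc(2)] by blast
  obtain kc c' where c': "c' \<in> L 2" "c - kc *s (e1 \<star> e2) - c' \<in> Z" using u_decomp[OF fr abc(3)] by blast
  have m: "om (e1 \<star> e2) x y = 0" "om x (e1 \<star> e2) y = 0" "om x y (e1 \<star> e2) = 0" if "x \<in> L 2" "y \<in> L 2" for x y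
    using main[OF br_in_L1(1) that] om_norm[where a = "e1 \<star> e2" and b = x and c = y] by simp_all
  have "om a b c = om (ka *s (e1 \<star> e2) + a') (kb *s (e1 \<star> e2) + b') (kc *s (e1 \<star> e2) + c')"
    using om_Z(1)[OF a'(2), of b c] om_Z(2)[OF b'(2), of "ka *s (e1 \<star> e2) + a'" c]
      om_Z(3)[OF c'(2), of "ka *s (e1 \<star> e2) + a'" "kb *s (e1 \<star> e2) + b'"] unfolding om_lin by algebra
  also have "\<dots> = 0" using m[OF a'(1) b'(1)] m[OF b'(1) c'(1)] m[OF a'(1) c'(1)] main[OF L21[OF a'(1)] b'(1) c'(1)] by (simp add: om_lin)
  finally show ?thesis .
qed

end

section \<open>Two directions outside \<open>G\<close>: the forms \<open>f1\<close>,
  \<open>f2\<close>, \<open>b a\<close> and their differentials\<close>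

locale rank_two = small_quadratic_lie +
  fixes e1 e2 :: 'b and f1 f2 :: "'b \<Rightarrow> 'a"
  assumes frame: "frame2 e1 e2 f1 f2" and rank: "R = 2"
begin

abbreviation "u \<equiv> e1 \<star> e2"

definition D where "D x = x - f1 x *s e1 - f2 x *s e2" for x

text \<open>\<open>B a\<close> modified to vanish on \<open>e1\<close> and \<open>e2\<close>. As
  \<open>D\<close> fixes brackets, the differential is still \<open>om a\<close>.\<close>

definition b where "b a x = B a (D x)"

text \<open>\<open>V a\<close> is the 3-form \<open>f1 \<and> f2 \<and> b a\<close>.\<close>

definition V where "V a = wedge21 (b a) (wedge f1 f2)"

lemma lin: "linform f1" "linform f2" and fG: "x \<in> G \<Longrightarrow> f1 x = 0" "x \<in> G \<Longrightarrow> f2 x = 0"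
  using frame unfolding frame2_def by blast+

lemma DG: "D x \<in> G" using frame unfolding frame2_def D_def by blast

lemma D_br [simp]: "D (x \<star> y) = x \<star> y" "f1 (x \<star> y) = 0" "f2 (x \<star> y) = 0"
  using fG br_G by (simp_all add: D_def)

lemma D_lin: "D (x + y) = D x + D y" "D (c *s x) = c *s D x"
  by (simp_all add: D_def linform_add[OF lin(1)] linform_add[OF lin(2)] linform_scale[OF lin(1)] linform_scale[OF lin(2)]
    scale_left_distrib scale_right_diff_distrib)

lemma lin_b: "linform (b a)" by (simp add: linform_def b_def D_lin B_lin)

lemma b_br [simp]: "b a (x \<star> y) = om a x y" by (simp add: b_def B_br)

lemma L1_om: "a \<in> L 1 \<Longrightarrow> c \<in> L 1 \<Longrightarrow> d \<in> L 1 \<Longrightarrow> om a c d = 0"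
  using derived_bracket_R2[OF rank frame] .

lemma L1_br: "a \<in> L 1 \<Longrightarrow> c \<in> L 1 \<Longrightarrow> a \<star> c \<in> Z"
  unfolding Z_iff[of "a \<star> c"] om_def[symmetric] using L1_om by blast

lemma G_om: "x \<in> G \<Longrightarrow> y \<in> G \<Longrightarrow> z \<in> G \<Longrightarrow> om x y z = 0"
  using om_G3 L1_om by blast

lemma comm: "a \<in> L 1 \<Longrightarrow> e1 \<star> (e2 \<star> a) - e2 \<star> (e1 \<star> a) \<in> Z"
  using L1_br[of u a] jacobi_left[of e1 e2 a] by simp

lemma x_eq: "x = f1 x *s e1 + f2 x *s e2 + D x" by (simp add: D_def)

definition Q1 where "Q1 x y = om e1 (D x) (D y)"
definition Q2 where "Q2 x y = om e2 (D x) (D y)"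

lemma om_e1: "om e1 x y = f2 x * b u y - f2 y * b u x + Q1 x y"
proof -
  have "om e1 x y = om e1 (f1 x *s e1 + f2 x *s e2 + D x) (f1 y *s e1 + f2 y *s e2 + D y)"
    using x_eq by metis
  also have "\<dots> = f2 x * om e1 e2 (D y) - f2 y * om e1 e2 (D x) + om e1 (D x) (D y)"
    using om_norm(2)[where a = e1 and b = e2 and c = "D x"] by (simp add: om_lin)
  finally show ?thesis by (simp add: b_def om_def Q1_def Q2_def)
qed

lemma om_e2: "om e2 x y = - f1 x * b u y + f1 y * b u x + Q2 x y"
proof -
  have "om e2 x y = om e2 (f1 x *s e1 + f2 x *s e2 + D x) (f1 y *s e1 + f2 y *s e2 + D y)"
    using x_eq by metis
  also have "\<dots> = - f1 x * om e1 e2 (D y) + f1 y * om e1 e2 (D x) + om e2 (D x) (D y)"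
    using om_norm(1)[where a = e1 and b = e2 and c = "D y"] om_norm(4)[where a = e1 and b = e2 and c = "D x"] by (simp add: om_lin)
  finally show ?thesis by (simp add: b_def om_def Q1_def Q2_def)
qed

lemma DD: "D (D x) = D x" "f1 (D x) = 0" "f2 (D x) = 0" "b a (D x) = b a x" "Q1 y (D x) = Q1 y x" "Q2 y (D x) = Q2 y x"
  using fG[OF DG[of x]] D_def[of "D x"] by (simp_all add: b_def Q1_def Q2_def)

text \<open>Expand the arguments along \<open>e1\<close>, \<open>e2\<close> and \<open>G\<close>;
  the component of \<open>om\<close> on \<open>G\<close> alone vanishes by
  \<open>G_om\<close>.\<close>

lemma om_eq: "om x y z = V u x y z + wedge21 f1 Q1 x y z + wedge21 f2 Q2 x y z"
proof -
  have "om x y z = om (f1 x *s e1 + f2 x *s e2 + D x) y z" by (rule arg_cong[where f = "\<lambda>v. om v y z", OF x_eq])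
  also have "\<dots> = f1 x * om e1 y z + f2 x * om e2 y z + om y z (D x)"
    using om_rot[of "D x" y z] by (simp add: om_lin)
  also have "om y z (D x) = om (f1 y *s e1 + f2 y *s e2 + D y) z (D x)" by (rule arg_cong[where f = "\<lambda>v. om v z (D x)", OF x_eq])
  also have "\<dots> = f1 y * om e1 z (D x) + f2 y * om e2 z (D x) + om z (D x) (D y)"
    using om_rot[of "D y" z "D x"] by (simp add: om_lin)
  also have "om z (D x) (D y) = om (f1 z *s e1 + f2 z *s e2 + D z) (D x) (D y)" by (rule arg_cong[where f = "\<lambda>v. om v (D x) (D y)", OF x_eq])
  also have "\<dots> = f1 z * Q1 x y + f2 z * Q2 x y" using G_om[OF DG DG DG] by (simp add: om_lin Q1_def Q2_def)
  finally show ?thesis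
    by (simp add: om_e1 om_e2 DD V_def wedge21_def wedge_def algebra_simps)
qed

lemma exact_1: "exact (\<lambda>x y z. V u x y z + wedge21 f1 Q1 x y z)"
  by (rule exact_cong[OF exact_closed[OF lin(1) linform_B[of e1] D_br(2)]])
    (simp add: B_br om_e1 V_def wedge21_def wedge_def algebra_simps)

lemma exact_2: "exact (\<lambda>x y z. V u x y z + wedge21 f2 Q2 x y z)"
  by (rule exact_cong[OF exact_closed[OF lin(2) linform_B[of e2] D_br(3)]])
    (simp add: B_br om_e2 V_def wedge21_def wedge_def algebra_simps)

text \<open>\<open>exact_1\<close> and \<open>exact_2\<close> are \<open>f1 \<and> om e1\<close> and
  \<open>f2 \<and> om e2\<close>. Each contains \<open>V u\<close>, which \<open>om\<close> contains
  once.\<close>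

lemma exact_om: assumes "exact (V u)" shows "exact om"
  by (rule exact_cong[OF exact_add[OF exact_add[OF exact_1 exact_2] exact_scale[OF assms, of "-1"]]])
    (simp add: om_eq)

text \<open>The differential of \<open>b a\<close> in coordinates. It shows how the action of
  \<open>e1\<close> and \<open>e2\<close> on \<open>W\<close> governs the products formed
  below.\<close>

lemma om_L1: 
  assumes "a \<in> L 1"
  shows "om a x y = wedge f1 f2 x y * B a u - wedge f1 (b (e1 \<star> a)) x y - wedge f2 (b (e2 \<star> a)) x y"
proof -
  have "om a x y = om a (f1 x *s e1 + f2 x *s e2 + D x) (f1 y *s e1 + f2 y *s e2 + D y)"
    using x_eq by metis
  also have "om a (D x) (D y) = 0" using assms by (intro G_om DG span_base) blast
  then have "om a (f1 x *s e1 + f2 x *s e2 + D x) (f1 y *s e1 + f2 y *s e2 + D y)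
     = wedge f1 f2 x y * om a e1 e2 - (f1 x * om e1 a (D y) - f1 y * om e1 a (D x)) - (f2 x * om e2 a (D y) - f2 y * om e2 a (D x))"
    using om_norm(2)[where a = a and b = e1 and c = e2] om_norm(1)[where a = e1 and b = a and c = "D y"] om_norm(4)[where a = e1 and b = a and c = "D x"]
      om_norm(1)[where a = e2 and b = a and c = "D y"] om_norm(4)[where a = e2 and b = a and c = "D x"]
    by (simp add: om_lin wedge_def algebra_simps)
  finally show ?thesis by (simp add: wedge_def b_def om_def B_br[symmetric] B_inv algebra_simps)
qed

text \<open>Multiplying the differential of \<open>b a\<close> by \<open>f2\<close> or
  \<open>f1\<close> isolates one of its two terms with a factor \<open>b\<close>.\<close>

lemma exact_V:
  assumes "a \<in> L 1" shows "exact (V (e1 \<star> a))" "exact (V (e2 \<star> a))"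
proof -
  show "exact (V (e1 \<star> a))"
    by (rule exact_cong[OF exact_closed[OF lin(2) lin_b[of a] D_br(3)]])
      (simp add: om_L1[OF assms] V_def wedge21_def wedge_def algebra_simps)
  show "exact (V (e2 \<star> a))"
    by (rule exact_cong[OF exact_scale[OF exact_closed[OF lin(1) lin_b[of a] D_br(2)], of "-1"]])
      (simp add: om_L1[OF assms] V_def wedge21_def wedge_def algebra_simps)
qed

lemma b_Z: "a \<in> L 1 \<Longrightarrow> a \<in> Z \<Longrightarrow> b a x = 0" unfolding b_def using B_G DG by blast

text \<open>\<open>W\<close> is a cyclic module with generator \<open>u\<close>. Modulo
  \<open>T\<close> each layer is pushed into the next one, since \<open>D x\<close> maps
  \<open>L 1\<close> into \<open>Z\<close>, and nilpotency ends the descent.\<close>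

lemma span_L1:
  assumes T: "subspace T" "Z \<subseteq> T" "u \<in> T" "\<And>t. t \<in> T \<Longrightarrow> e1 \<star> t \<in> T" "\<And>t. t \<in> T \<Longrightarrow> e2 \<star> t \<in> T"
  shows "L 1 \<subseteq> T"
proof -
  have step: "L (Suc j) \<subseteq> span (T \<union> L (Suc (Suc j)))" for j
  proof (induction j)
    case 0
    show ?case
    proof
      fix a assume "a \<in> L (Suc 0)"
      then obtain k c where c: "c \<in> L 2" "a - k *s u - c \<in> Z" using u_decomp[OF frame, of a] by (auto simp: One_nat_def)
      then have 1: "k *s u + (a - k *s u - c) \<in> T" using T by (meson subsetD subspace_add subspace_scale)
      have "(k *s u + (a - k *s u - c)) + c \<in> span (T \<union> L 2)"
        by (rule span_add[OF span_base span_base]) (use 1 c(1) in blast)+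
      then show "a \<in> span (T \<union> L (Suc (Suc 0)))" by (simp add: numeral_2_eq_2)
    qed
  next
    case (Suc j)
    show ?case
    proof
      fix a assume "a \<in> L (Suc (Suc j))"
      then show "a \<in> span (T \<union> L (Suc (Suc (Suc j))))"
      proof (induction rule: L_induct)
        case (bracket x y)
        then obtain t l where tl: "t \<in> T" "l \<in> L (Suc (Suc j))" "y = t + l"
          using Suc unfolding span_Un span_L span_eq_iff[THEN iffD2, OF T(1)] by blast
        have L1: "y \<in> L 1" "l \<in> L 1" using bracket tl(2) L_antimono[of 1 "Suc j"] L_antimono[of 1 "Suc (Suc j)"] by auto
        have t1: "t \<in> L 1" using subspace_diff[OF subspace_L L1] tl(3) by simp
        have "D x \<star> t \<in> Z"
        proof -
          obtain a z where az: "a \<in> L 1" "z \<in> Z" "D x = a + z" using DG[of x] by (rule G_E)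
          show ?thesis unfolding az(3) br_add_left using L1_br[OF az(1) t1] br_Z(2)[OF az(2)] subspace_add[OF subspace_Z] by blast
        qed
        then have 1: "f1 x *s (e1 \<star> t) + f2 x *s (e2 \<star> t) + D x \<star> t \<in> T"
          using T tl(1) by (meson subsetD subspace_add subspace_scale)
        moreover have "x \<star> t = f1 x *s (e1 \<star> t) + f2 x *s (e2 \<star> t) + D x \<star> t"
          by (subst x_eq) (simp add: br_lin)
        moreover have "x \<star> l \<in> L (Suc (Suc (Suc j)))" using br_L_Suc[OF tl(2)] .
        ultimately show ?case unfolding tl(3) br_add_right by (intro span_add[OF span_base span_base]) auto
      qed (auto intro: span_zero span_add span_scale)
    qed
  qed
  obtain N where N: "L N = {0}" using nil unfolding nilpotent_def by blast
  \<comment> \<open>Upward from \<open>L (Suc N)\<close>, which is zero, to \<open>L 1\<close>,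
    reached at \<open>j = N\<close>.\<close>
  have "L (Suc (N - j)) \<subseteq> T" for j
  proof (induction j)
    case 0
    then show ?case using L_decseq[of N] N subspace_0[OF T(1)] by auto
  next
    case (Suc j)
    show ?case
    proof (cases "j < N")
      case True
      then have "N - j = Suc (N - Suc j)" by simp
      then have "T \<union> L (Suc (Suc (N - Suc j))) \<subseteq> T" using Suc by simp
      then show ?thesis using step[of "N - Suc j"] span_minimal[OF _ T(1)] by blast
    qed (use Suc in simp)
  qed
  from this[of N] show ?thesis by (simp add: One_nat_def)
qed

end

context quadratic_lie
begin

primrec ad_pow :: "'g \<Rightarrow> 'g \<Rightarrow> nat \<Rightarrow> 'g" where
  "ad_pow e v 0 = v"
| "ad_pow e v (Suc n) = e \<star> ad_pow e v n"

lemma ad_pow_L: "v \<in> L i \<Longrightarrow> ad_pow e v n \<in> L (i + n)"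
  by (induction n) (simp_all add: br_L_Suc)

lemma B_ad_pow: "B (ad_pow e v i) (ad_pow e v j) = (-1) ^ j * B (ad_pow e v (i + j)) v"
proof (induction j arbitrary: i)
  case (Suc j)
  have "B (ad_pow e v i) (ad_pow e v (Suc j)) = - B (ad_pow e v (Suc i)) (ad_pow e v j)"
    using B_ad[of e "ad_pow e v i" "ad_pow e v j"] by simp
  then show ?case using Suc[of "Suc i"] by simp
qed simp

text \<open>An odd power of a skew operator is skew, and \<open>B\<close> is symmetric.\<close>

lemma B_ad_pow_odd: "odd n \<Longrightarrow> B (ad_pow e v n) v = 0"
  using B_ad_pow[of e v 0 n] B_sym[of v "ad_pow e v n"] by simp

lemma G_induct:
  assumes "L 1 \<subseteq> span (S \<union> Z)" "x \<in> G"
    and "P 0" "\<And>x y. P x \<Longrightarrow> P y \<Longrightarrow> P (x + y)" "\<And>c x. P x \<Longrightarrow> P (c *s x)"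
    and "\<And>x. x \<in> S \<Longrightarrow> P x" "\<And>x. x \<in> Z \<Longrightarrow> P x"
  shows "P x"
proof -
  have "L 1 \<union> Z \<subseteq> span (S \<union> Z)" using assms(1) by (auto intro: span_base)
  then have "x \<in> span (S \<union> Z)" using assms(2) span_minimal[OF _ subspace_span] by blast
  then show ?thesis
    by (induction rule: span_induct_alt) (use assms(3-) in blast)+
qed

end

context rank_two
begin

text \<open>
  Case where words of length 3 in \<open>ad e1\<close>, \<open>ad e2\<close> map \<open>u\<close> into \<open>Z\<close>: the differential of \<open>b u \<and> b t\<close>, with \<open>t\<close>
  spanning the image of the words of length 2, is \<open>-3 V u\<close> modulo exact forms.
\<close>

lemma exact_small:
  assumes t: "t \<in> L 1" "e1 \<star> t \<in> Z" "e2 \<star> t \<in> Z" "B t u = 1" "B t t = 0" "exact (V t)"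
    and q: "\<And>e e'. e \<in> {e1, e2} \<Longrightarrow> e' \<in> {e1, e2} \<Longrightarrow> e \<star> (e' \<star> u) - B (e \<star> (e' \<star> u)) u *s t \<in> Z"
    and sp: "L 1 \<subseteq> span ({u, e1 \<star> u, e2 \<star> u, t} \<union> Z)"
  shows "exact om"
proof -
  \<comment> \<open>This identifies \<open>Q1\<close> and \<open>Q2\<close> with the products
    \<open>b t \<and> b (e \<star> u)\<close>. Both sides are bilinear, so it is enough to evaluate
    on the generators; words of length 2 enter through \<open>q\<close> as multiples of
    \<open>t\<close>.\<close>
  have key: "om e x y = B t x * B (e \<star> u) y - B (e \<star> u) x * B t y" 
    if e: "e \<in> {e1, e2}" and x: "x \<in> G" and y: "y \<in> G" for e x y
    using sp x
  proof (rule G_induct)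
    fix v assume v: "v \<in> {u, e1 \<star> u, e2 \<star> u, t}"
    have et: "e \<star> t \<in> Z" using e t(2,3) by blast
    have ety: "B (e \<star> t) y = 0" using B_G[OF br_in_L1(1) et y] .
    have eut: "B (e \<star> u) t = 0" using B_Z_L1[OF et br_in_L1(1), of e1 e2] B_ad[of e t u] B_ad[of e u t] B_sym by (metis neg_equal_0_iff_equal)
    have second: "om e v y = B t v * B (e \<star> u) y - B (e \<star> u) v * B t y" if "v = e' \<star> u" "e' \<in> {e1, e2}" for e'
    proof -
      have "e' \<star> t \<in> Z" using that(2) t(2,3) by blast
      then have 1: "B t v = 0" unfolding that(1) using B_Z_L1[OF _ br_in_L1(1)] B_ad[of e' t u] by (metis neg_equal_0_iff_equal)
      have "e \<star> v - B (e \<star> v) u *s t \<in> L 1" using t(1) by (intro subspace_diff subspace_scale subspace_L) simp_all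
      from B_G[OF this _ y] have "B (e \<star> v) y = B (e \<star> v) u * B t y" 
        using q[OF e that(2)] that(1) by (simp add: B_lin)
      moreover have "B (e \<star> u) v = - B (e \<star> v) u" using B_ad[of e u v] B_sym by metis
      ultimately show ?thesis using 1 by (simp add: om_def)
    qed
    consider "v = u" | e' where "v = e' \<star> u" "e' \<in> {e1, e2}" | "v = t" using v by blast
    then show "om e v y = B t v * B (e \<star> u) y - B (e \<star> u) v * B t y"
    proof cases
      case 1
      have "B (e \<star> u) u = 0" unfolding om_def[symmetric] by simp
      then show ?thesis using 1 t(4) by (simp add: om_def)
    next
      case 3
      then show ?thesis using t(5) ety eut by (simp add: om_def)
    qed (rule second)
  next
    fix z assume z: "z \<in> Z"
    show "om e z y = B t z * B (e \<star> u) y - B (e \<star> u) z * B t y"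
      using om_Z(2)[OF z] B_Z_L1[OF z t(1)] B_Z_L1[OF z br_in_L1(1)[of e u]] B_sym[of z t] B_sym[of z "e \<star> u"] by simp
  qed (unfold om_lin B_lin om_zero B_zero, algebra+)
  have Q: "Q1 x y = - wedge (b (e1 \<star> u)) (b t) x y" "Q2 x y = - wedge (b (e2 \<star> u)) (b t) x y" for x y
    using key[of e1, OF _ DG DG] key[of e2, OF _ DG DG] by (simp_all add: Q1_def Q2_def b_def wedge_def)
  have bt: "b (e1 \<star> t) x = 0" "b (e2 \<star> t) x = 0" for x
    using b_Z[OF br_in_L1(1)] t(2,3) by blast+
  note omt = om_L1[OF t(1), unfolded t(4)] 
  note omu = om_L1[OF br_in_L1(1)[of e1 e2]]
  \<comment> \<open>Since \<open>om t\<close> is \<open>f1 \<and> f2\<close>, the differential of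
    \<open>b u \<and> b t\<close> is \<open>B u u * V t + f1 \<and> Q1 + f2 \<and> Q2 - V u\<close>.
    Subtracting \<open>exact_1\<close> and \<open>exact_2\<close> removes both \<open>Q\<close>
    terms and leaves \<open>- 3 V u\<close> besides the exact \<open>V t\<close> term.\<close>
  have "exact (V u)"
    by (rule exact_cong[OF exact_scale[OF exact_add[OF exact_add[OF exact_add[OF exact_wedge[OF lin_b[of u] lin_b[of t]] 
          exact_scale[OF t(6), of "- B u u"]] exact_scale[OF exact_1, of "-1"]] exact_scale[OF exact_2, of "-1"]], of "-1/3"]])
      (simp add: omt omu bt Q V_def wedge21_def wedge_def field_simps)
  then show ?thesis by (rule exact_om)
qed

text \<open>
  Case where the powers of \<open>ad e1\<close> on \<open>u\<close> span \<open>[g, g]\<close> modulo \<open>Z\<close> and \<open>ad e2\<close> acts as \<open>c (ad e1)\<^sup>3\<close>. Giving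
  \<open>w i\<close> the weight \<open>i - 2\<close> suggests the primitive built from \<open>2 b0 \<and> b4\<close> and \<open>b1 \<and> b3\<close>.
\<close>

lemma exact_big:
  defines "w \<equiv> ad_pow e1 u"
  assumes w5: "w 5 \<in> Z" and e2w: "e2 \<star> w 0 - c *s w 3 \<in> Z" "e2 \<star> w 1 - c *s w 4 \<in> Z" "e2 \<star> w 2 \<in> Z" "e2 \<star> w 3 \<in> Z" "e2 \<star> w 4 \<in> Z"
    and m4: "B (w 4) u \<noteq> 0"
    and sp: "L 1 \<subseteq> span ({w 0, w 1, w 2, w 3, w 4} \<union> Z)"
  shows "exact om"
proof -
  have e1w: "e1 \<star> w 0 = w 1" "e1 \<star> w 1 = w 2" "e1 \<star> w 2 = w 3" "e1 \<star> w 3 = w 4" "e1 \<star> w 4 = w 5"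
    unfolding w_def by (simp_all add: numeral_eq_Suc One_nat_def)
  have wL: "w n \<in> L 1" for n
    unfolding w_def by (cases n) simp_all
  have wG: "w n \<in> G" for n using wL span_base by blast
  have w0: "w 0 = u" by (simp add: w_def)
  define m0 m2 m4 where "m0 = B u u" and "m2 = B (w 2) u" and "m4 = B (w 4) u"
  have tab: "B (w i) (w j) = (-1) ^ j * B (w (i + j)) u" for i j
    unfolding w_def by (rule B_ad_pow)
  have odd: "B (w 1) u = 0" "B (w 3) u = 0" "B (w 5) u = 0"
    unfolding w_def by (simp_all add: B_ad_pow_odd)
  have high: "B (w 5) x = 0" "B (w 6) x = 0" "B (w 7) x = 0" "B (w 8) x = 0" if "x \<in> G" for x
  proof -
    have "w 6 = e1 \<star> w 5" "w 7 = e1 \<star> w 6" "w 8 = e1 \<star> w 7" by (simp_all add: w_def numeral_eq_Suc)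
    then have "w 6 \<in> Z" "w 7 \<in> Z" "w 8 \<in> Z" using w5 br_Z(1) by metis+
    then show "B (w 5) x = 0" "B (w 6) x = 0" "B (w 7) x = 0" "B (w 8) x = 0" using B_G[OF wL _ that] w5 by blast+
  qed
  have uG: "u \<in> G" using wG[of 0] w0 by simp
  have T: "B (w 1) (w 0) = 0" "B (w 1) (w 1) = - m2" "B (w 1) (w 2) = 0" "B (w 1) (w 3) = - m4" "B (w 1) (w 4) = 0"
    "B (w 2) (w 0) = m2" "B (w 2) (w 1) = 0" "B (w 2) (w 2) = m4" "B (w 2) (w 3) = 0" "B (w 2) (w 4) = 0"
    "B (w 3) (w 0) = 0" "B (w 3) (w 1) = - m4" "B (w 3) (w 2) = 0" "B (w 3) (w 3) = 0" "B (w 3) (w 4) = 0"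
    "B (w 4) (w 0) = m4" "B (w 4) (w 1) = 0" "B (w 4) (w 2) = 0" "B (w 4) (w 3) = 0" "B (w 4) (w 4) = 0"
    unfolding tab using odd high[OF uG] by (simp_all add: m2_def m4_def)
  have m4n: "m4 \<noteq> 0" using m4 by (simp add: m4_def)
  have e1y: "om e1 (w n) y = B (w (Suc n)) y" for n y by (simp add: om_def w_def)
  have e2y: "om e2 (w 0) y = c * B (w 3) y" "om e2 (w 1) y = c * B (w 4) y" 
    "om e2 (w 2) y = 0" "om e2 (w 3) y = 0" "om e2 (w 4) y = 0" if "y \<in> G" for y
  proof -
    have L: "e2 \<star> w i - c *s w j \<in> L 1" for i j using wL by (intro subspace_diff subspace_scale subspace_L) simp_all
    show "om e2 (w 0) y = c * B (w 3) y" "om e2 (w 1) y = c * B (w 4) y" 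
      using B_G[OF L e2w(1) that] B_G[OF L e2w(2) that] by (simp_all add: om_def B_lin)
    show "om e2 (w 2) y = 0" "om e2 (w 3) y = 0" "om e2 (w 4) y = 0"
      unfolding om_def using B_G[OF br_in_L1(1) _ that] e2w(3-5) by blast+
  qed
  have Zs: "B (w n) z = 0" if "z \<in> Z" for n z using B_Z_L1[OF that wL] B_sym by metis
  \<comment> \<open>The restriction of \<open>om e1\<close> to \<open>G\<close>, written in the
    forms \<open>B (w i)\<close>; the coefficients come from inverting the Gram matrix
    \<open>T\<close>. The summand with \<open>m2 / m4\<close> compensates for
    \<open>B (w 2) (w 0) = m2\<close>.\<close>
  have key1: "m4 * om e1 x y = B (w 2) x * B (w 3) y - B (w 3) x * B (w 2) y - B (w 1) x * B (w 4) y + B (w 4) x * B (w 1) y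
      + (m2 / m4) * (B (w 3) x * B (w 4) y - B (w 4) x * B (w 3) y)"
    if x: "x \<in> G" and y: "y \<in> G" for x y
    using sp x
  proof (rule G_induct)
    have s: "Suc 0 = 1" "Suc 1 = 2" "Suc 2 = 3" "Suc 3 = 4" "Suc 4 = 5" by simp_all
    fix v assume "v \<in> {w 0, w 1, w 2, w 3, w 4}"
    then show "m4 * om e1 v y = B (w 2) v * B (w 3) y - B (w 3) v * B (w 2) y - B (w 1) v * B (w 4) y + B (w 4) v * B (w 1) y
      + (m2 / m4) * (B (w 3) v * B (w 4) y - B (w 4) v * B (w 3) y)"
      using high(1)[OF y] m4n unfolding insert_iff empty_iff by (elim disjE) (simp_all add: T e1y s del: One_nat_def)
  next
    fix z assume z: "z \<in> Z"
    then show "m4 * om e1 z y = B (w 2) z * B (w 3) y - B (w 3) z * B (w 2) y - B (w 1) z * B (w 4) y + B (w 4) z * B (w 1) y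
      + (m2 / m4) * (B (w 3) z * B (w 4) y - B (w 4) z * B (w 3) y)"
      using om_Z(2)[OF z] Zs[OF z] by simp
  qed (unfold om_lin B_lin om_zero B_zero, algebra+)
  have key2: "m4 * om e2 x y = - c * (B (w 3) x * B (w 4) y - B (w 4) x * B (w 3) y)"
    if x: "x \<in> G" and y: "y \<in> G" for x y
    using sp x
  proof (rule G_induct)
    fix v assume "v \<in> {w 0, w 1, w 2, w 3, w 4}"
    then show "m4 * om e2 v y = - c * (B (w 3) v * B (w 4) y - B (w 4) v * B (w 3) y)"
      unfolding insert_iff empty_iff by (elim disjE) (simp_all add: T e2y[OF y])
  next
    fix z assume z: "z \<in> Z"
    then show "m4 * om e2 z y = - c * (B (w 3) z * B (w 4) y - B (w 4) z * B (w 3) y)"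
      using om_Z(2)[OF z] Zs[OF z] by simp
  qed (unfold om_lin B_lin om_zero B_zero, algebra+)
  define b0 b1 b2 b3 b4 where "b0 = b (w 0)" and "b1 = b (w 1)" and "b2 = b (w 2)" and "b3 = b (w 3)" and "b4 = b (w 4)"
  note bdefs = b0_def b1_def b2_def b3_def b4_def
  have Q: "Q1 x y = inverse m4 * (wedge b2 b3 x y - wedge b1 b4 x y + (m2 / m4) * wedge b3 b4 x y)"
      "Q2 x y = - c * inverse m4 * wedge b3 b4 x y" for x y
    using key1[OF DG DG, of x y] key2[OF DG DG, of x y] m4n
    by (simp_all add: Q1_def Q2_def bdefs b_def wedge_def field_simps)
  have be2: "b (e2 \<star> w 0) x = c * b3 x" "b (e2 \<star> w 1) x = c * b4 x" "b (e2 \<star> w 2) x = 0" "b (e2 \<star> w 3) x = 0" "b (e2 \<star> w 4) x = 0"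
    "b (w 5) x = 0" for x
    using e2y[OF DG, of x] high(1)[OF DG, of x] by (simp_all add: b_def om_def bdefs)
  have om_w: "om (w 0) x y = wedge f1 f2 x y * m0 - wedge f1 b1 x y - c * wedge f2 b3 x y"
    "om (w 1) x y = - wedge f1 b2 x y - c * wedge f2 b4 x y"
    "om (w 2) x y = wedge f1 f2 x y * m2 - wedge f1 b3 x y"
    "om (w 3) x y = - wedge f1 b4 x y"
    "om (w 4) x y = wedge f1 f2 x y * m4" for x y
    by (simp_all add: om_L1[OF wL] e1w odd be2 bdefs m0_def m2_def m4_def wedge_def be2[unfolded bdefs]
      algebra_simps) (simp_all add: w0)
  have V: "exact (V (w 2))" "exact (V (w 4))"
    using exact_V(1)[OF wL[of 1]] exact_V(1)[OF wL[of 3]] e1w by simp_all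
  have Vu: "V u = V (w 0)" by (simp add: w0)
  have i: "exact (\<lambda>x y z. m0 * V (w 4) x y z - wedge21 f1 (wedge b1 b4) x y z - c * wedge21 f2 (wedge b3 b4) x y z - m4 * V u x y z)"
    unfolding Vu by (rule exact_cong[OF exact_wedge[OF lin_b[of "w 0"] lin_b[of "w 4"]]])
      (simp add: om_w V_def wedge21_def bdefs wedge_def algebra_simps)
  have ii: "exact (\<lambda>x y z. - wedge21 f1 (wedge b2 b3) x y z + c * wedge21 f2 (wedge b3 b4) x y z - wedge21 f1 (wedge b1 b4) x y z)"
    by (rule exact_cong[OF exact_wedge[OF lin_b[of "w 1"] lin_b[of "w 3"]]])
      (simp add: om_w V_def wedge21_def bdefs wedge_def algebra_simps)
  have iii: "exact (\<lambda>x y z. m2 * V (w 4) x y z - wedge21 f1 (wedge b3 b4) x y z - m4 * V (w 2) x y z)"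
    by (rule exact_cong[OF exact_wedge[OF lin_b[of "w 2"] lin_b[of "w 4"]]])
      (simp add: om_w V_def wedge21_def bdefs wedge_def algebra_simps)
  have iii': "exact (wedge21 f1 (wedge b3 b4))"
    by (rule exact_cong[OF exact_add[OF exact_scale[OF iii, of "-1"] exact_add[OF exact_scale[OF V(2), of m2] exact_scale[OF V(1), of "-m4"]]]])
       simp
  have WQ: "m4 * wedge21 f1 Q1 x y z = wedge21 f1 (wedge b2 b3) x y z - wedge21 f1 (wedge b1 b4) x y z + (m2 / m4) * wedge21 f1 (wedge b3 b4) x y z"
    "m4 * wedge21 f2 Q2 x y z = - c * wedge21 f2 (wedge b3 b4) x y z" for x y z
    using m4n by (simp_all add: wedge21_def Q field_simps)
  \<comment> \<open>The factors 1 of \<open>ii\<close> and -2 of \<open>i\<close>, with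
    \<open>m4\<close> times \<open>exact_1\<close>, cancel the products
    \<open>f1 \<and> b2 \<and> b3\<close> and \<open>f1 \<and> b1 \<and> b4\<close>. The factor
    \<open>3 * m4\<close> of \<open>exact_2\<close> then removes
    \<open>f2 \<and> b3 \<and> b4\<close>, and the copies of \<open>V u\<close> add up to
    \<open>m4 + 2 * m4 + 3 * m4\<close>.\<close>
  have "exact (\<lambda>x y z. (6 * m4) * V u x y z)"
  proof (rule exact_cong[OF exact_add[OF exact_add[OF exact_add[OF ii exact_scale[OF exact_1, of m4]] exact_scale[OF iii', of "- m2 / m4"]] 
        exact_add[OF exact_add[OF exact_scale[OF i, of "-2"] exact_scale[OF V(2), of "2 * m0"]] exact_scale[OF exact_2, of "3 * m4"]]]])
    fix x y z
    show "6 * m4 * V u x y z = - wedge21 f1 (wedge b2 b3) x y z + c * wedge21 f2 (wedge b3 b4) x y z - wedge21 f1 (wedge b1 b4) x y z +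
       m4 * (V u x y z + wedge21 f1 Q1 x y z) + - m2 / m4 * wedge21 f1 (wedge b3 b4) x y z +
       (- 2 * (m0 * V (w 4) x y z - wedge21 f1 (wedge b1 b4) x y z - c * wedge21 f2 (wedge b3 b4) x y z - m4 * V u x y z) +
        2 * m0 * V (w 4) x y z + 3 * m4 * (V u x y z + wedge21 f2 Q2 x y z))"
      using WQ[of x y z] by algebra
  qed
  then have "exact (V u)" by (rule exact_cancel) (use m4n in simp)
  then show ?thesis by (rule exact_om)
qed

end

section \<open>Changes of frame and the quartic form\<close>

context quadratic_lie
begin

text \<open>This and the next two changes of frame have determinant one, so they preserve
  \<open>u = e1 \<star> e2\<close>.\<close>

lemma frame2_shear1: "frame2 e1 e2 f1 f2 \<Longrightarrow> frame2 (e1 + t *s e2) e2 f1 (\<lambda>x. f2 x - t * f1 x)"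
  unfolding frame2_def linform_def
  by (simp add: algebra_simps)

lemma frame2_shear2: "frame2 e1 e2 f1 f2 \<Longrightarrow> frame2 e1 (e2 - t *s e1) (\<lambda>x. f1 x + t * f2 x) f2"
  unfolding frame2_def linform_def
  by (simp add: algebra_simps)

lemma frame2_rot: "frame2 e1 e2 f1 f2 \<Longrightarrow> frame2 e2 (- e1) f2 (\<lambda>x. - f1 x)"
  unfolding frame2_def linform_def
  by (simp add: algebra_simps)

end

context rank_two
begin

lemma L6: "L 6 \<subseteq> Z" using L_small[of 6] rank by simp

text \<open>The hypothesis says that \<open>(ad e1)^4 u\<close> pairs nontrivially with
  \<open>u\<close>, so the powers of \<open>ad e1\<close> on \<open>u\<close> form a basis of
  \<open>W\<close> and \<open>e2\<close> acts as a polynomial in \<open>ad e1\<close>. Nilpotency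
  and skewness remove the even terms, a shear removes the linear one, and the cubic term is the
  \<open>c\<close> of \<open>exact_big\<close>.\<close>

lemma exact_quartic:
  assumes "B (e1 \<star> (e1 \<star> u)) (e1 \<star> (e1 \<star> u)) \<noteq> 0"
  shows "exact om"
proof -
  define w where "w = ad_pow e1 u"
  have w0: "w 0 = u" by (simp add: w_def)
  have wS: "w (Suc n) = e1 \<star> w n" for n by (simp add: w_def)
  have e1w: "e1 \<star> w 0 = w 1" "e1 \<star> w 1 = w 2" "e1 \<star> w 2 = w 3" "e1 \<star> w 3 = w 4" "e1 \<star> w 4 = w 5"
    unfolding w_def by (simp_all add: numeral_eq_Suc One_nat_def)
  have wLn: "w n \<in> L (1 + n)" for n unfolding w_def by (rule ad_pow_L) simp
  have wL: "w n \<in> L 1" for n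
    unfolding w_def by (cases n) simp_all
  have wZ: "w n \<in> Z" if "5 \<le> n" for n
    using subsetD[OF order_trans[OF L_antimono L6] wLn[of n]] that by simp
  have tab: "B (w i) (w j) = (-1) ^ j * B (w (i + j)) u" for i j
    unfolding w_def by (rule B_ad_pow)
  have odd: "B (w 1) u = 0" "B (w 3) u = 0" "B (w 5) u = 0" "B (w 6) u = 0" "B (w 7) u = 0" "B (w 8) u = 0"
    using B_Z_L1[OF wZ wL[of 0]] by (simp_all add: B_ad_pow_odd w_def)
  define m4 where "m4 = B (w 4) u"
  have T: "B (w 1) (w 2) = 0" "B (w 1) (w 3) = - m4" "B (w 1) (w 4) = 0"
    "B (w 2) (w 1) = 0" "B (w 2) (w 2) = m4" "B (w 2) (w 3) = 0" "B (w 2) (w 4) = 0"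
    "B (w 3) (w 1) = - m4" "B (w 3) (w 2) = 0" "B (w 3) (w 3) = 0" "B (w 3) (w 4) = 0"
    "B (w 4) (w 1) = 0" "B (w 4) (w 2) = 0" "B (w 4) (w 3) = 0" "B (w 4) (w 4) = 0"
    "B (w 0) (w 4) = m4" "B (w 4) (w 0) = m4" "B (w 1) (w 0) = 0" "B (w 3) (w 0) = 0"
    unfolding tab using odd by (simp_all add: m4_def)
  have "w 2 = e1 \<star> (e1 \<star> u)" using e1w(1,2) w0 by simp
  then have m4: "m4 \<noteq> 0" using assms T(5) by simp
  have nZ: "x \<notin> Z" if "B x (w j) \<noteq> 0" for x j using B_Z_L1[OF _ wL] that by blast
  \<comment> \<open>The Gram matrix is triangular with respect to the antidiagonal, whose entries
    are \<open>m4\<close> up to sign. A combination with leading term \<open>w (4 - j)\<close> is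
    therefore detected by \<open>w j\<close>.\<close>
  have ch: "chain Z [w 4, w 3, w 2, w 1, w 0]"
  proof -
    have "w 4 \<notin> Z" by (rule nZ[of _ 0]) (simp add: T m4)
    moreover have "w 3 - k *s w 4 \<notin> Z" for k by (rule nZ[of _ 1]) (simp add: T m4 B_lin)
    moreover have "w 2 - l *s w 3 - k *s w 4 \<notin> Z" for k l by (rule nZ[of _ 2]) (simp add: T m4 B_lin)
    moreover have "w 1 - m *s w 2 - l *s w 3 - k *s w 4 \<notin> Z" for k l m by (rule nZ[of _ 3]) (simp add: T m4 B_lin)
    moreover have "w 0 - n *s w 1 - m *s w 2 - l *s w 3 - k *s w 4 \<notin> Z" for k l m n by (rule nZ[of _ 4]) (simp add: T m4 B_lin)
    ultimately show ?thesis by (simp add: span_breakdown_eq)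
  qed
  have max: "x \<in> span (Z \<union> set [w 4, w 3, w 2, w 1, w 0])" if "x \<in> L 1" for x
    by (rule chain_maximal[OF ch _ _ that]) (use wL rank in simp_all)
  have sp: "L 1 \<subseteq> span ({w 0, w 1, w 2, w 3, w 4} \<union> Z)"
  proof
    fix x assume "x \<in> L 1"
    moreover have "Z \<union> set [w 4, w 3, w 2, w 1, w 0] = {w 0, w 1, w 2, w 3, w 4} \<union> Z" by auto
    ultimately show "x \<in> span ({w 0, w 1, w 2, w 3, w 4} \<union> Z)" using max by metis
  qed
  have "Z \<union> set [w 4, w 3, w 2, w 1, w 0] = insert (w 0) (insert (w 1) (insert (w 2) (insert (w 3) (insert (w 4) Z))))" by auto
  then have "e2 \<star> u \<in> span (insert (w 0) (insert (w 1) (insert (w 2) (insert (w 3) (insert (w 4) Z)))))"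
    using max[OF br_in_L1(1), of e2 u] by simp
  then obtain k0 k1 k2 k3 k4 where k: "e2 \<star> u - k0 *s w 0 - k1 *s w 1 - k2 *s w 2 - k3 *s w 3 - k4 *s w 4 \<in> Z"
    unfolding span_breakdown_eq span_Z by blast
  have pair: "B (e2 \<star> u) (w j) = k0 * B (w 0) (w j) + k1 * B (w 1) (w j) + k2 * B (w 2) (w j) + k3 * B (w 3) (w j) + k4 * B (w 4) (w j)" for j
    using B_Z_L1[OF k wL[of j]] unfolding B_lin by algebra
  have k0: "k0 = 0"
  proof -
    have "e2 \<star> w 4 \<in> Z" using br_L_Suc[OF wLn[of 4], of e2] L6 by auto
    then have "B (e2 \<star> u) (w 4) = 0"
      using B_ad[of e2 u "w 4"] B_Z_L1[of "e2 \<star> w 4" u] B_sym[of u "e2 \<star> w 4"] by simp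
    then show ?thesis using pair[of 4] T m4 by simp
  qed
  \<comment> \<open>\<open>ad e2\<close> is skew, the square of \<open>ad e1\<close> is symmetric,
    and they commute on \<open>L 1\<close> modulo \<open>Z\<close>; so
    \<open>B (e2 \<star> u) (w 2)\<close> equals its negative.\<close>
  have k2: "k2 = 0"
  proof -
    have z1: "e1 \<star> (e2 \<star> w 1) - e2 \<star> w 2 \<in> Z" using comm[OF wL[of 1]] e1w by simp
    have z2: "e1 \<star> (e1 \<star> (e2 \<star> w 0)) - e1 \<star> (e2 \<star> w 1) \<in> Z" using br_Z(1)[OF comm[OF wL[of 0]], of e1] e1w by (simp add: br_lin)
    have "B u (e2 \<star> w 2) = B u (e1 \<star> (e1 \<star> (e2 \<star> u)))"
      using B_Z_L1[OF z1 wL[of 0]] B_Z_L1[OF z2 wL[of 0]] w0 B_sym[of u] by (simp add: B_lin)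
    also have "\<dots> = B (w 2) (e2 \<star> u)" using B_ad[of e1 u "e1 \<star> (e2 \<star> u)"] B_ad[of e1 "e1 \<star> u" "e2 \<star> u"] e1w w0 by simp
    finally have "B (e2 \<star> u) (w 2) = - B (e2 \<star> u) (w 2)" using B_ad[of e2 u "w 2"] B_sym[of "w 2"] by simp
    then have "B (e2 \<star> u) (w 2) = 0" by simp
    then show ?thesis using pair[of 2] T m4 k0 by simp
  qed
  have k4: "k4 = 0"
  proof -
    have "B (e2 \<star> u) (w 0) = 0" unfolding w0 om_def[symmetric] by simp
    then show ?thesis using pair[of 0] T m4 k0 k2 by simp
  qed
  define e2' where "e2' = e2 - k1 *s e1"
  have u': "e1 \<star> e2' = u" by (simp add: e2'_def br_lin bracket_self)
  interpret r: rank_two scale bracket Basis B e1 e2' "\<lambda>x. f1 x + k1 * f2 x" f2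
    by unfold_locales (use frame2_shear2[OF frame] rank in \<open>simp_all add: e2'_def\<close>)
  have e2w: "e2' \<star> w n - k3 *s w (n + 3) \<in> Z" for n
  proof (induction n)
    case 0
    show ?case using k k0 k2 k4 e1w(1) w0 by (simp add: e2'_def br_lin)
  next
    case (Suc n)
    have "e2' \<star> w (Suc n) - k3 *s w (Suc n + 3) = e1 \<star> (e2' \<star> w n - k3 *s w (n + 3)) - (e1 \<star> (e2' \<star> w n) - e2' \<star> (e1 \<star> w n))"
      unfolding wS[of n] wS[of "n + 3", folded add_Suc] br_lin by simp
    then show ?case using subspace_diff[OF subspace_Z br_Z(1)[OF Suc, of e1] r.comm[OF wL[of n]]] by simp
  qed
  have e2w': "e2' \<star> w n \<in> Z" if "2 \<le> n" for n
    using subspace_add[OF subspace_Z e2w[of n] subspace_scale[OF subspace_Z wZ[of "n + 3"], of k3]] that by simp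
  show ?thesis
    by (rule r.exact_big[unfolded u', folded w_def, of k3])
      (use wZ[of 5] e2w[of 0] e2w[of 1] e2w'[of 2] e2w'[of 3] e2w'[of 4] m4 sp in \<open>simp_all add: m4_def\<close>)
qed

lemma exact_quartic_shear:
  assumes "v = e1 + t *s e2" "B (v \<star> (v \<star> u)) (v \<star> (v \<star> u)) \<noteq> 0"
  shows "exact om"
proof -
  interpret r: rank_two scale bracket Basis B v e2 f1 "\<lambda>x. f2 x - t * f1 x"
    by unfold_locales (use frame2_shear1[OF frame] rank in \<open>simp_all add: assms(1)\<close>)
  have "v \<star> e2 = u" by (simp add: assms(1) br_lin bracket_self)
  then show ?thesis using r.exact_quartic assms(2) by simp
qed

lemma exact_quartic_rot:
  assumes "B (e2 \<star> (e2 \<star> u)) (e2 \<star> (e2 \<star> u)) \<noteq> 0"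
  shows "exact om"
proof -
  interpret r: rank_two scale bracket Basis B e2 "- e1" f2 "\<lambda>x. - f1 x"
    by unfold_locales (use frame2_rot[OF frame] rank in simp_all)
  have "e2 \<star> (- e1) = u" using br_skew[of e2 e1] by (simp add: br_lin)
  then show ?thesis using r.exact_quartic assms by simp
qed

text \<open>
  The numbers \<open>B (v\<^sup>2 u) (v\<^sup>2 u)\<close>, for \<open>v\<close> in the span of \<open>e1\<close>, \<open>e2\<close> acting by brackets, form a quartic in \<open>v\<close>.
  If it is nonzero, \<open>exact_quartic\<close> applies in a suitable frame; if it vanishes, polarisation shows that
  all words of length 4, and then by skewness all words of length 3, map \<open>u\<close> into \<open>Z\<close>.
\<close>

lemma exact_rank_two: "exact om"
proof (rule ccontr)
  assume ne: "\<not> exact om"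
  define p q q' r where "p = e1 \<star> (e1 \<star> u)" and "q = e1 \<star> (e2 \<star> u)" and "q' = e2 \<star> (e1 \<star> u)" and "r = e2 \<star> (e2 \<star> u)"
  note defs = p_def q_def q'_def r_def
  have L1s: "p \<in> L 1" "q \<in> L 1" "q' \<in> L 1" "r \<in> L 1" "u \<in> L 1" by (simp_all add: defs)
  have q': "B q' x = B q x" "B x q' = B x q" if "x \<in> L 1" for x
    using B_Z_L1[OF comm[of u] that] B_sym[of x] by (simp_all add: B_lin defs)
  have quart: "B (v \<star> (v \<star> u)) (v \<star> (v \<star> u)) = B p p + 4 * t * B p q + t\<^sup>2 * (4 * B q q + 2 * B p r) + 4 * t ^ 3 * B q r + t ^ 4 * B r r"
    if "v = e1 + t *s e2" for v t
  proof -
    have "v \<star> (v \<star> u) = p + t *s q + t *s q' + (t * t) *s r"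
      by (simp add: that defs br_lin scale_right_distrib)
    then show ?thesis using q'[OF L1s(1)] q'[OF L1s(2)] q'[OF L1s(3)] q'[OF L1s(4)] B_sym[of q p] B_sym[of r p] B_sym[of r q]
      by (simp add: B_lin power2_eq_square power3_eq_cube power4_eq_xxxx algebra_simps)
  qed
  \<comment> \<open>Both are pairings of \<open>u\<close> with a word containing \<open>e1\<close>
    and \<open>e2\<close> twice each, and the order of the operators is immaterial modulo
    \<open>Z\<close>. The middle coefficient of the quartic becomes
    \<open>6 * B q q\<close>.\<close>
  have pr: "B p r = B q q"
  proof -
    have z: "e1 \<star> (e2 \<star> (e1 \<star> u)) - e2 \<star> (e1 \<star> (e1 \<star> u)) \<in> Z" by (rule comm) simp
    have "B p r = - B (e2 \<star> p) (e2 \<star> u)" using B_ad[of e2 p "e2 \<star> u"] by (simp add: r_def)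
    also have "\<dots> = - B (e1 \<star> q') (e2 \<star> u)" using B_Z_L1[OF z, of "e2 \<star> u"] by (simp add: defs B_lin)
    also have "\<dots> = B q' q" using B_ad[of e1 q' "e2 \<star> u"] by (simp add: q_def)
    finally show ?thesis using q'(1)[OF L1s(2)] by simp
  qed
  have p0: "B p p = 0" using exact_quartic ne unfolding p_def by blast
  have r0: "B r r = 0" using exact_quartic_rot ne unfolding r_def by blast
  have t: "4 * t * B p q + 6 * t\<^sup>2 * B q q + 4 * t ^ 3 * B q r = 0" for t
  proof -
    have "B p p + 4 * t * B p q + t\<^sup>2 * (4 * B q q + 2 * B p r) + 4 * t ^ 3 * B q r + t ^ 4 * B r r = 0"
      unfolding quart[OF refl, symmetric] using exact_quartic_shear[OF refl] ne by blast
    then show ?thesis unfolding pr p0 r0 by algebra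
  qed
  \<comment> \<open>The values 1, -1 and 2 of \<open>t\<close> separate the three remaining
    coefficients in characteristic 0.\<close>
  have t1: "4 * B p q + 6 * B q q + 4 * B q r = 0" using t[of 1] by simp
  have t2: "- 4 * B p q + 6 * B q q - 4 * B q r = 0" using t[of "-1"] by simp
  have t3: "8 * B p q + 24 * B q q + 32 * B q r = 0" using t[of 2] by simp
  have "12 * B q q = 0" using t1 t2 by algebra
  then have qq: "B q q = 0" by simp
  have "24 * B q r = 0" using t1 t3 qq by algebra
  then have qr: "B q r = 0" by simp
  have "4 * B p q = 0" using t1 qq qr by algebra
  then have pq: "B p q = 0" by simp
  define E where "E = {e1, e2}"
  define S where "S = {p, q, q', r}"
  have SL: "s \<in> L 1" if "s \<in> S" for s using that L1s unfolding S_def by auto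
  have SE: "e \<star> (e' \<star> u) \<in> S" if "e \<in> E" "e' \<in> E" for e e'
    using that unfolding S_def E_def defs by auto
  have S_E: "\<exists>e\<in>E. \<exists>e'\<in>E. s = e \<star> (e' \<star> u)" if "s \<in> S" for s
    using that unfolding S_def E_def defs by auto
  have SS: "B s s' = 0" if "s \<in> S" "s' \<in> S" for s s'
    using that p0 r0 qq qr pq pr q' L1s B_sym[of q p] B_sym[of r p] B_sym[of r q] unfolding S_def by auto
  have S3: "s \<in> L 3" if "s \<in> S" for s
  proof -
    from S_E[OF that] obtain e e' where "s = e \<star> (e' \<star> u)" by blast
    moreover have "Suc (Suc 1) = 3" by simp
    ultimately show ?thesis using br_L_Suc[OF br_L_Suc[OF br_in_L1(1)]] by metis
  qed
  \<comment> \<open>\<open>u_decomp\<close> leaves two pairings to test. Against \<open>L 2\<close>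
    the element, lying in \<open>L 5\<close>, gives zero because \<open>L 6 \<subseteq> Z\<close>;
    against \<open>u\<close> two brackets are moved over and \<open>SS\<close> applies.\<close>
  have quartic: "e \<star> (e' \<star> s) \<in> Z" if "e \<in> E" "e' \<in> E" "s \<in> S" for e e' s
    unfolding Z_iff
  proof
    fix y assume "y \<in> L 1"
    then obtain k y2 where y2: "y2 \<in> L 2" "y - k *s u - y2 \<in> Z" using u_decomp[OF frame] by blast
    have "Suc (Suc 3) = 5" by simp
    then have x5: "e \<star> (e' \<star> s) \<in> L 5" using br_L_Suc[OF br_L_Suc[OF S3[OF that(3)]]] by metis
    have "L (5 + 1) \<subseteq> Z" using L6 by simp
    from B_L_L[OF this x5, of y2] have "B (e \<star> (e' \<star> s)) y2 = 0" using y2(1) by (simp add: Suc_1)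
    moreover have "B (e \<star> (e' \<star> s)) u = 0" using B_ad[of e "e' \<star> s" u] B_ad[of e' s "e \<star> u"] SS[OF that(3) SE[OF that(2,1)]] by simp
    ultimately show "B (e \<star> (e' \<star> s)) y = 0"
      using B_Z_L1[OF y2(2) br_in_L1(1)[of e "e' \<star> s"]] B_sym[of "e \<star> (e' \<star> s)"] by (simp add: B_lin)
  qed
  have comm2: "e \<star> (e' \<star> a) - e' \<star> (e \<star> a) \<in> Z" if "e \<in> E" "e' \<in> E" "a \<in> L 1" for e e' a
    using that comm[OF that(3)] subspace_neg[OF subspace_Z comm[OF that(3)]] subspace_0[OF subspace_Z] unfolding E_def by auto
  have Bcomm: "B u (e \<star> (e' \<star> a)) = B u (e' \<star> (e \<star> a))" if "e \<in> E" "e' \<in> E" "a \<in> L 1" for e e' a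
    using B_Z_L1[OF comm2[OF that], of u] B_sym[of u] by (simp add: B_lin)
  have Bcomm': "B u (e'' \<star> (e \<star> (e' \<star> a))) = B u (e'' \<star> (e' \<star> (e \<star> a)))" if "e \<in> E" "e' \<in> E" "a \<in> L 1" for e e' e'' a
    using B_Z_L1[OF br_Z(1)[OF comm2[OF that]], of u e''] B_sym[of u] by (simp add: B_lin br_lin)
  \<comment> \<open>Moving three skew operators to the other side gives a sign and reverses their
    order; restoring the order changes nothing modulo \<open>Z\<close>, so the value equals its
    negative.\<close>
  have cubic_u: "B (e \<star> s) u = 0" if e: "e \<in> E" and s: "s \<in> S" for e s
  proof -
    obtain e' e'' where e': "e' \<in> E" "e'' \<in> E" "s = e' \<star> (e'' \<star> u)" using S_E[OF s] by blast
    have "B (e \<star> s) u = - B u (e'' \<star> (e' \<star> (e \<star> u)))"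
      using B_ad[of e s u] B_ad[of e' "e'' \<star> u" "e \<star> u"] B_ad[of e'' u "e' \<star> (e \<star> u)"] by (simp add: e'(3))
    also have "B u (e'' \<star> (e' \<star> (e \<star> u))) = B u (e' \<star> (e'' \<star> (e \<star> u)))" by (rule Bcomm) (use e' in simp_all)
    also have "\<dots> = B u (e' \<star> (e \<star> (e'' \<star> u)))" by (rule Bcomm') (use e e' in simp_all)
    also have "\<dots> = B u (e \<star> (e' \<star> (e'' \<star> u)))" by (rule Bcomm) (use e e' in simp_all)
    finally show ?thesis using B_sym[of u] by (simp add: e'(3))
  qed
  \<comment> \<open>The subspace of \<open>G\<close> orthogonal to all \<open>e \<star> s\<close>
    contains \<open>u\<close> by \<open>cubic_u\<close> and is stable under \<open>e1\<close> and
    \<open>e2\<close> by \<open>quartic\<close>. Cyclicity of \<open>W\<close> makes it contain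
    \<open>L 1\<close>.\<close>
  have cubic: "e \<star> s \<in> Z" if es: "e \<in> E" "s \<in> S" for e s
  proof -
    have "L 1 \<subseteq> {y \<in> G. \<forall>e\<in>E. \<forall>s\<in>S. B (e \<star> s) y = 0}"
    proof (rule span_L1)
      show "subspace {y \<in> G. \<forall>e\<in>E. \<forall>s\<in>S. B (e \<star> s) y = 0}"
        unfolding subspace_def by (auto simp: B_lin intro: span_add span_scale span_zero)
      show "Z \<subseteq> {y \<in> G. \<forall>e\<in>E. \<forall>s\<in>S. B (e \<star> s) y = 0}"
        using B_Z_L1[OF _ br_in_L1(1)] B_sym by (fastforce intro: span_base)
      show "u \<in> {y \<in> G. \<forall>e\<in>E. \<forall>s\<in>S. B (e \<star> s) y = 0}" using cubic_u by simp
      have "e' \<star> t \<in> {y \<in> G. \<forall>e\<in>E. \<forall>s\<in>S. B (e \<star> s) y = 0}" if "t \<in> {y \<in> G. \<forall>e\<in>E. \<forall>s\<in>S. B (e \<star> s) y = 0}" "e' \<in> E" for t e'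
        using that B_G[OF br_in_L1(1) quartic[OF that(2)], of _ _ t] B_ad[of e' _ t] by auto
      then show "e1 \<star> t \<in> {y \<in> G. \<forall>e\<in>E. \<forall>s\<in>S. B (e \<star> s) y = 0}" "e2 \<star> t \<in> {y \<in> G. \<forall>e\<in>E. \<forall>s\<in>S. B (e \<star> s) y = 0}"
        if "t \<in> {y \<in> G. \<forall>e\<in>E. \<forall>s\<in>S. B (e \<star> s) y = 0}" for t
        using that unfolding E_def by blast+
    qed
    then show ?thesis using es unfolding Z_iff by blast
  qed
  define M where "M = {u, e1 \<star> u, e2 \<star> u} \<union> S"
  have sp: "L 1 \<subseteq> span (M \<union> Z)"
  proof (rule span_L1)
    have "e \<star> t \<in> span (M \<union> Z)" if "t \<in> span (M \<union> Z)" and e: "e \<in> E" for e t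
      using that(1)
    proof (induction rule: span_induct_alt)
      case (step c x y)
      have "e \<star> x \<in> M \<union> Z"
      proof (cases "x \<in> Z")
        case True then show ?thesis using br_Z(1) by blast
      next
        case False
        then have "x = u \<or> x = e1 \<star> u \<or> x = e2 \<star> u \<or> x \<in> S" using step unfolding M_def by blast
        then show ?thesis using cubic[OF e] SE[OF e] e unfolding M_def E_def by blast
      qed
      then show ?case using step unfolding br_lin by (intro span_add span_scale) (auto intro: span_base)
    qed (simp add: span_zero)
    then show "e1 \<star> t \<in> span (M \<union> Z)" "e2 \<star> t \<in> span (M \<union> Z)" if "t \<in> span (M \<union> Z)" for t
      using that unfolding E_def by blast+
  qed (auto intro: span_base simp: M_def)
  have in_Z: "x \<in> Z" if x: "x \<in> L 1" "B x u = 0" "\<And>e. e \<in> E \<Longrightarrow> B x (e \<star> u) = 0" "\<And>s. s \<in> S \<Longrightarrow> B x s = 0" for x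
    unfolding Z_iff
  proof
    fix y assume "y \<in> L 1"
    then have "y \<in> G" by (simp add: span_base)
    with sp show "B x y = 0"
    proof (rule G_induct)
      fix z assume "z \<in> Z" then show "B x z = 0" using B_Z_L1[OF _ x(1)] B_sym by metis
    next
      fix y assume "y \<in> M" then show "B x y = 0" using x unfolding M_def E_def by auto
    qed (simp_all add: B_lin)
  qed
  have cubic_B: "B s (e \<star> u) = 0" if "s \<in> S" "e \<in> E" for s e
    using B_ad[of e s u] cubic_u[OF that(2,1)] by simp
  show False
  proof (cases "S \<subseteq> Z")
    case True
    \<comment> \<open>If the words of length 2 vanish modulo \<open>Z\<close>, then so do those of
      length 1, and \<open>W\<close> is at most a line: the abelian case.\<close>
    have eu: "e \<star> u \<in> Z" if e: "e \<in> E" for e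
    proof (rule in_Z)
      show "B (e \<star> u) u = 0" unfolding om_def[symmetric] by simp
      show "B (e \<star> u) (e' \<star> u) = 0" if "e' \<in> E" for e'
        using B_ad[of e u "e' \<star> u"] B_Z_L1[OF subsetD[OF True SE[OF e that]] L1s(5)] B_sym[of u] by simp
      show "B (e \<star> u) s = 0" if "s \<in> S" for s
        using B_Z_L1[OF subsetD[OF True that], of "e \<star> u"] B_sym[of s] by simp
    qed simp
    have MZ: "y = u \<or> y \<in> Z" if "y \<in> M" for y using that eu True unfolding M_def E_def by auto
    have "om a c x = 0" if a: "a \<in> L 1" and c: "c \<in> L 1" for a c x
    proof -
      have "c \<in> G" using c by (simp add: span_base)
      with sp have 1: "om u c x = 0"
      proof (rule G_induct)
        show "om u y x = 0" if "y \<in> M" for y using MZ[OF that] om_Z(2)[of y u x] by auto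
      qed (simp_all add: om_lin om_Z)
      have "a \<in> G" using a by (simp add: span_base)
      with sp show "om a c x = 0"
      proof (rule G_induct)
        show "om y c x = 0" if "y \<in> M" for y using MZ[OF that] om_Z(1)[of y c x] 1 by auto
      qed (simp_all add: om_lin om_Z)
    qed
    then show False using exact_abelian_2[OF frame] ne by blast
  next
    case False
    then obtain s where s: "s \<in> S" "s \<notin> Z" by blast
    define m where "m = B s u"
    \<comment> \<open>An element of \<open>S\<close> is already orthogonal to every generator except
      \<open>u\<close>, so outside \<open>Z\<close> it must pair with \<open>u\<close>. After
      normalisation \<open>red\<close> shows that \<open>t\<close> spans \<open>S\<close> modulo
      \<open>Z\<close>.\<close>
    have m: "m \<noteq> 0" using in_Z[OF SL[OF s(1)] _ cubic_B[OF s(1)] SS[OF s(1)]] s(2) unfolding m_def by blast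
    define t where "t = inverse m *s s"
    have tu: "B t u = 1" using m by (simp add: t_def B_lin m_def)
    have tL: "t \<in> L 1" unfolding t_def using SL[OF s(1)] by (rule subspace_scale[OF subspace_L])
    have et: "e \<star> t \<in> Z" if "e \<in> E" for e unfolding t_def br_lin using cubic[OF that s(1)] by (rule subspace_scale[OF subspace_Z])
    have tS: "B t s' = 0" if "s' \<in> S" for s' using SS[OF s(1) that] by (simp add: t_def B_lin)
    have tt: "B t t = 0" using tS[OF s(1)] unfolding t_def[THEN arg_cong[where f = "B t"]] by (simp add: B_lin)
    have Vt: "exact (V t)"
    proof -
      obtain e e' where e: "e \<in> E" "s = e \<star> (e' \<star> u)" using S_E[OF s(1)] by blast
      have "t = e \<star> (inverse m *s (e' \<star> u))" by (simp add: t_def e(2) br_lin)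
      moreover have "inverse m *s (e' \<star> u) \<in> L 1" by (rule subspace_scale[OF subspace_L]) simp
      ultimately show ?thesis using exact_V e(1) unfolding E_def by auto
    qed
    have red: "s' - B s' u *s t \<in> Z" if s': "s' \<in> S" for s'
    proof (rule in_Z)
      show "s' - B s' u *s t \<in> L 1" using SL[OF s'] tL by (intro subspace_diff subspace_scale subspace_L)
      show "B (s' - B s' u *s t) u = 0" using tu by (simp add: B_lin)
      show "B (s' - B s' u *s t) (e \<star> u) = 0" if "e \<in> E" for e
        using cubic_B[OF s' that] cubic_B[OF s(1) that] by (simp add: B_lin t_def)
      show "B (s' - B s' u *s t) s'' = 0" if "s'' \<in> S" for s''
        using SS[OF s' that] tS[OF that] by (simp add: B_lin)
    qed
    have sp': "L 1 \<subseteq> span ({u, e1 \<star> u, e2 \<star> u, t} \<union> Z)"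
    proof -
      have "x \<in> span ({u, e1 \<star> u, e2 \<star> u, t} \<union> Z)" if "x \<in> S" for x
      proof -
        have "(x - B x u *s t) + B x u *s t \<in> span ({u, e1 \<star> u, e2 \<star> u, t} \<union> Z)"
          using red[OF that] by (intro span_add[OF span_base span_scale[OF span_base]]) auto
        then show ?thesis by simp
      qed
      then have "M \<union> Z \<subseteq> span ({u, e1 \<star> u, e2 \<star> u, t} \<union> Z)" unfolding M_def by (auto intro: span_base)
      from order_trans[OF sp span_minimal[OF this subspace_span]] show ?thesis .
    qed
    have "exact om"
      by (rule exact_small[OF tL _ _ tu tt Vt _ sp']) (use et red SE in \<open>auto simp: E_def\<close>)
    then show False using ne by blast
  qed
qed

end

lemma (in small_quadratic_lie) exact_R2:
  assumes "R = 2" shows "exact om"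
proof -
  obtain e1 e2 f1 f2 where "frame2 e1 e2 f1 f2" using frame2_exists[OF assms] by blast
  then interpret rank_two scale bracket Basis B e1 e2 f1 f2
    by unfold_locales (use assms in simp_all)
  show ?thesis by (rule exact_rank_two)
qed

section \<open>Codimension three\<close>

context quadratic_lie
begin

lemma frame3_rot: "frame3 e1 e2 e3 f1 f2 f3 \<Longrightarrow> frame3 e2 e3 e1 f2 f3 f1"
  unfolding frame3_def by (auto simp: algebra_simps)

lemma frame3_shear:
  assumes "frame3 e1 e2 e3 f1 f2 f3"
  shows "frame3 e1 (e2 - k *s e1) (e3 - l *s e1) (\<lambda>x. f1 x + k * f2 x + l * f3 x) f2 f3"
  using assms unfolding frame3_def linform_def by (simp add: algebra_simps)

end

context small_quadratic_lie
begin

text \<open>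
  Each product of a dual form \<open>f\<^sub>i\<close> with the differential \<open>om e\<^sub>j\<close> of \<open>B e\<^sub>j\<close> is exact; the four relations used
  below are enough to eliminate the components of \<open>om\<close> one after the other.
\<close>

lemma exact_R3_core:
  assumes fr: "frame3 e1 e2 e3 f1 f2 f3"
    and L1_om: "\<And>a b c. a \<in> L 1 \<Longrightarrow> b \<in> L 1 \<Longrightarrow> c \<in> L 1 \<Longrightarrow> om a b c = 0"
    and e23: "\<And>v. v \<in> L 1 \<Longrightarrow> e2 \<star> v \<in> Z" "\<And>v. v \<in> L 1 \<Longrightarrow> e3 \<star> v \<in> Z"
    and w: "w0 \<in> L 1" "w1 = e1 \<star> w0" "w2 = e1 \<star> w1" "e1 \<star> w2 \<in> Z" "w2 \<notin> Z" "B w0 w2 \<noteq> 0"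
    and sp: "L 1 \<subseteq> span ({w0, w1, w2} \<union> Z)"
  shows "exact om"
proof -
  define D where "D x = x - f1 x *s e1 - f2 x *s e2 - f3 x *s e3" for x
  define b where "b a x = B a (D x)" for a x
  have lin: "linform f1" "linform f2" "linform f3" 
    and fG: "x \<in> G \<Longrightarrow> f1 x = 0" "x \<in> G \<Longrightarrow> f2 x = 0" "x \<in> G \<Longrightarrow> f3 x = 0" for x
    using fr unfolding frame3_def by blast+
  have DG: "D x \<in> G" for x using fr unfolding frame3_def D_def by blast
  have D_br: "D (x \<star> y) = x \<star> y" "f1 (x \<star> y) = 0" "f2 (x \<star> y) = 0" "f3 (x \<star> y) = 0" for x y
    using fG[OF br_G] by (simp_all add: D_def)
  have D_lin: "D (x + y) = D x + D y" "D (c *s x) = c *s D x" for x y c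
    using lin by (simp_all add: D_def linform_add linform_scale scale_left_distrib scale_right_diff_distrib)
  have lin_b: "linform (b a)" for a by (simp add: linform_def b_def D_lin B_lin)
  have b_br: "b a (x \<star> y) = om a x y" for a x y by (simp add: b_def D_br B_br)
  have x_eq: "x = f1 x *s e1 + f2 x *s e2 + f3 x *s e3 + D x" for x by (simp add: D_def)
  have b_Z: "b a x = 0" if "a \<in> L 1" "a \<in> Z" for a x unfolding b_def by (rule B_G[OF that DG])
  have G3: "om x y z = 0" if "x \<in> G" "y \<in> G" "z \<in> G" for x y z
    by (rule om_G3[OF that L1_om])
  have eG: "om e2 x y = 0" "om e3 x y = 0" if "x \<in> G" "y \<in> G" for x y
  proof -
    have "om a e2 y = 0" "om a e3 y = 0" if a: "a \<in> L 1" for a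
      using B_G[OF br_in_L1(1) e23(1)[OF a] \<open>y \<in> G\<close>] B_G[OF br_in_L1(1) e23(2)[OF a] \<open>y \<in> G\<close>]
        om_swap(1)[of a e2 y] om_swap(1)[of a e3 y] unfolding om_def by simp_all
    then have "om x e2 y = 0" "om x e3 y = 0" using om_G[OF that(1)] by blast+
    then show "om e2 x y = 0" "om e3 x y = 0" using om_swap(1)[of e2 x y] om_swap(1)[of e3 x y] by simp_all
  qed
  define g where "g = om e1 e2 e3"
  define b12 b13 b23 where "b12 = b (e1 \<star> e2)" and "b13 = b (e1 \<star> e3)" and "b23 = b (e2 \<star> e3)"
  define Q where "Q x y = om e1 (D x) (D y)" for x y
  define F where "F = wedge21 f1 (wedge f2 f3)"
  define V12 V13 V23 where "V12 a = wedge21 (b a) (wedge f1 f2)" and "V13 a = wedge21 (b a) (wedge f1 f3)" and "V23 a = wedge21 (b a) (wedge f2 f3)" for a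
  note Vdefs = V12_def V13_def V23_def F_def wedge21_def wedge_def
  have bD: "om e1 e2 (D x) = b12 x" "om e1 e3 (D x) = b13 x" "om e2 e3 (D x) = b23 x" for x
    by (simp_all add: b12_def b13_def b23_def b_def om_def)
  have ome: "om e1 x y = g * wedge f2 f3 x y + wedge f2 b12 x y + wedge f3 b13 x y + Q x y"
    "om e2 x y = - g * wedge f1 f3 x y - wedge f1 b12 x y + wedge f3 b23 x y"
    "om e3 x y = g * wedge f1 f2 x y - wedge f1 b13 x y - wedge f2 b23 x y" for x y
  proof -
    have *: "om e x y = om e (f1 x *s e1 + f2 x *s e2 + f3 x *s e3 + D x) (f1 y *s e1 + f2 y *s e2 + f3 y *s e3 + D y)" for e
      using x_eq[of x] x_eq[of y] by simp
    have n: "om e1 (D z) e2 = - b12 z" "om e1 (D z) e3 = - b13 z" "om e2 (D z) e3 = - b23 z" 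
      "om e2 e1 (D z) = - b12 z" "om e3 e1 (D z) = - b13 z" "om e3 e2 (D z) = - b23 z"
      "om e2 (D z) e1 = b12 z" "om e3 (D z) e1 = b13 z" "om e3 (D z) e2 = b23 z" for z
      unfolding bD[symmetric] by (rule om_norm)+
    have n': "om e2 e1 e3 = - g" "om e1 e3 e2 = - g" "om e3 e2 e1 = - g" "om e2 e3 e1 = g" "om e3 e1 e2 = g"
      unfolding g_def by (rule om_norm)+
    show "om e1 x y = g * wedge f2 f3 x y + wedge f2 b12 x y + wedge f3 b13 x y + Q x y"
      unfolding *[of e1] by (simp add: om_lin n n' bD g_def[symmetric] Q_def wedge_def algebra_simps)
    show "om e2 x y = - g * wedge f1 f3 x y - wedge f1 b12 x y + wedge f3 b23 x y"
      unfolding *[of e2] by (simp add: om_lin n n' bD g_def[symmetric] eG[OF DG DG] wedge_def algebra_simps)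
    show "om e3 x y = g * wedge f1 f2 x y - wedge f1 b13 x y - wedge f2 b23 x y"
      unfolding *[of e3] by (simp add: om_lin n n' bD g_def[symmetric] eG[OF DG DG] wedge_def algebra_simps)
  qed
  have fD: "f1 (D x) = 0" "f2 (D x) = 0" "f3 (D x) = 0" for x using fG[OF DG] by blast+
  have DD: "D (D x) = D x" for x using fD[of x] D_def[of "D x"] by simp
  have bDD: "b a (D x) = b a x" for a x by (simp add: b_def DD)
  have om_eq: "om x y z = g * F x y z + V12 (e1 \<star> e2) x y z + V13 (e1 \<star> e3) x y z + V23 (e2 \<star> e3) x y z + wedge21 f1 Q x y z" for x y z
  proof -
    have "om x y z = om (f1 x *s e1 + f2 x *s e2 + f3 x *s e3 + D x) y z" using x_eq[of x] by simp
    also have "\<dots> = f1 x * om e1 y z + f2 x * om e2 y z + f3 x * om e3 y z + om y z (D x)"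
      using om_rot[of "D x" y z] by (simp add: om_lin)
    also have "om y z (D x) = om (f1 y *s e1 + f2 y *s e2 + f3 y *s e3 + D y) z (D x)" using x_eq[of y] by simp
    also have "\<dots> = f1 y * om e1 z (D x) + f2 y * om e2 z (D x) + f3 y * om e3 z (D x) + om z (D x) (D y)"
      using om_rot[of "D y" z "D x"] by (simp add: om_lin)
    also have "om z (D x) (D y) = om (f1 z *s e1 + f2 z *s e2 + f3 z *s e3 + D z) (D x) (D y)" using x_eq[of z] by simp
    also have "\<dots> = f1 z * Q x y" using G3[OF DG DG DG] eG[OF DG DG] by (simp add: om_lin Q_def)
    finally have 1: "om x y z = f1 x * om e1 y z + f2 x * om e2 y z + f3 x * om e3 y z +
      (f1 y * om e1 z (D x) + f2 y * om e2 z (D x) + f3 y * om e3 z (D x) + f1 z * Q x y)" .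
    have 2: "Q z (D x) = Q z x" by (simp add: Q_def DD)
    show ?thesis unfolding 1 ome by (simp add: 2 fD b12_def b13_def b23_def bDD Vdefs algebra_simps)
  qed
  have om_L1: "om a x y = wedge f1 f2 x y * B a (e1 \<star> e2) + wedge f1 f3 x y * B a (e1 \<star> e3) + wedge f2 f3 x y * B a (e2 \<star> e3)
    - wedge f1 (b (e1 \<star> a)) x y" if a: "a \<in> L 1" for a x y
  proof -
    have aG: "a \<in> G" using a by (simp add: span_base)
    have n: "om a e1 (D z) = - b (e1 \<star> a) z" "om a (D z) e1 = b (e1 \<star> a) z" for z
      using om_norm(1)[where a = e1 and b = a and c = "D z"] om_norm(4)[where a = e1 and b = a and c = "D z"]
      by (simp_all add: b_def om_def)
    have n2: "om a e2 (D z) = 0" "om a (D z) e2 = 0" "om a e3 (D z) = 0" "om a (D z) e3 = 0" for z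
      using om_norm(1)[where a = e2 and b = a and c = "D z"] om_norm(4)[where a = e2 and b = a and c = "D z"]
        om_norm(1)[where a = e3 and b = a and c = "D z"] om_norm(4)[where a = e3 and b = a and c = "D z"] eG[OF aG DG] by simp_all
    have n3: "om a e2 e1 = - om a e1 e2" "om a e3 e1 = - om a e1 e3" "om a e3 e2 = - om a e2 e3"
      by (rule om_swap(2))+
    have "om a x y = om a (f1 x *s e1 + f2 x *s e2 + f3 x *s e3 + D x) (f1 y *s e1 + f2 y *s e2 + f3 y *s e3 + D y)"
      using x_eq[of x] x_eq[of y] by simp
    also have "\<dots> = wedge f1 f2 x y * om a e1 e2 + wedge f1 f3 x y * om a e1 e3 + wedge f2 f3 x y * om a e2 e3
    - wedge f1 (b (e1 \<star> a)) x y"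
      by (simp add: om_lin n n2 n3 G3[OF aG DG DG] wedge_def algebra_simps)
    finally show ?thesis by (simp add: B_br)
  qed
  note ex = exact_closed[OF lin(1) linform_B[of e1] D_br(2)] exact_closed[OF lin(2) linform_B[of e2] D_br(3)]
    exact_closed[OF lin(3) linform_B[of e3] D_br(4)] exact_closed[OF lin(2) linform_B[of e3] D_br(3)]
  \<comment> \<open>\<open>C\<close>, \<open>A\<close>, \<open>B'\<close>, \<open>D'\<close> are
    \<open>f1 \<and> om e1\<close>, \<open>f2 \<and> om e2\<close>, \<open>f3 \<and> om e3\<close>
    and \<open>f2 \<and> om e3\<close>. By \<open>om_eq\<close>, \<open>om\<close> is the form in
    \<open>C\<close> plus \<open>V23 (e2 \<star> e3)\<close>.\<close>
  have C: "exact (\<lambda>x y z. g * F x y z + V12 (e1 \<star> e2) x y z + V13 (e1 \<star> e3) x y z + wedge21 f1 Q x y z)"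
    by (rule exact_cong[OF ex(1)]) (simp add: B_br ome b12_def b13_def Vdefs algebra_simps)
  have A: "exact (\<lambda>x y z. g * F x y z + V12 (e1 \<star> e2) x y z + V23 (e2 \<star> e3) x y z)"
    by (rule exact_cong[OF ex(2)]) (simp add: B_br ome b12_def b23_def Vdefs algebra_simps)
  have B': "exact (\<lambda>x y z. g * F x y z + V13 (e1 \<star> e3) x y z + V23 (e2 \<star> e3) x y z)"
    by (rule exact_cong[OF ex(3)]) (simp add: B_br ome b13_def b23_def Vdefs algebra_simps)
  have D': "exact (V12 (e1 \<star> e3))"
    by (rule exact_cong[OF ex(4)]) (simp add: B_br ome b13_def b23_def Vdefs algebra_simps)
  have wL: "w0 \<in> L 1" "w1 \<in> L 1" "w2 \<in> L 1" using w(1-3) by simp_all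
  have dec: "\<exists>p r s. a - p *s w0 - r *s w1 - s *s w2 \<in> Z" if "a \<in> L 1" for a
  proof -
    have "{w0, w1, w2} \<union> Z = insert w0 (insert w1 (insert w2 Z))" by auto
    then have "a \<in> span (insert w0 (insert w1 (insert w2 Z)))" using sp that by auto
    then show ?thesis unfolding span_breakdown_eq span_Z by blast
  qed
  have b_dec: "b a x = p * b w0 x + r * b w1 x + s * b w2 x" if "a \<in> L 1" "a - p *s w0 - r *s w1 - s *s w2 \<in> Z" for a p r s x
  proof -
    have "b (a - p *s w0 - r *s w1 - s *s w2) x = 0"
      by (rule b_Z[OF _ that(2)]) (use that(1) wL in \<open>intro subspace_diff subspace_scale subspace_L\<close>)
    then show ?thesis unfolding b_def B_lin by algebra
  qed
  obtain p r c where u23: "e2 \<star> e3 - p *s w0 - r *s w1 - c *s w2 \<in> Z"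
    using dec[OF br_in_L1(1)[of e2 e3]] by blast
  \<comment> \<open>Jacobi, with \<open>e2\<close> and \<open>e3\<close> acting trivially on
    \<open>W\<close>. So \<open>e2 \<star> e3\<close> lies in the kernel of the Jordan block
    \<open>e1\<close>, which is spanned by \<open>w2\<close>.\<close>
  have "e1 \<star> (e2 \<star> e3) \<in> Z"
  proof -
    have "e1 \<star> (e2 \<star> e3) = - (e2 \<star> (e3 \<star> e1) + e3 \<star> (e1 \<star> e2))"
      using jacobi[of e1 e2 e3] by (simp only: eq_neg_iff_add_eq_0 add.assoc)
    also have "\<dots> \<in> Z"
      by (intro subspace_neg[OF subspace_Z] subspace_add[OF subspace_Z] e23 br_in_L1(1))
    finally show ?thesis .
  qed
  from subspace_diff[OF subspace_Z this br_Z(1)[OF u23, of e1]]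
  have e1u: "p *s w1 + r *s w2 + c *s (e1 \<star> w2) \<in> Z"
    by (simp add: br_lin w(2,3)[symmetric] algebra_simps)
  then have e1u': "p *s w1 + r *s w2 \<in> Z"
    using subspace_diff[OF subspace_Z e1u subspace_scale[OF subspace_Z w(4), of c]] by simp
  have sZ: "k = 0" if "k *s w2 \<in> Z" for k
  proof (rule ccontr)
    assume "k \<noteq> 0"
    then have "w2 = inverse k *s (k *s w2)" by simp
    then show False using subspace_scale[OF subspace_Z that, of "inverse k"] w(5) by simp
  qed
  have "p *s w2 \<in> Z"
    using subspace_diff[OF subspace_Z br_Z(1)[OF e1u', of e1] subspace_scale[OF subspace_Z w(4), of r]]
    by (simp add: br_lin w(3)[symmetric])
  then have p0: "p = 0" by (rule sZ)
  then have r0: "r = 0" using e1u' sZ[of r] by simp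
  have b23: "b (e2 \<star> e3) x = c * b w2 x" for x
    using b_dec[OF br_in_L1(1) u23] p0 r0 by simp
  have V23: "V23 (e2 \<star> e3) x y z = c * V23 w2 x y z" for x y z
    by (simp add: V23_def wedge21_def b23 algebra_simps)
  have red: "exact om" if "exact (\<lambda>x y z. c * V23 w2 x y z)"
    by (rule exact_cong[OF exact_add[OF C that]]) (simp add: om_eq V23)
  show ?thesis
  proof (cases "c = 0")
    case True
    then show ?thesis by (intro red) (simp add: exact_zero)
  next
    case False
    \<comment> \<open>In \<open>f1 \<and> om w0\<close> every term containing \<open>f1\<close>
      disappears, leaving \<open>B w0 (e2 \<star> e3)\<close> times \<open>F\<close>.\<close>
    have "exact (\<lambda>x y z. (c * B w0 w2) * F x y z)"
    proof (rule exact_cong[OF exact_closed[OF lin(1) lin_b[of w0] D_br(2)]])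
      have "B w0 (e2 \<star> e3) = c * B w0 w2"
        using B_Z_L1[OF u23 wL(1)] p0 r0 B_sym[of w0] by (simp add: B_lin)
      then show "c * B w0 w2 * F x y z = f1 x * b w0 (y \<star> z) + f1 y * b w0 (z \<star> x) + f1 z * b w0 (x \<star> y)" for x y z
        by (simp add: b_br om_L1[OF wL(1)] Vdefs algebra_simps)
    qed
    then have F: "exact F" by (rule exact_cancel) (use False w(6) in simp)
    have V1: "exact (V12 (e1 \<star> a))" "exact (V13 (e1 \<star> a))" if a: "a \<in> L 1" for a
    proof -
      show "exact (V12 (e1 \<star> a))"
        by (rule exact_cong[OF exact_add[OF exact_closed[OF lin(2) lin_b[of a] D_br(3)] exact_scale[OF F, of "B a (e1 \<star> e3)"]]])
          (simp add: b_br om_L1[OF a] Vdefs algebra_simps)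
      show "exact (V13 (e1 \<star> a))"
        by (rule exact_cong[OF exact_add[OF exact_closed[OF lin(3) lin_b[of a] D_br(4)] exact_scale[OF F, of "- B a (e1 \<star> e2)"]]])
          (simp add: b_br om_L1[OF a] Vdefs algebra_simps)
    qed
    have Vw: "exact (V12 w1)" "exact (V12 w2)" "exact (V13 w1)" "exact (V13 w2)"
      using V1[OF wL(1)] V1[OF wL(2)] w(2,3) by simp_all
    obtain p2 r2 s2 where u12: "e1 \<star> e2 - p2 *s w0 - r2 *s w1 - s2 *s w2 \<in> Z"
    using dec[OF br_in_L1(1)[of e1 e2]] by blast
    obtain p3 r3 s3 where u13: "e1 \<star> e3 - p3 *s w0 - r3 *s w1 - s3 *s w2 \<in> Z"
    using dec[OF br_in_L1(1)[of e1 e3]] by blast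
    note b12' = b_dec[OF br_in_L1(1) u12] and b13' = b_dec[OF br_in_L1(1) u13]
    have V12u: "V12 (e1 \<star> e2) x y z = p2 * V12 w0 x y z + r2 * V12 w1 x y z + s2 * V12 w2 x y z"
      "V12 (e1 \<star> e3) x y z = p3 * V12 w0 x y z + r3 * V12 w1 x y z + s3 * V12 w2 x y z"
      "V13 (e1 \<star> e3) x y z = p3 * V13 w0 x y z + r3 * V13 w1 x y z + s3 * V13 w2 x y z" for x y z
      by (simp_all add: V12_def V13_def wedge21_def b12' b13' algebra_simps)
    have A2: "exact (\<lambda>x y z. p2 * V12 w0 x y z + c * V23 w2 x y z)"
      by (rule exact_cong[OF exact_add[OF exact_add[OF A exact_scale[OF F, of "-g"]] exact_add[OF exact_scale[OF Vw(1), of "-r2"] exact_scale[OF Vw(2), of "-s2"]]]])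
        (simp add: V12u V23)
    have B2: "exact (\<lambda>x y z. p3 * V13 w0 x y z + c * V23 w2 x y z)"
      by (rule exact_cong[OF exact_add[OF exact_add[OF B' exact_scale[OF F, of "-g"]] exact_add[OF exact_scale[OF Vw(3), of "-r3"] exact_scale[OF Vw(4), of "-s3"]]]])
        (simp add: V12u V23)
    have D2: "exact (\<lambda>x y z. p3 * V12 w0 x y z)"
      by (rule exact_cong[OF exact_add[OF D' exact_add[OF exact_scale[OF Vw(1), of "-r3"] exact_scale[OF Vw(2), of "-s3"]]]])
        (simp add: V12u)
    \<comment> \<open>For \<open>p3 = 0\<close> the relation \<open>B2\<close> is already the claim.
      Otherwise \<open>D2\<close> makes \<open>V12 w0\<close> exact, and \<open>A2\<close>
      finishes.\<close>
    show ?thesis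
    proof (cases "p3 = 0")
      case True
      then have "exact (\<lambda>x y z. c * V23 w2 x y z)" using B2 by simp
      then show ?thesis by (rule red)
    next
      case False
      have V: "exact (V12 w0)" by (rule exact_cancel[OF D2 False])
      have "exact (\<lambda>x y z. c * V23 w2 x y z)"
        by (rule exact_cong[OF exact_add[OF A2 exact_scale[OF V, of "- p2"]]]) simp
      then show ?thesis by (rule red)
    qed
  qed
qed

text \<open>If \<open>om a b c\<close> were nonzero, \<open>a\<close>, \<open>b\<close>,
  \<open>c\<close> would be a basis of \<open>L 1\<close> modulo \<open>Z\<close>, as
  \<open>2 * 3 + 3 = 9\<close>, and an element of \<open>L 1\<close> would be determined modulo
  \<open>Z\<close> by its values under \<open>om\<close> on pairs of them. These vanish on
  \<open>L j\<close> when \<open>L (j + 1) \<subseteq> Z\<close>, so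
  \<open>L 4 \<subseteq> Z\<close> descends to \<open>L 1 \<subseteq> Z\<close>.\<close>

lemma derived_bracket_R3:
  assumes R: "R = 3" and abc: "a \<in> L 1" "b \<in> L 1" "c \<in> L 1"
  shows "om a b c = 0"
proof (rule ccontr)
  assume ne: "om a b c \<noteq> 0"
  have nZ: "x \<notin> Z" if "om x y z \<noteq> 0" for x y z using om_Z(1)[of x y z] that by blast
  have "a \<notin> Z" using ne by (rule nZ)
  moreover have "b - k *s a \<notin> Z" for k using nZ[of "b - k *s a" c a] ne om_rot[of a b c] by (simp add: om_lin)
  moreover have "c - l *s b - k *s a \<notin> Z" for k l
    using nZ[of "c - l *s b - k *s a" a b] ne om_norm(5)[where a = a and b = b and c = c] by (simp add: om_lin)
  ultimately have ch: "chain Z [a, b, c]" by (simp add: span_breakdown_eq)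
  have dec: "\<exists>p q r. x - r *s c - q *s b - p *s a \<in> Z" if "x \<in> L 1" for x
  proof -
    have "Z \<union> set [a, b, c] = insert c (insert b (insert a Z))" by auto
    then have "x \<in> span (insert c (insert b (insert a Z)))"
      using chain_maximal[OF ch _ _ that] abc R by simp
    then show ?thesis unfolding span_breakdown_eq span_Z by blast
  qed
  have step: "L j \<subseteq> Z" if j: "1 \<le> j" "L (Suc j) \<subseteq> Z" for j
  proof
    fix x assume x: "x \<in> L j"
    have x1: "x \<in> L 1" by (rule subsetD[OF L_antimono[OF j(1)] x])
    have z: "om x y v = 0" if "v \<in> L 1" for y v
      unfolding om_def by (rule B_Z_L1[OF subsetD[OF j(2) br_L_Suc'[OF x]] that])
    obtain p q r where pqr: "x - r *s c - q *s b - p *s a \<in> Z" using dec[OF x1] by blast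
    have "om (x - r *s c - q *s b - p *s a) v y = 0" for v y using om_Z(1)[OF pqr] .
    from this[of b c] this[of c a] this[of a b] have "p = 0" "q = 0" "r = 0"
      using z[OF abc(1)] z[OF abc(2)] z[OF abc(3)] ne om_rot[of a b c] om_norm(5)[where a = a and b = b and c = c]
      by (simp_all add: om_lin)
    then show "x \<in> Z" using pqr by simp
  qed
  have "L 4 \<subseteq> Z" using L_small[of 4] R by simp
  then have "L 3 \<subseteq> Z" using step[of 3] by simp
  then have "L 2 \<subseteq> Z" using step[of 2] by simp
  then have "L 1 \<subseteq> Z" using step[of 1] by simp
  then show False using nZ[OF ne] abc(1) by blast
qed

text \<open>Here \<open>e1\<close> acts nontrivially on \<open>W\<close>, of dimension at most 3,
  which forces a single Jordan block. Operators commuting with it are polynomials in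
  \<open>e1\<close>; skewness leaves the linear term, and a shear of the frame removes that, so
  \<open>e2\<close> and \<open>e3\<close> may be taken to act trivially.\<close>

lemma exact_R3_aux:
  assumes R: "R = 3" and fr: "frame3 e1 e2 e3 f1 f2 f3" and ab: "a \<in> L 1" "b \<in> L 1" "om e1 a b \<noteq> 0"
  shows "exact om"
proof -
  have L1_om: "om a b c = 0" if "a \<in> L 1" "b \<in> L 1" "c \<in> L 1" for a b c
    by (rule derived_bracket_R3[OF R that])
  have L1_br: "a \<star> c \<in> Z" if "a \<in> L 1" "c \<in> L 1" for a c
    unfolding Z_iff[of "a \<star> c"] om_def[symmetric] using L1_om[OF that] by blast
  have nZ: "x \<notin> Z" if "B x y \<noteq> 0" "y \<in> L 1" for x y using B_Z_L1[of x y] that by blast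
  have "\<exists>w\<in>L 1. e1 \<star> (e1 \<star> w) \<notin> Z"
  proof (rule ccontr)
    assume "\<not> (\<exists>w\<in>L 1. e1 \<star> (e1 \<star> w) \<notin> Z)"
    \<comment> \<open>If \<open>e1\<close> had square zero on \<open>W\<close>, its image would be
      isotropic. Since \<open>a\<close> and \<open>b\<close> pair with \<open>e1 \<star> b\<close>
      and \<open>e1 \<star> a\<close>, four independent vectors would result, and
      \<open>2 * 3 + 4 > 9\<close>.\<close>
    then have z: "B (e1 \<star> v) (e1 \<star> v') = 0" if "v \<in> L 1" "v' \<in> L 1" for v v'
      using B_Z_L1[of "e1 \<star> (e1 \<star> v)" v'] B_ad[of e1 "e1 \<star> v" v'] that by auto
    have s: "B (e1 \<star> v) v = 0" for v unfolding om_def[symmetric] by simp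
    have ba: "B (e1 \<star> b) a = - B (e1 \<star> a) b" using om_norm(2)[where a = e1 and b = a and c = b] unfolding om_def .
    have ab': "B (e1 \<star> a) b \<noteq> 0" using ab(3) by (simp add: om_def)
    have "e1 \<star> a \<notin> Z" by (rule nZ[OF ab' ab(2)])
    moreover have "e1 \<star> b - k *s (e1 \<star> a) \<notin> Z" for k
      by (rule nZ[OF _ ab(1)]) (simp add: B_lin s ba ab')
    moreover have "a - l *s (e1 \<star> b) - k *s (e1 \<star> a) \<notin> Z" for k l
      by (rule nZ[of _ "e1 \<star> b"]) (simp_all add: B_lin z ab B_sym[of a] ba ab')
    moreover have "b - m *s a - l *s (e1 \<star> b) - k *s (e1 \<star> a) \<notin> Z" for k l m
      by (rule nZ[of _ "e1 \<star> a"]) (simp_all add: B_lin z ab B_sym[of a] B_sym[of b] s ab')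
    ultimately have "chain Z [e1 \<star> a, e1 \<star> b, a, b]" by (simp add: span_breakdown_eq)
    from chain_bound[OF this] show False using ab dim9 R by simp
  qed
  then obtain w where w: "w \<in> L 1" "e1 \<star> (e1 \<star> w) \<notin> Z" by blast
  define w1 w2 where "w1 = e1 \<star> w" and "w2 = e1 \<star> w1"
  have wL: "w \<in> L 1" "w1 \<in> L 1" "w2 \<in> L 1" by (simp_all add: w w1_def w2_def)
  have w3: "e1 \<star> w2 \<in> Z"
  proof -
    have "e1 \<star> w2 \<in> L (Suc (Suc (Suc 1)))" unfolding w1_def w2_def using w(1) by (intro br_L_Suc)
    moreover have "Suc (Suc (Suc 1)) = 4" by simp
    ultimately show ?thesis using L_small[of 4] R by auto
  qed
  have w2: "w2 \<notin> Z" using w(2) by (simp add: w1_def w2_def)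
  have ch: "chain Z [w2, w1, w]"
  proof -
    have 1: "w1 - k *s w2 \<notin> Z" for k
    proof
      assume "w1 - k *s w2 \<in> Z"
      from subspace_add[OF subspace_Z br_Z(1)[OF this, of e1] subspace_scale[OF subspace_Z w3, of k]]
      show False using w2 by (simp add: br_lin w2_def)
    qed
    have 2: "w - l *s w1 - k *s w2 \<notin> Z" for k l
    proof
      assume "w - l *s w1 - k *s w2 \<in> Z"
      from subspace_add[OF subspace_Z br_Z(1)[OF this, of e1] subspace_scale[OF subspace_Z w3, of k]]
      have "w1 - l *s w2 \<in> Z" by (simp add: br_lin w1_def w2_def)
      then show False using 1 by blast
    qed
    show ?thesis using 1 2 w2 by (simp add: span_breakdown_eq)
  qed
  have max: "x \<in> span ({w, w1, w2} \<union> Z)" if "x \<in> L 1" for x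
  proof -
    have "Z \<union> set [w2, w1, w] = {w, w1, w2} \<union> Z" by auto
    then show ?thesis using chain_maximal[OF ch _ _ that] wL R by simp
  qed
  then have sp: "L 1 \<subseteq> span ({w, w1, w2} \<union> Z)" by blast
  have dec: "\<exists>p q r. x - p *s w - q *s w1 - r *s w2 \<in> Z" if "x \<in> L 1" for x
  proof -
    have "{w, w1, w2} \<union> Z = insert w (insert w1 (insert w2 Z))" by auto
    then have "x \<in> span (insert w (insert w1 (insert w2 Z)))"
      using max[OF that] by simp
    then show ?thesis unfolding span_breakdown_eq span_Z by blast
  qed
  have T: "B w1 w = 0" "B w1 w1 = - B w2 w" "B w2 w1 = 0" "B w1 w2 = 0" "B w2 w2 = 0" "B w w1 = 0" "B w w2 = B w2 w"
  proof -
    show 1: "B w1 w = 0" "B w2 w1 = 0" unfolding w1_def w2_def om_def[symmetric] by simp_all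
    show "B w1 w1 = - B w2 w" using B_ad[of e1 w1 w] by (simp add: w1_def w2_def)
    show "B w2 w2 = 0" using B_ad[of e1 w1 w2] B_Z_L1[OF w3 wL(2)] B_sym[of w1 "e1 \<star> w2"] by (simp add: w2_def)
    show "B w1 w2 = 0" "B w w1 = 0" "B w w2 = B w2 w" using 1 B_sym by metis+
  qed
  have q: "B w2 w \<noteq> 0"
  proof
    assume q0: "B w2 w = 0"
    have "B w2 y = 0" if y: "y \<in> G" for y using sp y
    proof (rule G_induct)
      show "B w2 z = 0" if "z \<in> Z" for z using B_Z_L1[OF that wL(3)] B_sym by metis
    qed (use q0 T in \<open>auto simp: B_lin\<close>)
    then have "B w2 y = 0" if "y \<in> L 1" for y using that by (simp add: span_base)
    then show False using w2 Z_iff by blast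
  qed
  have comm: "e1 \<star> (e \<star> v) - e \<star> (e1 \<star> v) \<in> Z" if "v \<in> L 1" for e v
    using L1_br[OF br_in_L1(1)[of e1 e] that] jacobi_left[of e1 e v] by simp
  have red: "\<exists>k. \<forall>v\<in>L 1. (e - k *s e1) \<star> v \<in> Z" for e
  proof -
    obtain p k r where pkr: "e \<star> w - p *s w - k *s w1 - r *s w2 \<in> Z" using dec[OF br_in_L1(1)] by blast
    have z1: "e1 \<star> (e \<star> w1) - e \<star> w2 \<in> Z" using comm[OF wL(2)] by (simp add: w2_def)
    have z2: "e1 \<star> (e1 \<star> (e \<star> w)) - e1 \<star> (e \<star> w1) \<in> Z"
      using br_Z(1)[OF comm[OF wL(1)], of e1] by (simp add: br_lin w1_def)
    have "B w (e \<star> w2) = B w (e1 \<star> (e1 \<star> (e \<star> w)))"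
      using B_Z_L1[OF z1 wL(1)] B_Z_L1[OF z2 wL(1)] B_sym[of w] by (simp add: B_lin)
    also have "\<dots> = B w2 (e \<star> w)" using B_ad[of e1 w "e1 \<star> (e \<star> w)"] B_ad[of e1 w1 "e \<star> w"] by (simp add: w1_def w2_def)
    finally have "B (e \<star> w) w2 = - B (e \<star> w) w2" using B_ad[of e w w2] B_sym[of w2] by simp
    then have "B (e \<star> w) w2 = 0" by simp
    then have p0: "p = 0" using B_Z_L1[OF pkr wL(3)] T q by (simp add: B_lin)
    have "B (e \<star> w) w = 0" unfolding om_def[symmetric] by simp
    then have r0: "r = 0" using B_Z_L1[OF pkr wL(1)] T q p0 by (simp add: B_lin)
    define e' where "e' = e - k *s e1"
    have 0: "e' \<star> w \<in> Z" using pkr p0 r0 by (simp add: e'_def br_lin w1_def)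
    have st: "e' \<star> (e1 \<star> v) \<in> Z" if "v \<in> L 1" "e' \<star> v \<in> Z" for v
      using subspace_diff[OF subspace_Z br_Z(1)[OF that(2), of e1] comm[OF that(1), of e']] by simp
    have 1: "e' \<star> w1 \<in> Z" using st[OF wL(1) 0] by (simp add: w1_def)
    have 2: "e' \<star> w2 \<in> Z" using st[OF wL(2) 1] by (simp add: w2_def)
    have "e' \<star> v \<in> Z" if "v \<in> G" for v
      using sp that
    proof (rule G_induct)
      show "e' \<star> x \<in> Z" if "x \<in> {w, w1, w2}" for x using 0 1 2 that by blast
    qed (simp_all add: br_lin br_Z subspace_0[OF subspace_Z] subspace_add[OF subspace_Z] subspace_scale[OF subspace_Z])
    then have "\<forall>v\<in>L 1. (e - k *s e1) \<star> v \<in> Z" unfolding e'_def by (simp add: span_base)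
    then show ?thesis ..
  qed
  obtain k where k: "\<forall>v\<in>L 1. (e2 - k *s e1) \<star> v \<in> Z" using red by blast
  obtain l where l: "\<forall>v\<in>L 1. (e3 - l *s e1) \<star> v \<in> Z" using red by blast
  show ?thesis
    by (rule exact_R3_core[OF frame3_shear[OF fr, of k l] L1_om _ _ w(1) w1_def w2_def w3 w2 _ sp])
      (use k l q T in auto)
qed

text \<open>Either no direction outside \<open>G\<close> acts on \<open>W\<close>, which is the
  abelian case, or a rotation of the frame puts an acting direction first.\<close>

lemma exact_R3:
  assumes R: "R = 3" shows "exact om"
proof -
  obtain e1 e2 e3 f1 f2 f3 where fr: "frame3 e1 e2 e3 f1 f2 f3" using frame3_exists[OF R] by blast
  show ?thesis
  proof (cases "\<forall>a\<in>L 1. \<forall>b\<in>L 1. \<forall>x. om a b x = 0")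
    case True
    then show ?thesis using exact_abelian_3[OF fr] by blast
  next
    case False
    then obtain a b x where ab: "a \<in> L 1" "b \<in> L 1" "om a b x \<noteq> 0" by blast
    have G: "x - f1 x *s e1 - f2 x *s e2 - f3 x *s e3 \<in> G" using fr unfolding frame3_def by blast
    have "om (x - f1 x *s e1 - f2 x *s e2 - f3 x *s e3) a b = 0"
      by (rule om_G[OF G]) (rule derived_bracket_R3[OF R _ ab(1,2)])
    then have "om e1 a b \<noteq> 0 \<or> om e2 a b \<noteq> 0 \<or> om e3 a b \<noteq> 0"
      using ab(3) om_rot[of x a b] by (auto simp: om_lin)
    then show ?thesis
      using exact_R3_aux[OF R fr ab(1,2)] exact_R3_aux[OF R frame3_rot[OF fr] ab(1,2)]
        exact_R3_aux[OF R frame3_rot[OF frame3_rot[OF fr]] ab(1,2)] by blast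
  qed
qed

theorem exact_om: "exact om"
proof -
  have "R \<le> 1 \<or> R = 2 \<or> R = 3 \<or> R = 4" using R_le by linarith
  then show ?thesis using exact_R1 exact_R2 exact_R3 exact_R4 by blast
qed

end

section \<open>Linear functionals on free vector spaces\<close>

interpretation free: vector_space "fscale :: 'k::field \<Rightarrow> ('x \<Rightarrow>\<^sub>0 'k) \<Rightarrow> ('x \<Rightarrow>\<^sub>0 'k)"
  by (rule vector_space_fscale)

definition functional :: "(('x \<Rightarrow>\<^sub>0 'k::field) \<Rightarrow> 'k) \<Rightarrow> bool" where
  "functional \<phi> \<longleftrightarrow> (\<forall>p q. \<phi> (p + q) = \<phi> p + \<phi> q) \<and> (\<forall>c p. \<phi> (fscale c p) = c * \<phi> p)"

lemma functional_add: "functional \<phi> \<Longrightarrow> \<phi> (p + q) = \<phi> p + \<phi> q"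
  and functional_scale: "functional \<phi> \<Longrightarrow> \<phi> (fscale c p) = c * \<phi> p"
  by (simp_all add: functional_def)

lemma functional_zero: "functional \<phi> \<Longrightarrow> \<phi> 0 = 0"
  using functional_scale[of \<phi> 0 0] by simp

lemma functional_diff: "functional \<phi> \<Longrightarrow> \<phi> (p - q) = \<phi> p - \<phi> q"
  using functional_add[of \<phi> "p - q" q] by simp

lemma functional_sum: "functional \<phi> \<Longrightarrow> \<phi> (\<Sum>x\<in>A. f x) = (\<Sum>x\<in>A. \<phi> (f x))"
  by (induction A rule: infinite_finite_induct) (simp_all add: functional_zero functional_add)

lemma (in vector_space) separating_functional:
  assumes S: "subspace S" and v: "v \<notin> S"
  obtains \<phi> where "\<And>x y. \<phi> (x + y) = \<phi> x + \<phi> y" "\<And>c x. \<phi> (scale c x) = c * \<phi> x"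
    "\<And>x. x \<in> S \<Longrightarrow> \<phi> x = 0" "\<phi> v = 1"
proof -
  obtain A where A: "A \<subseteq> S" "independent A" "S \<subseteq> span A" by (rule basis_exists[of S])
  have SA: "span A = S" using A S by (metis span_minimal subset_antisym)
  have "independent (insert v A)" using v A(2) SA by (simp add: independent_insert)
  then obtain C where C: "insert v A \<subseteq> C" "independent C" "UNIV \<subseteq> span C"
    using maximal_independent_subset_extend[OF subset_UNIV, of "insert v A"] by metis
  have all: "x \<in> span C" for x using C(3) by blast
  show ?thesis
  proof
    show "representation C (x + y) v = representation C x v + representation C y v" for x y
      using representation_add[OF C(2) all all, of x y] by simp
    show "representation C (scale c x) v = c * representation C x v" for c x
      using representation_scale[OF C(2) all, of c x] by simp
    show "representation C x v = 0" if "x \<in> S" for x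
    proof -
      have "representation C x = representation A x"
        by (rule representation_extend[OF C(2)]) (use that SA C(1) in auto)
      then show ?thesis using representation_ne_zero[of A x v] v A(1) by auto
    qed
    show "representation C v v = 1"
      using representation_basis[OF C(2), of v] C(1) by simp
  qed
qed

lemma functional_span:
  assumes "functional \<phi>" "\<And>g. g \<in> A \<Longrightarrow> \<phi> g = 0" "p \<in> fspan A"
  shows "\<phi> p = 0"
  using assms(3)
  by (induction rule: free.span_induct_alt)
    (simp_all add: functional_zero functional_add functional_scale assms(1,2))

text \<open>Duality: a vector outside a subspace is detected by a functional vanishing on it.
  Well-definedness on quotients and vanishing in \<open>Kill(g)\<close> are thereby tested on
  multilinear forms.\<close>

lemma in_spanI:
  assumes "\<And>\<phi>. functional \<phi> \<Longrightarrow> \<forall>g\<in>A. \<phi> g = 0 \<Longrightarrow> \<phi> p = 0"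
  shows "p \<in> fspan A"
proof (rule ccontr)
  assume "p \<notin> fspan A"
  then obtain \<phi> where \<phi>: "\<And>x y. \<phi> (x + y) = \<phi> x + \<phi> y" "\<And>c x. \<phi> (fscale c x) = c * \<phi> x"
    "\<And>x. x \<in> fspan A \<Longrightarrow> \<phi> x = 0" "\<phi> p = 1"
    using free.separating_functional[OF free.subspace_span] by metis
  then show False using assms[of \<phi>] free.span_base[of _ A] unfolding functional_def by auto
qed

lemma sum_keys:
  fixes p :: "'x \<Rightarrow>\<^sub>0 'k::field"
  assumes "finite A" "Poly_Mapping.keys p \<subseteq> A"
  shows "(\<Sum>x\<in>Poly_Mapping.keys p. Poly_Mapping.lookup p x * F x) = (\<Sum>x\<in>A. Poly_Mapping.lookup p x * F x)"
  by (rule sum.mono_neutral_left[OF assms]) (auto simp: in_keys_iff)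

text \<open>Linear extension with values in the field; it also describes the coordinates of
  \<open>lin_ext\<close>, whose values lie in a free space.\<close>

definition scalar_ext :: "('x \<Rightarrow> 'k) \<Rightarrow> ('x \<Rightarrow>\<^sub>0 'k::field) \<Rightarrow> 'k" where
  "scalar_ext F p = (\<Sum>x\<in>Poly_Mapping.keys p. Poly_Mapping.lookup p x * F x)"

lemma functional_scalar_ext:
  fixes F :: "'x \<Rightarrow> 'k::field"
  shows "functional (scalar_ext F)"
  unfolding functional_def
proof (intro conjI allI)
  fix p q :: "'x \<Rightarrow>\<^sub>0 'k" and c :: 'k
  let ?A = "Poly_Mapping.keys p \<union> Poly_Mapping.keys q"
  have "scalar_ext F (p + q) = (\<Sum>x\<in>?A. Poly_Mapping.lookup (p + q) x * F x)"
    unfolding scalar_ext_def by (rule sum_keys) (use keys_add[of p q] in auto)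
  also have "\<dots> = (\<Sum>x\<in>?A. Poly_Mapping.lookup p x * F x) + (\<Sum>x\<in>?A. Poly_Mapping.lookup q x * F x)"
    by (simp add: lookup_add distrib_right sum.distrib)
  also have "\<dots> = scalar_ext F p + scalar_ext F q"
    unfolding scalar_ext_def by (intro arg_cong2[where f = "(+)"] sum_keys[symmetric]) auto
  finally show "scalar_ext F (p + q) = scalar_ext F p + scalar_ext F q" .
  have "scalar_ext F (fscale c p) = (\<Sum>x\<in>Poly_Mapping.keys p. Poly_Mapping.lookup (fscale c p) x * F x)"
    unfolding scalar_ext_def by (rule sum_keys) (auto simp: in_keys_iff)
  then show "scalar_ext F (fscale c p) = c * scalar_ext F p"
    by (simp add: scalar_ext_def sum_distrib_left mult.assoc)
qed

lemma scalar_ext_basis [simp]: "scalar_ext F (basis_vec x) = F x"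
  by (simp add: scalar_ext_def)

lemma functional_lin_ext: "functional \<phi> \<Longrightarrow> \<phi> (lin_ext f p) = scalar_ext (\<lambda>x. \<phi> (f x)) p"
  by (simp add: lin_ext_def scalar_ext_def functional_sum functional_scale)

lemma lookup_lin_ext: "Poly_Mapping.lookup (lin_ext f p) y = scalar_ext (\<lambda>x. Poly_Mapping.lookup (f x) y) p"
  by (rule functional_lin_ext) (simp add: functional_def lookup_add)

lemma lin_ext_zero [simp]: "lin_ext f 0 = 0"
  by (simp add: lin_ext_def)

lemma lin_ext_add: "lin_ext f (p + q) = lin_ext f p + lin_ext f q"
  by (rule poly_mapping_eqI) (simp add: lookup_lin_ext lookup_add functional_add[OF functional_scalar_ext])

lemma lin_ext_scale: "lin_ext f (fscale c p) = fscale c (lin_ext f p)"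
  by (rule poly_mapping_eqI) (simp add: lookup_lin_ext functional_scale[OF functional_scalar_ext])

lemma lin_ext_basis [simp]: "lin_ext f (basis_vec x) = f x"
  by (rule poly_mapping_eqI) (simp add: lookup_lin_ext)

lemma functional_comp: "functional \<phi> \<Longrightarrow> functional (\<lambda>p. \<phi> (lin_ext f p))"
  by (simp add: functional_def lin_ext_add lin_ext_scale)

lemma functional_eq_scalar_ext:
  assumes "functional \<phi>"
  shows "\<phi> p = scalar_ext (\<lambda>x. \<phi> (basis_vec x)) p"
proof -
  have "lin_ext basis_vec p = p"
  proof (rule poly_mapping_eqI)
    fix y
    have "Poly_Mapping.lookup (lin_ext basis_vec p) y = (\<Sum>x\<in>Poly_Mapping.keys p. if x = y then Poly_Mapping.lookup p x else 0)"
      unfolding lookup_lin_ext scalar_ext_def by (rule sum.cong) (auto simp: lookup_single when_def)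
    also have "\<dots> = Poly_Mapping.lookup p y" by (simp add: in_keys_iff)
    finally show "Poly_Mapping.lookup (lin_ext basis_vec p) y = Poly_Mapping.lookup p y" .
  qed
  then show ?thesis using functional_lin_ext[OF assms, of basis_vec p] by simp
qed

lemma functional_tuple_space:
  assumes "functional \<phi>" "\<And>xs. length xs = n \<Longrightarrow> \<phi> (basis_vec xs) = 0" "p \<in> tuple_space n"
  shows "\<phi> p = 0"
  unfolding functional_eq_scalar_ext[OF assms(1), of p] scalar_ext_def
  using assms(2,3) by (intro sum.neutral) (auto simp: tuple_space_def)

lemma tuple_space_add: "p \<in> tuple_space n \<Longrightarrow> q \<in> tuple_space n \<Longrightarrow> p + q \<in> tuple_space n"
  using keys_add[of p q] unfolding tuple_space_def by blast

lemma tuple_space_scale: "p \<in> tuple_space n \<Longrightarrow> fscale c p \<in> tuple_space n"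
  unfolding tuple_space_def by (auto simp: in_keys_iff)

lemma tuple_space_zero [simp]: "0 \<in> tuple_space n"
  unfolding tuple_space_def by simp

lemma tuple_space_basis [simp]: "length xs = n \<Longrightarrow> basis_vec xs \<in> tuple_space n"
  unfolding tuple_space_def by simp

section \<open>Cosets\<close>

lemma coset_eq_iff:
  assumes "free.subspace N"
  shows "p +o N = q +o N \<longleftrightarrow> p - q \<in> N"
proof
  assume "p +o N = q +o N"
  then have "p \<in> q +o N" using free.subspace_0[OF assms] unfolding elt_set_plus_def by force
  then show "p - q \<in> N" unfolding elt_set_plus_def by auto
next
  assume pq: "p - q \<in> N"
  have "x +o N \<subseteq> y +o N" if "x - y \<in> N" for x y
  proof
    fix v assume "v \<in> x +o N"
    then obtain n where n: "n \<in> N" "v = x + n" unfolding elt_set_plus_def by blast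
    then have "v = y + ((x - y) + n)" by simp
    then show "v \<in> y +o N" using free.subspace_add[OF assms that n(1)] unfolding elt_set_plus_def by blast
  qed
  moreover have "q - p \<in> N" using free.subspace_neg[OF assms pq] by simp
  ultimately show "p +o N = q +o N" using pq by blast
qed

lemma coset_add:
  assumes "free.subspace N"
  shows "(p +o N) + (q +o N) = (p + q) +o N"
proof -
  have "N + N = N"
    using free.subspace_add[OF assms] free.subspace_0[OF assms] unfolding set_plus_def by force
  then show ?thesis by (simp add: set_plus_rearrange)
qed

lemma induced_const:
  assumes "\<And>x. x \<in> A \<Longrightarrow> f x = v" "A \<noteq> {}"
  shows "induced f A = v"
proof -
  have "f ` A = {v}" using assms by auto
  then show ?thesis unfolding induced_def by simp
qed

lemma induced_coset:
  assumes "\<And>n. n \<in> N \<Longrightarrow> f (p + n) = f p" "N \<noteq> {}"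
  shows "induced f (p +o N) = f p"
  by (rule induced_const) (use assms in \<open>auto simp: elt_set_plus_def\<close>)

section \<open>The boundary and the Koszul map on cosets\<close>

lemma list_length_2: "length xs = 2 \<Longrightarrow> \<exists>a b. xs = [a, b]"
  and list_length_3: "length xs = 3 \<Longrightarrow> \<exists>a b c. xs = [a, b, c]"
  and list_length_4: "length xs = 4 \<Longrightarrow> \<exists>a b c d. xs = [a, b, c, d]"
  by (auto simp: numeral_eq_Suc length_Suc_conv)

context lie_algebra
begin

definition alt_rels :: "nat \<Rightarrow> ('g list \<Rightarrow>\<^sub>0 'k) set" where
  "alt_rels n = multilinear_rels scale n \<union> {basis_vec xs | xs. length xs = n \<and> \<not> distinct xs}"

definition sym_rels :: "nat \<Rightarrow> ('g list \<Rightarrow>\<^sub>0 'k) set" where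
  "sym_rels n = multilinear_rels scale n \<union> {basis_vec xs - basis_vec ys | xs ys. length xs = n \<and> mset xs = mset ys}"

lemma ext_null_span: "ext_null scale n = fspan (alt_rels n)"
  by (simp add: ext_null_def alt_rels_def)

lemma sym_null_span: "sym_null scale n = fspan (sym_rels n)"
  by (simp add: sym_null_def sym_rels_def)

lemma multilinear_D:
  assumes "functional \<phi>" "\<forall>g\<in>multilinear_rels scale n. \<phi> g = 0" "length xs + 1 + length ys = n"
  shows "\<phi> (basis_vec (xs @ (x + y) # ys)) = \<phi> (basis_vec (xs @ x # ys)) + \<phi> (basis_vec (xs @ y # ys))"
    "\<phi> (basis_vec (xs @ scale c x # ys)) = c * \<phi> (basis_vec (xs @ x # ys))"
proof -
  have "basis_vec (xs @ (x + y) # ys) - basis_vec (xs @ x # ys) - basis_vec (xs @ y # ys) \<in> multilinear_rels scale n"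
    using assms(3) unfolding multilinear_rels_def by blast
  from bspec[OF assms(2) this] show "\<phi> (basis_vec (xs @ (x + y) # ys)) = \<phi> (basis_vec (xs @ x # ys)) + \<phi> (basis_vec (xs @ y # ys))"
    by (simp add: functional_diff[OF assms(1)] functional_add[OF assms(1)] algebra_simps)
  have "basis_vec (xs @ scale c x # ys) - fscale c (basis_vec (xs @ x # ys)) \<in> multilinear_rels scale n"
    using assms(3) unfolding multilinear_rels_def by blast
  from bspec[OF assms(2) this] show "\<phi> (basis_vec (xs @ scale c x # ys)) = c * \<phi> (basis_vec (xs @ x # ys))"
    by (simp add: functional_diff[OF assms(1)] functional_scale[OF assms(1)])
qed

lemma multilinear_I:
  assumes "functional \<phi>" 
    "\<And>xs x y ys. length xs + 1 + length ys = n \<Longrightarrow> \<phi> (basis_vec (xs @ (x + y) # ys)) = \<phi> (basis_vec (xs @ x # ys)) + \<phi> (basis_vec (xs @ y # ys))"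
    "\<And>xs c x ys. length xs + 1 + length ys = n \<Longrightarrow> \<phi> (basis_vec (xs @ scale c x # ys)) = c * \<phi> (basis_vec (xs @ x # ys))"
    "g \<in> multilinear_rels scale n"
  shows "\<phi> g = 0"
  using assms(4) unfolding multilinear_rels_def
  by (auto simp: functional_diff[OF assms(1)] functional_scale[OF assms(1)] assms(2,3))

lemma split_3:
  assumes "length xs + 1 + length ys = (3::nat)"
  obtains a b where "xs = []" "ys = [a, b]" | a b where "xs = [a]" "ys = [b]" | a b where "xs = [a, b]" "ys = []"
proof -
  have "length xs = 0 \<and> length ys = 2 \<or> length xs = 1 \<and> length ys = 1 \<or> length xs = 2 \<and> length ys = 0"
    using assms by arith
  then show ?thesis using that by (auto simp: numeral_eq_Suc length_Suc_conv)
qed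

lemma split_4:
  assumes "length xs + 1 + length ys = (4::nat)"
  obtains a b c where "xs = []" "ys = [a, b, c]" | a b c where "xs = [a]" "ys = [b, c]"
   | a b c where "xs = [a, b]" "ys = [c]" | a b c where "xs = [a, b, c]" "ys = []"
proof -
  have "length xs = 0 \<and> length ys = 3 \<or> length xs = 1 \<and> length ys = 2 \<or> length xs = 2 \<and> length ys = 1
    \<or> length xs = 3 \<and> length ys = 0"
    using assms by arith
  then show ?thesis using that by (auto simp: numeral_eq_Suc length_Suc_conv)
qed

abbreviation "bdry \<equiv> lin_ext boundary_tuple"

lemma fscale_minus_one [simp]: "fscale (- 1) p = - p" "fscale 1 p = p"
  by (rule poly_mapping_eqI; simp)+

lemma boundary_tuple_3: "boundary_tuple [x, y, z] =
  - basis_vec [bracket x y, z] + basis_vec [bracket x z, y] - basis_vec [bracket y z, x]"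
proof -
  have "{(i, j). i < j \<and> j < length [x, y, z]} = {(0, 1), (0, 2), (1, 2)}"
    by (auto simp: less_Suc_eq numeral_eq_Suc)
  then show ?thesis by (simp add: boundary_tuple_def nths_Cons numeral_eq_Suc)
qed

lemma boundary_tuple_4: "boundary_tuple [a, b, c, d] =
  - basis_vec [bracket a b, c, d] + basis_vec [bracket a c, b, d] - basis_vec [bracket a d, b, c]
  - basis_vec [bracket b c, a, d] + basis_vec [bracket b d, a, c] - basis_vec [bracket c d, a, b]"
proof -
  have "{(i, j). i < j \<and> j < length [a, b, c, d]} = {(0, 1), (0, 2), (0, 3), (1, 2), (1, 3), (2, 3)}"
    by (auto simp: less_Suc_eq numeral_eq_Suc)
  then show ?thesis by (simp add: boundary_tuple_def nths_Cons numeral_eq_Suc)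
qed

lemmas functional_rules = functional_add functional_diff functional_scale functional_zero

lemma functional_minus: "functional \<phi> \<Longrightarrow> \<phi> (- p) = - \<phi> p"
  using functional_diff[of \<phi> 0 p] functional_zero[of \<phi>] by simp

lemma alt_functional_2:
  assumes "functional \<phi>" "\<forall>g\<in>alt_rels 2. \<phi> g = 0"
  defines "A \<equiv> \<lambda>a b. \<phi> (basis_vec [a, b])"
  shows "A (x + y) z = A x z + A y z" "A z (x + y) = A z x + A z y"
    "A (scale c x) y = c * A x y" "A x (scale c y) = c * A x y" "A x x = 0"
proof -
  have m: "\<forall>g\<in>multilinear_rels scale 2. \<phi> g = 0" using assms(2) unfolding alt_rels_def by blast
  note M = multilinear_D[where \<phi> = \<phi> and n = 2, OF assms(1) m]
  show "A (x + y) z = A x z + A y z" "A z (x + y) = A z x + A z y"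
    "A (scale c x) y = c * A x y" "A x (scale c y) = c * A x y"
    unfolding A_def using M(1)[where xs = "[]" and ys = "[z]" and x = x and y = y] M(1)[where xs = "[z]" and ys = "[]" and x = x and y = y] M(2)[where xs = "[]" and ys = "[y]" and c = c and x = x] M(2)[where xs = "[x]" and ys = "[]" and c = c and x = y] by simp_all
  have "basis_vec [x, x] \<in> alt_rels 2" unfolding alt_rels_def by auto
  then show "A x x = 0" unfolding A_def by (rule bspec[OF assms(2)])
qed

lemma alt_functional_3:
  assumes "functional \<phi>" "\<forall>g\<in>alt_rels 3. \<phi> g = 0"
  defines "A \<equiv> \<lambda>a b c. \<phi> (basis_vec [a, b, c])"
  shows "A (x + y) z w = A x z w + A y z w" "A z (x + y) w = A z x w + A z y w" "A z w (x + y) = A z w x + A z w y"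
    "A (scale c x) y z = c * A x y z" "A x (scale c y) z = c * A x y z" "A x y (scale c z) = c * A x y z"
    "A x x y = 0" "A x y x = 0" "A y x x = 0"
proof -
  have m: "\<forall>g\<in>multilinear_rels scale 3. \<phi> g = 0" using assms(2) unfolding alt_rels_def by blast
  note M = multilinear_D[where \<phi> = \<phi> and n = 3, OF assms(1) m]
  show "A (x + y) z w = A x z w + A y z w" "A z (x + y) w = A z x w + A z y w" "A z w (x + y) = A z w x + A z w y"
    unfolding A_def using M(1)[where xs = "[]" and ys = "[z, w]" and x = x and y = y] M(1)[where xs = "[z]" and ys = "[w]" and x = x and y = y] M(1)[where xs = "[z, w]" and ys = "[]" and x = x and y = y] by simp_all
  show "A (scale c x) y z = c * A x y z" "A x (scale c y) z = c * A x y z" "A x y (scale c z) = c * A x y z"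
    unfolding A_def using M(2)[where xs = "[]" and ys = "[y, z]" and c = c and x = x] M(2)[where xs = "[x]" and ys = "[z]" and c = c and x = y] M(2)[where xs = "[x, y]" and ys = "[]" and c = c and x = z] by simp_all
  have "basis_vec [x, x, y] \<in> alt_rels 3" "basis_vec [x, y, x] \<in> alt_rels 3" "basis_vec [y, x, x] \<in> alt_rels 3"
    unfolding alt_rels_def by auto
  then show "A x x y = 0" "A x y x = 0" "A y x x = 0" unfolding A_def using assms(2) by blast+
qed

lemma alt_rels_3_I:
  assumes "functional \<phi>"
  defines "A \<equiv> \<lambda>a b c. \<phi> (basis_vec [a, b, c])"
  assumes "\<And>x y z w. A (x + y) z w = A x z w + A y z w" "\<And>x y z w. A z (x + y) w = A z x w + A z y w" 
    "\<And>x y z w. A z w (x + y) = A z w x + A z w y"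
    "\<And>c x y z. A (scale c x) y z = c * A x y z" "\<And>c x y z. A x (scale c y) z = c * A x y z" "\<And>c x y z. A x y (scale c z) = c * A x y z"
    "\<And>x y. A x x y = 0" "\<And>x y. A x y x = 0" "\<And>x y. A y x x = 0"
    and g: "g \<in> alt_rels 3"
  shows "\<phi> g = 0"
proof -
  from g consider "g \<in> multilinear_rels scale 3" | xs where "g = basis_vec xs" "length xs = 3" "\<not> distinct xs"
    unfolding alt_rels_def by blast
  then show ?thesis
  proof cases
    case 1
    then show ?thesis
    proof (rule multilinear_I[OF assms(1), rotated 2])
      fix xs ys :: "'g list" and x y assume "length xs + 1 + length ys = 3"
      then show "\<phi> (basis_vec (xs @ (x + y) # ys)) = \<phi> (basis_vec (xs @ x # ys)) + \<phi> (basis_vec (xs @ y # ys))"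
        by (rule split_3) (use assms(3-5) in \<open>simp_all add: A_def\<close>)
    next
      fix xs ys :: "'g list" and x c assume "length xs + 1 + length ys = 3"
      then show "\<phi> (basis_vec (xs @ scale c x # ys)) = c * \<phi> (basis_vec (xs @ x # ys))"
        by (rule split_3) (use assms(6-8) in \<open>simp_all add: A_def\<close>)
    qed
  next
    case 2
    then obtain a b c where "xs = [a, b, c]" using list_length_3 by blast
    then show ?thesis using 2 assms(9-11) unfolding A_def by auto
  qed
qed

lemma alt_skew_3:
  assumes "functional \<phi>" "\<forall>g\<in>alt_rels 3. \<phi> g = 0"
  shows "\<phi> (basis_vec [y, x, z]) = - \<phi> (basis_vec [x, y, z])" "\<phi> (basis_vec [x, z, y]) = - \<phi> (basis_vec [x, y, z])"
proof -
  note A = alt_functional_3[OF assms]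
  have "\<phi> (basis_vec [x + y, x + y, z]) = \<phi> (basis_vec [x, y, z]) + \<phi> (basis_vec [y, x, z])"
    using A(1)[of x y "x + y" z] A(2)[of x x y z] A(2)[of y x y z] A(7)[of x z] A(7)[of y z] by simp
  then show "\<phi> (basis_vec [y, x, z]) = - \<phi> (basis_vec [x, y, z])" using A(7)[of "x + y" z] by algebra
  have "\<phi> (basis_vec [x, y + z, y + z]) = \<phi> (basis_vec [x, y, z]) + \<phi> (basis_vec [x, z, y])"
    using A(2)[of x y z "y + z"] A(3)[of x y y z] A(3)[of x z y z] A(9)[of x y] A(9)[of x z] by simp
  then show "\<phi> (basis_vec [x, z, y]) = - \<phi> (basis_vec [x, y, z])" using A(9)[of x "y + z"] by algebra
qed

text \<open>Checked dually: an alternating functional of degree 2 composed with \<open>bdry\<close>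
  is alternating of degree 3.\<close>

lemma boundary_null_3:
  assumes "p \<in> ext_null scale 3"
  shows "bdry p \<in> ext_null scale 2"
  unfolding ext_null_span
proof (rule in_spanI)
  fix \<phi> :: "('g list \<Rightarrow>\<^sub>0 'k) \<Rightarrow> 'k" assume \<phi>: "functional \<phi>" "\<forall>g\<in>alt_rels 2. \<phi> g = 0"
  note A = alt_functional_2[OF \<phi>]
  show "\<phi> (bdry p) = 0"
  proof (rule functional_span[OF functional_comp[OF \<phi>(1)] _ assms[unfolded ext_null_span]])
    fix g assume "g \<in> alt_rels 3"
    then show "\<phi> (bdry g) = 0"
    proof (rule alt_rels_3_I[OF functional_comp[OF \<phi>(1)], rotated -1])
      have n: "\<phi> (basis_vec [- x, y]) = - \<phi> (basis_vec [x, y])" for x y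
        using A(3)[of "-1" x y] by simp
      show "\<phi> (bdry (basis_vec [x, x, y])) = 0" "\<phi> (bdry (basis_vec [x, y, x])) = 0" "\<phi> (bdry (basis_vec [y, x, x])) = 0" for x y
        using A(3)[of 0 0] n[of "bracket x y" x] br_skew[of y x]
        by (simp_all add: boundary_tuple_3 functional_rules[OF \<phi>(1)] functional_minus[OF \<phi>(1)] bracket_self)
    qed (simp_all add: boundary_tuple_3 functional_rules[OF \<phi>(1)] functional_minus[OF \<phi>(1)]
       br_add_left br_add_right br_scale_left br_scale_right A(1-4) algebra_simps)
  qed
qed

lemma boundary_null_4:
  assumes "p \<in> ext_null scale 4"
  shows "bdry p \<in> ext_null scale 3"
  unfolding ext_null_span
proof (rule in_spanI)
  fix \<phi> :: "('g list \<Rightarrow>\<^sub>0 'k) \<Rightarrow> 'k" assume \<phi>: "functional \<phi>" "\<forall>g\<in>alt_rels 3. \<phi> g = 0"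
  note A = alt_functional_3[OF \<phi>] and S = alt_skew_3[OF \<phi>]
  note R = boundary_tuple_4 functional_rules[OF \<phi>(1)] functional_minus[OF \<phi>(1)]
       br_add_left br_add_right br_scale_left br_scale_right bracket_self A
  have z: "\<phi> (basis_vec [0, y, z]) = 0" for y z using A(4)[of 0 0 y z] by simp
  have n: "\<phi> (basis_vec [bracket y x, v, w]) = - \<phi> (basis_vec [bracket x y, v, w])" for x y v w
    using A(4)[of "-1" "bracket x y" v w] br_skew[of y x] by simp
  show "\<phi> (bdry p) = 0"
  proof (rule functional_span[OF functional_comp[OF \<phi>(1)] _ assms[unfolded ext_null_span]])
    fix g assume "g \<in> alt_rels 4"
    then consider "g \<in> multilinear_rels scale 4" | xs where "g = basis_vec xs" "length xs = 4" "\<not> distinct xs"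
      unfolding alt_rels_def by blast
    then show "\<phi> (bdry g) = 0"
    proof cases
      case 1
      then show ?thesis
      proof (rule multilinear_I[OF functional_comp[OF \<phi>(1)], rotated 2])
        fix xs ys :: "'g list" and x y assume "length xs + 1 + length ys = 4"
        then show "\<phi> (bdry (basis_vec (xs @ (x + y) # ys))) = \<phi> (bdry (basis_vec (xs @ x # ys))) + \<phi> (bdry (basis_vec (xs @ y # ys)))"
          by (rule split_4) (simp_all add: R algebra_simps)
      next
        fix xs ys :: "'g list" and x c assume "length xs + 1 + length ys = 4"
        then show "\<phi> (bdry (basis_vec (xs @ scale c x # ys))) = c * \<phi> (bdry (basis_vec (xs @ x # ys)))"
          by (rule split_4) (simp_all add: R algebra_simps)
      qed
    next
      case 2
      then obtain a b c d where "xs = [a, b, c, d]" using list_length_4 by blast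
      \<comment> \<open>One case for each pair of equal positions. The surviving terms cancel in
        pairs, after a transposition by \<open>S\<close> or \<open>n\<close> where required.\<close>
      with 2 consider "xs = [a, a, c, d]" | "xs = [a, b, a, d]" | "xs = [a, b, c, a]" | "xs = [a, b, b, d]"
        | "xs = [a, b, c, b]" | "xs = [a, b, c, c]" by auto
      then show ?thesis
      proof cases
        case 1
        then show ?thesis using 2(1) by (simp add: R z)
      next
        case 2
        then show ?thesis using \<open>g = basis_vec xs\<close> n[of a b a d] S(2)[of "bracket a d" a b] by (simp add: R z)
      next
        case 3
        then show ?thesis using \<open>g = basis_vec xs\<close> n[of a b a c] n[of a c a b] S(2)[of "bracket a b" c a] S(2)[of "bracket a c" b a] by (simp add: R z)
      next
        case 4
        then show ?thesis using \<open>g = basis_vec xs\<close> S(2)[of "bracket a b" b d] by (simp add: R z)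
      next
        case 5
        then show ?thesis using \<open>g = basis_vec xs\<close> n[of b c a b] S(2)[of "bracket a b" b c] by (simp add: R z)
      next
        case 6
        then show ?thesis using \<open>g = basis_vec xs\<close> by (simp add: R z)
      qed
    qed
  qed
qed

abbreviation "S2 \<equiv> sym_null scale 2"

abbreviation "kill \<equiv> lin_ext (\<lambda>xs. basis_vec [bracket (xs ! 0) (xs ! 1), xs ! 2] - basis_vec [xs ! 0, bracket (xs ! 1) (xs ! 2)])"

abbreviation "koszul \<equiv> lin_ext (\<lambda>xs. basis_vec [xs ! 0, bracket (xs ! 1) (xs ! 2)])"

lemma subspace_S2: "free.subspace S2" and subspace_ext_null: "free.subspace (ext_null scale n)"
  unfolding sym_null_def ext_null_def by (rule free.subspace_span)+

lemma sym_functional_2: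
  assumes "functional \<phi>" "\<forall>g\<in>sym_rels 2. \<phi> g = 0"
  defines "A \<equiv> \<lambda>a b. \<phi> (basis_vec [a, b])"
  shows "A (x + y) z = A x z + A y z" "A z (x + y) = A z x + A z y"
    "A (scale c x) y = c * A x y" "A x (scale c y) = c * A x y" "A x y = A y x"
proof -
  have m: "\<forall>g\<in>multilinear_rels scale 2. \<phi> g = 0" using assms(2) unfolding sym_rels_def by blast
  note M = multilinear_D[where \<phi> = \<phi> and n = 2, OF assms(1) m]
  show "A (x + y) z = A x z + A y z" "A z (x + y) = A z x + A z y"
    "A (scale c x) y = c * A x y" "A x (scale c y) = c * A x y"
    unfolding A_def using M(1)[where xs = "[]" and ys = "[z]" and x = x and y = y] M(1)[where xs = "[z]" and ys = "[]" and x = x and y = y]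
     M(2)[where xs = "[]" and ys = "[y]" and c = c and x = x] M(2)[where xs = "[x]" and ys = "[]" and c = c and x = y] by simp_all
  have "length [x, y] = 2 \<and> mset [x, y] = mset [y, x]" by simp
  then have "basis_vec [x, y] - basis_vec [y, x] \<in> sym_rels 2" unfolding sym_rels_def by blast
  from bspec[OF assms(2) this] show "A x y = A y x" by (simp add: A_def functional_diff[OF assms(1)])
qed

lemma kill_tensor_null:
  assumes "p \<in> tensor_null scale 3"
  shows "kill p \<in> S2"
  unfolding sym_null_span
proof (rule in_spanI)
  fix \<phi> :: "('g list \<Rightarrow>\<^sub>0 'k) \<Rightarrow> 'k" assume \<phi>: "functional \<phi>" "\<forall>g\<in>sym_rels 2. \<phi> g = 0"
  note A = sym_functional_2(1-4)[OF \<phi>]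
  note R = functional_rules[OF \<phi>(1)] br_add_left br_add_right br_scale_left br_scale_right A
  show "\<phi> (kill p) = 0"
  proof (rule functional_span[OF functional_comp[OF \<phi>(1)] _ assms[unfolded tensor_null_def]])
    fix g assume "g \<in> multilinear_rels scale 3"
    then show "\<phi> (kill g) = 0"
    proof (rule multilinear_I[OF functional_comp[OF \<phi>(1)], rotated 2])
      fix xs ys :: "'g list" and x y assume "length xs + 1 + length ys = 3"
      then show "\<phi> (kill (basis_vec (xs @ (x + y) # ys))) = \<phi> (kill (basis_vec (xs @ x # ys))) + \<phi> (kill (basis_vec (xs @ y # ys)))"
        by (rule split_3) (simp_all add: R numeral_2_eq_2)
    next
      fix xs ys :: "'g list" and x c assume "length xs + 1 + length ys = 3"
      then show "\<phi> (kill (basis_vec (xs @ scale c x # ys))) = c * \<phi> (kill (basis_vec (xs @ x # ys)))"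
        by (rule split_3) (simp_all add: R numeral_2_eq_2 algebra_simps)
    qed
  qed
qed

lemma coset_image: "x +o (f ` A) = (\<lambda>a. x + f a) ` A"
  unfolding elt_set_plus_def by blast

lemma coset_cong:
  assumes "free.subspace N" "p - q \<in> N" shows "p +o N = q +o N"
  using coset_eq_iff[OF assms(1)] assms(2) by blast

lemma killing_null_eq: "killing_null = (\<lambda>r. kill r +o S2) ` tuple_space 3"
proof -
  have "killing_map (r +o tensor_null scale 3) = kill r +o S2" for r
    unfolding killing_map_def
  proof (rule induced_coset)
    show "kill (r + n) +o S2 = kill r +o S2" if "n \<in> tensor_null scale 3" for n
      by (rule coset_cong[OF subspace_S2]) (use kill_tensor_null[OF that] in \<open>simp add: lin_ext_add\<close>)
    show "tensor_null scale 3 \<noteq> {}" unfolding tensor_null_def using free.span_zero by blast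
  qed
  then show ?thesis unfolding killing_null_def tensor_power_def quotient_space_def image_image by simp
qed

lemma killing_class_eq: "killing_class p = (\<lambda>r. (p + kill r) +o S2) ` tuple_space 3"
proof -
  show ?thesis
    unfolding killing_class_def killing_null_eq by (simp only: coset_image coset_add[OF subspace_S2])
qed

text \<open>A class in \<open>Kill(g)\<close> is a set of cosets of \<open>S2\<close> indexed by
  \<open>tuple_space 3\<close>. Adding \<open>kill r\<close> translates the index set, and adding an
  element of \<open>S2\<close> changes no coset.\<close>

lemma killing_class_zero:
  assumes "r \<in> tuple_space 3" "s \<in> S2"
  shows "killing_class (kill r + s) = killing_class 0"
proof -
  have "(kill r + s + kill r') +o S2 = (0 + kill (r + r')) +o S2" for r'
    by (rule coset_cong[OF subspace_S2]) (use assms(2) in \<open>simp add: lin_ext_add algebra_simps\<close>)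
  then have 1: "killing_class (kill r + s) = (\<lambda>r'. (0 + kill (r + r')) +o S2) ` tuple_space 3"
    unfolding killing_class_eq by simp
  have "(+) r ` tuple_space 3 = tuple_space 3"
  proof
    show "(+) r ` tuple_space 3 \<subseteq> tuple_space 3" using tuple_space_add[OF assms(1)] by blast
    show "tuple_space 3 \<subseteq> (+) r ` tuple_space 3"
    proof
      fix q :: "'g list \<Rightarrow>\<^sub>0 'k" assume q: "q \<in> tuple_space 3"
      have "q = r + (q + fscale (-1) r)" by simp
      then show "q \<in> (+) r ` tuple_space 3"
        using tuple_space_add[OF q tuple_space_scale[OF assms(1), of "-1"]] by blast
    qed
  qed
  then have "(\<lambda>r'. (0 + kill (r + r')) +o S2) ` tuple_space 3 = (\<lambda>r. (0 + kill r) +o S2) ` tuple_space 3"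
    by (metis (no_types, lifting) image_cong image_image)
  with 1 show ?thesis unfolding killing_class_eq[of 0] by (rule trans)
qed

lemma boundary_coset:
  assumes "\<And>m. m \<in> ext_null scale n \<Longrightarrow> bdry m \<in> ext_null scale (n - 1)"
  shows "boundary n (p +o ext_null scale n) = bdry p +o ext_null scale (n - 1)"
  unfolding boundary_def
proof (rule induced_coset)
  show "bdry (p + m) +o ext_null scale (n - 1) = bdry p +o ext_null scale (n - 1)" if "m \<in> ext_null scale n" for m
    by (rule coset_cong[OF subspace_ext_null]) (use assms[OF that] in \<open>simp add: lin_ext_add\<close>)
  show "ext_null scale n \<noteq> {}" unfolding ext_null_def using free.span_zero by blast
qed

text \<open>
  A functional that vanishes on \<open>killing_null\<close> is an invariant symmetric form \<open>\<beta>\<close>, and on a cycle its composition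
  with the Koszul map is evaluation of \<open>\<beta> [x, y] z\<close>, hence of a primitive \<open>\<alpha>\<close> on the boundary of the cycle.
\<close>

lemma koszul_zeroI:
  assumes "p \<in> tuple_space 3" "bdry p \<in> ext_null scale 2" "q \<in> tuple_space 4" "m \<in> ext_null scale 3"
    and ex: "\<And>\<beta>. (\<And>x y z. \<beta> (x + y) z = \<beta> x z + \<beta> y z) \<Longrightarrow> (\<And>c x y. \<beta> (scale c x) y = c * \<beta> x y)
      \<Longrightarrow> (\<And>x y. \<beta> x y = \<beta> y x) \<Longrightarrow> (\<And>x y z. \<beta> (bracket x y) z = \<beta> x (bracket y z))
      \<Longrightarrow> \<exists>\<alpha>. (\<forall>x y z. \<alpha> (x + y) z = \<alpha> x z + \<alpha> y z) \<and> (\<forall>x y z. \<alpha> z (x + y) = \<alpha> z x + \<alpha> z y) \<and>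
         (\<forall>c x y. \<alpha> (scale c x) y = c * \<alpha> x y) \<and> (\<forall>c x y. \<alpha> x (scale c y) = c * \<alpha> x y) \<and> (\<forall>x. \<alpha> x x = 0) \<and>
         (\<forall>x y z. \<beta> (bracket x y) z = \<alpha> (bracket x y) z + \<alpha> (bracket y z) x + \<alpha> (bracket z x) y)"
  shows "killing_class (koszul (p + bdry q + m)) = killing_class 0"
proof -
  \<comment> \<open>The preimage of \<open>killing_null\<close> in the free space. It is a subspace,
    so membership can be tested by functionals.\<close>
  define M where "M = {kill r + s | r s. r \<in> tuple_space 3 \<and> s \<in> S2}"
  have "koszul (p + bdry q + m) \<in> fspan M"
  proof (rule in_spanI)
    fix \<phi> :: "('g list \<Rightarrow>\<^sub>0 'k) \<Rightarrow> 'k" assume \<phi>: "functional \<phi>" "\<forall>g\<in>M. \<phi> g = 0"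
    have phiS: "\<phi> s = 0" if "s \<in> S2" for s
    proof -
      have "kill 0 + s \<in> M" unfolding M_def using that tuple_space_zero by blast
      then show ?thesis using \<phi>(2) by simp
    qed
    have \<phi>': "\<forall>g\<in>sym_rels 2. \<phi> g = 0"
      using phiS free.span_base[of _ "sym_rels 2"] unfolding sym_null_span by blast
    define \<beta> where "\<beta> a b = \<phi> (basis_vec [a, b])" for a b
    note A = sym_functional_2[where \<phi> = \<phi>, OF \<phi>(1) \<phi>', folded \<beta>_def]
    have inv: "\<beta> (bracket x y) z = \<beta> x (bracket y z)" for x y z
    proof -
      have "kill (basis_vec [x, y, z]) + 0 \<in> M"
        unfolding M_def using free.subspace_0[OF subspace_S2] tuple_space_basis[of "[x, y, z]" 3] by fastforce
      from bspec[OF \<phi>(2) this] show ?thesis by (simp add: functional_diff[OF \<phi>(1)] \<beta>_def numeral_2_eq_2)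
    qed
    from ex[of \<beta>, OF A(1,3,5) inv] obtain \<alpha> where \<alpha>':
      "\<forall>x y z. \<alpha> (x + y) z = \<alpha> x z + \<alpha> y z" "\<forall>x y z. \<alpha> z (x + y) = \<alpha> z x + \<alpha> z y"
      "\<forall>c x y. \<alpha> (scale c x) y = c * \<alpha> x y" "\<forall>c x y. \<alpha> x (scale c y) = c * \<alpha> x y" "\<forall>x. \<alpha> x x = 0"
      "\<forall>x y z. \<beta> (bracket x y) z = \<alpha> (bracket x y) z + \<alpha> (bracket y z) x + \<alpha> (bracket z x) y"
      by (elim exE conjE)
    note \<alpha> = \<alpha>'[rule_format]
    define \<Phi> where "\<Phi> p = \<phi> (koszul p)" for p
    have \<Phi>: "functional \<Phi>" unfolding \<Phi>_def by (rule functional_comp[OF \<phi>(1)])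
    have \<Phi>b: "\<Phi> (basis_vec [x, y, z]) = \<beta> x (bracket y z)" for x y z
      by (simp add: \<Phi>_def \<beta>_def numeral_2_eq_2)
    have neg: "\<beta> x (- y) = - \<beta> x y" for x y using A(4)[of x "-1" y] by simp
    have \<beta>0: "\<beta> x 0 = 0" for x using A(4)[of x 0 0] by simp
    have yy: "\<beta> x (bracket x y) = 0" for x y using inv[of x x y] A(3)[of 0 0 y] by (simp add: bracket_self)
    have "\<Phi> m = 0"
    proof (rule functional_span[OF \<Phi> _ assms(4)[unfolded ext_null_span]])
      fix g assume "g \<in> alt_rels 3"
      then show "\<Phi> g = 0"
      proof (rule alt_rels_3_I[OF \<Phi>, rotated -1])
        show "\<Phi> (basis_vec [x, y, x]) = 0" for x y using yy[of x y] br_skew[of y x] neg[of x "bracket x y"] by (simp add: \<Phi>b)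
      qed (simp_all add: \<Phi>b A(1-4) br_add_left br_add_right br_scale_left br_scale_right bracket_self \<beta>0 yy algebra_simps)
    qed
    moreover have "\<Phi> (bdry q) = 0"
    proof (rule functional_tuple_space[OF functional_comp[OF \<Phi>] _ assms(3)])
      fix xs :: "'g list" assume "length xs = 4"
      then obtain a b c d where xs: "xs = [a, b, c, d]" using list_length_4 by blast
      \<comment> \<open>Jacobi paired with \<open>d\<close>, which is the cocycle identity for the
        3-form; it makes \<open>\<Phi>\<close> vanish on boundaries.\<close>
      have J: "\<beta> (bracket a b) (bracket c d) + \<beta> (bracket b c) (bracket a d) + \<beta> (bracket c a) (bracket b d) = 0"
      proof -
        have "\<beta> (bracket a b) (bracket c d) + \<beta> (bracket b c) (bracket a d) + \<beta> (bracket c a) (bracket b d)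
          = \<beta> (bracket (bracket a b) c + bracket (bracket b c) a + bracket (bracket c a) b) d"
          by (simp only: inv[symmetric] A(1))
        also have "bracket (bracket a b) c + bracket (bracket b c) a + bracket (bracket c a) b
            = - (bracket c (bracket a b) + bracket a (bracket b c) + bracket b (bracket c a))"
          using br_skew[of "bracket a b" c] br_skew[of "bracket b c" a] br_skew[of "bracket c a" b] by simp
        also have "\<dots> = 0" using jacobi[of c a b] by simp
        finally show ?thesis using A(3)[of 0 0 d] by simp
      qed
      have ac: "\<beta> (bracket c a) (bracket b d) = - \<beta> (bracket a c) (bracket b d)"
        using neg[of "bracket b d" "bracket a c"] br_skew[of c a] A(5) by metis
      have J': "\<beta> (bracket a b) (bracket c d) = \<beta> (bracket a c) (bracket b d) - \<beta> (bracket a d) (bracket b c)"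
        using J ac A(5)[of "bracket b c" "bracket a d"] by algebra
      show "\<Phi> (bdry (basis_vec xs)) = 0"
        using J' A(5)[of "bracket b d" "bracket a c"] A(5)[of "bracket b c" "bracket a d"] A(5)[of "bracket c d" "bracket a b"]
        unfolding xs by (simp add: boundary_tuple_4 functional_rules[OF \<Phi>] functional_minus[OF \<Phi>] \<Phi>b)
    qed
    moreover have "\<Phi> p = 0"
    proof -
      define \<psi> where "\<psi> = scalar_ext (\<lambda>xs. \<alpha> (xs ! 0) (xs ! 1))"
      have \<psi>: "functional \<psi>" unfolding \<psi>_def by (rule functional_scalar_ext)
      have \<psi>b: "\<psi> (basis_vec [x, y]) = \<alpha> x y" for x y by (simp add: \<psi>_def)
      have askew: "\<alpha> x y = - \<alpha> y x" for x y
        using \<alpha>(1)[of x y "x + y"] \<alpha>(2)[of x x y] \<alpha>(2)[of y x y] \<alpha>(5) by (metis add.right_neutral add_0 eq_neg_iff_add_eq_0)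
      have "\<psi> (bdry p) = 0"
      proof (rule functional_span[OF \<psi> _ assms(2)[unfolded ext_null_span]])
        fix g assume "g \<in> alt_rels 2"
        then consider "g \<in> multilinear_rels scale 2" | xs where "g = basis_vec xs" "length xs = 2" "\<not> distinct xs"
          unfolding alt_rels_def by blast
        then show "\<psi> g = 0"
        proof cases
          case 1
          have sp: "(\<exists>b. xs = [] \<and> ys = [b]) \<or> (\<exists>a. xs = [a] \<and> ys = [])" if "length xs + 1 + length ys = 2" for xs ys :: "'g list"
          proof -
            have "length xs = 0 \<and> length ys = 1 \<or> length xs = 1 \<and> length ys = 0" using that by arith
            then show ?thesis by (auto simp: length_Suc_conv)
          qed
          show ?thesis
            by (rule multilinear_I[OF \<psi> _ _ 1]; drule sp) (auto simp: \<psi>b \<alpha>(1-4))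
        next
          case 2
          then show ?thesis using list_length_2[of xs] \<alpha>(5) by (auto simp: \<psi>b)
        qed
      qed
      \<comment> \<open>A sum, because the boundary of \<open>x \<and> y \<and> z\<close> starts
        with \<open>- [x, y] \<and> z\<close>: composing it with \<open>\<alpha>\<close> gives minus
        the 3-form.\<close>
      have "\<Phi> p + \<psi> (bdry p) = 0"
      proof (rule functional_tuple_space[where \<phi> = "\<lambda>p. \<Phi> p + \<psi> (bdry p)", OF _ _ assms(1)])
        show "functional (\<lambda>p. \<Phi> p + \<psi> (bdry p))"
          using \<Phi> functional_comp[OF \<psi>, of boundary_tuple] by (simp add: functional_def algebra_simps)
        fix xs :: "'g list" assume "length xs = 3"
        then obtain x y z where xs: "xs = [x, y, z]" using list_length_3 by blast
        have "\<alpha> (bracket z x) y = - \<alpha> (bracket x z) y" using \<alpha>(3)[of "-1" "bracket x z" y] br_skew[of z x] by simp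
        then show "\<Phi> (basis_vec xs) + \<psi> (bdry (basis_vec xs)) = 0"
          unfolding xs by (simp add: \<Phi>b boundary_tuple_3 functional_rules[OF \<psi>] functional_minus[OF \<psi>] \<psi>b inv[symmetric] \<alpha>(6))
      qed
      with \<open>\<psi> (bdry p) = 0\<close> show ?thesis by simp
    qed
    ultimately have "\<Phi> (p + bdry q + m) = 0" by (simp add: functional_rules[OF \<Phi>])
    then show "\<phi> (koszul (p + bdry q + m)) = 0" by (simp add: \<Phi>_def)
  qed
  moreover have "fspan M \<subseteq> M"
  proof (rule free.span_minimal)
    show "free.subspace M"
      unfolding free.subspace_def
    proof (intro conjI ballI allI)
      have "0 = kill 0 + 0" by simp
      then show "0 \<in> M" unfolding M_def using free.subspace_0[OF subspace_S2] tuple_space_zero by blast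
      fix a b assume "a \<in> M" "b \<in> M"
      then obtain r s r' s' where "r \<in> tuple_space 3" "s \<in> S2" "r' \<in> tuple_space 3" "s' \<in> S2" "a = kill r + s" "b = kill r' + s'"
        unfolding M_def by blast
      moreover from this have "a + b = kill (r + r') + (s + s')" by (simp add: lin_ext_add)
      ultimately show "a + b \<in> M" unfolding M_def using tuple_space_add free.subspace_add[OF subspace_S2] by blast
    next
      fix c a assume "a \<in> M"
      then obtain r s where "r \<in> tuple_space 3" "s \<in> S2" "a = kill r + s" unfolding M_def by blast
      moreover from this have "fscale c a = kill (fscale c r) + fscale c s" by (simp add: lin_ext_scale free.scale_right_distrib)
      ultimately show "fscale c a \<in> M" unfolding M_def using tuple_space_scale free.subspace_scale[OF subspace_S2] by blast
    qed
  qed blast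
  ultimately obtain r s where "r \<in> tuple_space 3" "s \<in> S2" "koszul (p + bdry q + m) = kill r + s" unfolding M_def by blast
  then show ?thesis using killing_class_zero by simp
qed

end

theorem theorem5p1:
  fixes scale :: "'k::field_char_0 \<Rightarrow> 'g::ab_group_add \<Rightarrow> 'g"
    and bracket :: "'g \<Rightarrow> 'g \<Rightarrow> 'g"
    and Basis :: "'g set"
  assumes "lie_algebra scale bracket"
    and "finite_dimensional_vector_space scale Basis"
    and "vector_space.dim scale (UNIV :: 'g set) \<le> 9"
    and "lie_algebra.nilpotent scale bracket"
  shows "\<forall>c\<in>lie_algebra.homology scale bracket 3.
           lie_algebra.reduced_koszul_map scale bracket c = lie_algebra.killing_class scale bracket 0"
proof
  interpret lie_algebra scale bracket by (rule assms(1))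
  interpret finite_dimensional_vector_space scale Basis by (rule assms(2))
  let ?N = "ext_null scale 3"
  fix c assume "c \<in> homology 3"
  then obtain p where p: "p \<in> tuple_space 3" "boundary 3 (p +o ?N) = 0 +o ext_null scale 2" "c = (p +o ?N) +o boundaries 3"
    unfolding homology_def quotient_space_def cycles_def ext_power_def by auto
  have "bdry p +o ext_null scale 2 = 0 +o ext_null scale 2"
    using p(2) boundary_coset[of 3 p] boundary_null_3 by simp
  then have bp: "bdry p \<in> ext_null scale 2"
    using coset_eq_iff[OF subspace_ext_null, of "bdry p" 2 0] by simp
  have "boundaries 3 = (\<lambda>q. bdry q +o ?N) ` tuple_space 4"
    unfolding boundaries_def ext_power_def quotient_space_def image_image
    using boundary_coset[of 4] boundary_null_4 by simp
  then have c: "c = (\<lambda>q. (p + bdry q) +o ?N) ` tuple_space 4"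
    unfolding p(3) by (simp only: coset_image coset_add[OF subspace_ext_null])
  have ex: "\<exists>\<alpha>. (\<forall>x y z. \<alpha> (x + y) z = \<alpha> x z + \<alpha> y z) \<and> (\<forall>x y z. \<alpha> z (x + y) = \<alpha> z x + \<alpha> z y) \<and>
         (\<forall>c x y. \<alpha> (scale c x) y = c * \<alpha> x y) \<and> (\<forall>c x y. \<alpha> x (scale c y) = c * \<alpha> x y) \<and> (\<forall>x. \<alpha> x x = 0) \<and>
         (\<forall>x y z. \<beta> (bracket x y) z = \<alpha> (bracket x y) z + \<alpha> (bracket y z) x + \<alpha> (bracket z x) y)"
    if \<beta>: "\<And>x y z. \<beta> (x + y) z = \<beta> x z + \<beta> y z" "\<And>c x y. \<beta> (scale c x) y = c * \<beta> x y"
      "\<And>x y. \<beta> x y = \<beta> y x" "\<And>x y z. \<beta> (bracket x y) z = \<beta> x (bracket y z)" for \<beta>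
  proof -
    interpret q: small_quadratic_lie scale bracket Basis \<beta>
      by unfold_locales (fact \<beta> assms(3,4))+
    from q.exact_om obtain \<alpha> where "q.alt_form \<alpha>" "\<forall>x y z. q.om x y z = \<alpha> (bracket x y) z + \<alpha> (bracket y z) x + \<alpha> (bracket z x) y"
      unfolding q.exact_def by (elim exE conjE)
    then show ?thesis unfolding q.alt_form_def q.linform_def q.om_def by (intro exI[of _ \<alpha>]) simp
  qed
  \<comment> \<open>A homology class is a set of cosets, and \<open>induced\<close> is applied at
    both levels. So all representatives have to be covered, with \<open>bdry q\<close> and
    \<open>m\<close> as the two ambiguities.\<close>
  have koszul_zero: "koszul_map A = killing_class 0" if A: "A \<in> c" for A
  proof -
    obtain q where q: "q \<in> tuple_space 4" "A = (p + bdry q) +o ?N" using A unfolding c by blast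
    show ?thesis
      unfolding koszul_map_def
    proof (rule induced_const)
      show "killing_class (koszul x) = killing_class 0" if x: "x \<in> A" for x
      proof -
        obtain m where "m \<in> ?N" "x = p + bdry q + m" using x unfolding q(2) elt_set_plus_def by blast
        then show ?thesis using koszul_zeroI[OF p(1) bp q(1) _ ex] by simp
      qed
      show "A \<noteq> {}" unfolding q(2) elt_set_plus_def using free.subspace_0[OF subspace_ext_null] by blast
    qed
  qed
  show "reduced_koszul_map c = killing_class 0"
    unfolding reduced_koszul_map_def
  proof (rule induced_const)
    show "c \<noteq> {}" unfolding c using tuple_space_zero by blast
  qed (rule koszul_zero)
qed

end
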